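(* For any fixed $p, q, \epsilon \in (0,1)$, the mixing time of the symmetric simple exclusion process on $[N]=\{1,\dots,N\}$ with reservoirs of density $p$ at site $1$ and $q$ at site $N$ satisfies $$\mathrm{t}_{\mathrm{mix}}(\epsilon) = \frac{\log N}{2\pi^2} + \mathcal{O}_{p,q,\epsilon}(1),$$ i.e. there is a constant $K = K(p,q,\epsilon) < \infty$, not depending on $N$, such that $\left|\mathrm{t}_{\mathrm{mix}}(\epsilon) - \frac{\log N}{2\pi^2}\right| \le K$ for all $N \geq 1$.
   Context: For $N \in \mathbb{Z}_{+}$, $N\ge 1$, and $p,q\in[0,1]$, the SSEP with reservoirs is the continuous-time Markov process $(\eta_t)_{t\ge 0}$ on $\Omega = \{0,1\}^N$ with generator acting on $\varphi:\Omega\to\mathbb{R}$ by $$L\varphi(\eta) = \sum_{i=1}^{N-1} N^2\big(\varphi(\eta^{i\leftrightarrow i+1}) - \varphi(\eta)\big) + N^2\big[p\,\varphi(\eta^{1,1}) + (1-p)\varphi(\eta^{1,0}) - \varphi(\eta)\big] + N^2\big[q\,\varphi(\eta^{N,1}) + (1-q)\varphi(\eta^{N,0}) - \varphi(\eta)\big],$$ where $\eta^{i\leftrightarrow i+1}$ is obtained from $\eta$ by swapping coordinates $i$ and $i+1$, and $\eta^{i,0}$, $\eta^{i,1}$ are obtained by resetting coordinate $i$ to $0$, resp. $1$. (Note the acceleration of time by $N^2$.) For $p,q\in(0,1)$ the process is irreducible; let $\pi$ be its unique invariant distribution. The total variation distance is $\mathrm{d}_{\mathrm{TV}}(\mu,\nu)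 = \max_{A\subset\Omega}|\mu(A)-\nu(A)|$, the worst-case distance to equilibrium is $d(t) = \max_{\eta\in\Omega} \mathrm{d}_{\mathrm{TV}}(\mathbb{P}_\eta[\eta_t\in\cdot],\pi)$, where $\mathbb{P}_\eta$ is the law of the process started from $\eta$, and $\mathrm{t}_{\mathrm{mix}}(\epsilon) = \inf\{t\ge 0: d(t)\le \epsilon\}$. In $\frac{\log N}{2\pi^2}$, $\pi$ denotes the number $3.14159\ldots$. *)

theory Defs
  imports "HOL-Probability.Probability"
begin

section \<open>Continuous-time Markov chains on a finite state space\<close>

text \<open>
  A generator is an operator \<open>L\<close> on observables. The semigroup is \<open>P\<^sub>t = exp (t L)\<close>, so that
  \<open>markov_semigroup L t \<phi> x\<close> is the expectation of \<open>\<phi>(X\<^sub>t)\<close> for the chain started from \<open>x\<close>. That these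
  are indeed the laws of the Markov process with generator \<open>L\<close> is proved below (\<open>law_markov_process\<close>, \<open>law_ssep_process\<close>).
\<close>

definition markov_semigroup :: "(('s \<Rightarrow> real) \<Rightarrow> 's \<Rightarrow> real) \<Rightarrow> real \<Rightarrow> ('s \<Rightarrow> real) \<Rightarrow> 's \<Rightarrow> real" where
  "markov_semigroup L t \<phi> x = (\<Sum>n. t ^ n / fact n * (L ^^ n) \<phi> x)"

definition law :: "(('s \<Rightarrow> real) \<Rightarrow> 's \<Rightarrow> real) \<Rightarrow> real \<Rightarrow> 's \<Rightarrow> 's set \<Rightarrow> real" where
  "law L t x A = markov_semigroup L t (indicator A) x"

definition invariant_distribution ::
  "'s set \<Rightarrow> (('s \<Rightarrow> real) \<Rightarrow> 's \<Rightarrow> real) \<Rightarrow> 's pmf \<Rightarrow> bool" where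
  "invariant_distribution S L \<mu> \<longleftrightarrow>
     set_pmf \<mu> \<subseteq> S \<and>
     (\<forall>t\<ge>0. \<forall>A\<subseteq>S. (\<Sum>x\<in>S. pmf \<mu> x * law L t x A) = measure_pmf.prob \<mu> A)"

definition tv_dist :: "'s set \<Rightarrow> ('s set \<Rightarrow> real) \<Rightarrow> ('s set \<Rightarrow> real) \<Rightarrow> real" where
  "tv_dist S \<mu> \<nu> = (MAX A\<in>Pow S. \<bar>\<mu> A - \<nu> A\<bar>)"

section \<open>The exclusion process with reservoirs\<close>

text \<open>A configuration is an element of \<open>{0,1}\<^sup>N\<close>, with sites \<open>1, \<dots>, N\<close>.\<close>

type_synonym config = "nat \<Rightarrow> nat"

definition configs :: "nat \<Rightarrow> config set" where
  "configs N = {1..N} \<rightarrow>\<^sub>E {0, 1}"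

definition swap_sites :: "nat \<Rightarrow> config \<Rightarrow> config" where
  "swap_sites i \<eta> = \<eta>(i := \<eta> (i + 1), i + 1 := \<eta> i)"

definition ssep_generator :: "nat \<Rightarrow> real \<Rightarrow> real \<Rightarrow> (config \<Rightarrow> real) \<Rightarrow> config \<Rightarrow> real" where
  "ssep_generator N p q \<phi> \<eta> =
     (\<Sum>i\<in>{1..<N}. (real N)\<^sup>2 * (\<phi> (swap_sites i \<eta>) - \<phi> \<eta>))
     + (real N)\<^sup>2 * (p * \<phi> (\<eta>(1 := 1)) + (1 - p) * \<phi> (\<eta>(1 := 0)) - \<phi> \<eta>)
     + (real N)\<^sup>2 * (q * \<phi> (\<eta>(N := 1)) + (1 - q) * \<phi> (\<eta>(N := 0)) - \<phi> \<eta>)"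

text \<open>For \<open>p, q \<in> (0,1)\<close> the chain is irreducible, so the invariant distribution exists and is unique.\<close>

definition ssep_stationary :: "nat \<Rightarrow> real \<Rightarrow> real \<Rightarrow> config pmf" where
  "ssep_stationary N p q = (THE \<mu>. invariant_distribution (configs N) (ssep_generator N p q) \<mu>)"

definition ssep_distance :: "nat \<Rightarrow> real \<Rightarrow> real \<Rightarrow> real \<Rightarrow> real" where
  "ssep_distance N p q t =
     (MAX \<eta>\<in>configs N. tv_dist (configs N) (law (ssep_generator N p q) t \<eta>)
        (measure_pmf.prob (ssep_stationary N p q)))"

definition ssep_mixing_time :: "nat \<Rightarrow> real \<Rightarrow> real \<Rightarrow> real \<Rightarrow> real" where
  "ssep_mixing_time N p q \<epsilon> = Inf {t. 0 \<le> t \<and> ssep_distance N p q t \<le> \<epsilon>}"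

section \<open>The law of a Markov process with a given generator\<close>

text \<open>
  \<open>P x\<close> is the measure on paths under which the process \<open>X\<close> starts from \<open>x\<close>. The clauses are: paths
  in \<open>S\<close>, initial condition, time-homogeneous Markov property with respect to the natural
  filtration, and \<open>L\<close> being the derivative of the expectations at time \<open>0\<close>.
\<close>

definition markov_process ::
  "'s set \<Rightarrow> (('s \<Rightarrow> real) \<Rightarrow> 's \<Rightarrow> real) \<Rightarrow> ('s \<Rightarrow> 'w measure) \<Rightarrow> (real \<Rightarrow> 'w \<Rightarrow> 's) \<Rightarrow> bool" where
  "markov_process S L P X \<longleftrightarrow>
     (\<forall>x\<in>S. prob_space (P x)) \<and>
     (\<forall>x\<in>S. \<forall>t\<ge>0. X t \<in> P x \<rightarrow>\<^sub>M count_space S) \<and>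
     (\<forall>x\<in>S. measure (P x) {\<omega>\<in>space (P x). X 0 \<omega> = x} = 1) \<and>
     (\<forall>x\<in>S. \<forall>s\<ge>0. \<forall>t\<ge>0. \<forall>y\<in>S. \<forall>z\<in>S.
        \<forall>E\<in>sigma_sets (space (P x)) {{\<omega>\<in>space (P x). X u \<omega> = v} |u v. 0 \<le> u \<and> u \<le> s \<and> v \<in> S}.
          measure (P x) {\<omega>\<in>E. X s \<omega> = y \<and> X (s + t) \<omega> = z} =
          measure (P x) {\<omega>\<in>E. X s \<omega> = y} * measure (P y) {\<omega>\<in>space (P y). X t \<omega> = z}) \<and>
     (\<forall>x\<in>S. \<forall>\<phi>. ((\<lambda>t. ((\<integral>\<omega>. \<phi> (X t \<omega>) \<partial>P x) - \<phi> x) / t) \<longlongrightarrow> L \<phi> x) (at_right 0))"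


text \<open>Operators on observables of a finite state space are given by a kernel.\<close>

definition kernel_on :: "'s set \<Rightarrow> (('s \<Rightarrow> real) \<Rightarrow> 's \<Rightarrow> real) \<Rightarrow> ('s \<Rightarrow> 's \<Rightarrow> real) \<Rightarrow> bool" where
  "kernel_on S L Q \<longleftrightarrow> (\<forall>\<phi>. \<forall>x\<in>S. L \<phi> x = (\<Sum>y\<in>S. Q x y * \<phi> y))"

lemma kernel_on_bound:
  assumes "finite S" "kernel_on S L Q"
  shows "\<exists>C\<ge>0. \<forall>n. \<forall>x\<in>S. \<bar>(L ^^ n) \<phi> x\<bar> \<le> C ^ n * (\<Sum>y\<in>S. \<bar>\<phi> y\<bar>)"
proof -
  define C where "C = (\<Sum>x\<in>S. \<Sum>y\<in>S. \<bar>Q x y\<bar>)"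
  define M where "M = (\<Sum>y\<in>S. \<bar>\<phi> y\<bar>)"
  have C0: "C \<ge> 0" unfolding C_def by (intro sum_nonneg) auto
  have M0: "M \<ge> 0" unfolding M_def by (intro sum_nonneg) auto
  have row: "(\<Sum>y\<in>S. \<bar>Q x y\<bar>) \<le> C" if "x \<in> S" for x
    unfolding C_def by (rule member_le_sum) (use that assms in \<open>auto intro: sum_nonneg\<close>)
  have "\<forall>x\<in>S. \<bar>(L ^^ n) \<phi> x\<bar> \<le> C ^ n * M" for n
  proof (induction n)
    case 0
    then show ?case
      using assms(1) by (auto simp: M_def intro!: member_le_sum[where f = "\<lambda>y. \<bar>\<phi> y\<bar>"])
  next
    case (Suc n)
    show ?case
    proof
      fix x assume x: "x \<in> S"
      have "\<bar>(L ^^ Suc n) \<phi> x\<bar> = \<bar>\<Sum>y\<in>S. Q x y * (L ^^ n) \<phi> y\<bar>"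
        using x assms(2) by (simp add: kernel_on_def)
      also have "\<dots> \<le> (\<Sum>y\<in>S. \<bar>Q x y\<bar> * \<bar>(L ^^ n) \<phi> y\<bar>)"
        by (rule order_trans[OF sum_abs]) (simp add: abs_mult)
      also have "\<dots> \<le> (\<Sum>y\<in>S. \<bar>Q x y\<bar> * (C ^ n * M))"
        by (intro sum_mono mult_left_mono) (use Suc in auto)
      also have "\<dots> = (\<Sum>y\<in>S. \<bar>Q x y\<bar>) * (C ^ n * M)"
        by (simp add: sum_distrib_right)
      also have "\<dots> \<le> C * (C ^ n * M)"
        by (intro mult_right_mono row x) (use C0 M0 in auto)
      finally show "\<bar>(L ^^ Suc n) \<phi> x\<bar> \<le> C ^ Suc n * M" by (simp add: mult_ac)
    qed
  qed
  then show ?thesis using C0 by (auto simp: M_def)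
qed

lemma summable_semigroup:
  assumes "finite S" "kernel_on S L Q" "x \<in> S"
  shows "summable (\<lambda>n. t ^ n / fact n * (L ^^ n) \<phi> x)"
proof -
  obtain C where C: "C \<ge> 0" "\<And>n. \<bar>(L ^^ n) \<phi> x\<bar> \<le> C ^ n * (\<Sum>y\<in>S. \<bar>\<phi> y\<bar>)"
    using kernel_on_bound[OF assms(1,2), of \<phi>] assms(3) by blast
  have "summable (\<lambda>n. inverse (fact n) * (\<bar>t\<bar> * C) ^ n * (\<Sum>y\<in>S. \<bar>\<phi> y\<bar>))"
    by (intro summable_mult2 summable_exp)
  then show ?thesis
  proof (rule summable_comparison_test'[where N = 0])
    fix n :: nat
    have "norm (t ^ n / fact n * (L ^^ n) \<phi> x) = \<bar>t\<bar> ^ n / fact n * \<bar>(L ^^ n) \<phi> x\<bar>"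
      by (simp add: abs_mult power_abs)
    also have "\<dots> \<le> \<bar>t\<bar> ^ n / fact n * (C ^ n * (\<Sum>y\<in>S. \<bar>\<phi> y\<bar>))"
      by (intro mult_left_mono C) auto
    finally show "norm (t ^ n / fact n * (L ^^ n) \<phi> x)
        \<le> inverse (fact n) * (\<bar>t\<bar> * C) ^ n * (\<Sum>y\<in>S. \<bar>\<phi> y\<bar>)"
      by (simp add: power_mult_distrib field_simps)
  qed
qed

lemma semigroup_0: "markov_semigroup L 0 \<phi> x = \<phi> x"
proof -
  have "(\<Sum>n. 0 ^ n / fact n * (L ^^ n) \<phi> x) = (\<Sum>n. ((L ^^ n) \<phi> x / fact n) * 0 ^ n)"
    by (simp add: mult_ac)
  also have "\<dots> = \<phi> x" by (subst powser_zero) simp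
  finally show ?thesis by (simp add: markov_semigroup_def)
qed

lemma semigroup_backward_equation:
  assumes "finite S" "kernel_on S L Q" "x \<in> S"
  shows "((\<lambda>t. markov_semigroup L t \<phi> x) has_real_derivative L (markov_semigroup L t \<phi>) x) (at t)"
proof -
  define c where "c n = (L ^^ n) \<phi> x / fact n" for n
  have eq: "t ^ n / fact n * (L ^^ n) \<phi> x = c n * t ^ n" for n t
    by (simp add: c_def)
  have "summable (\<lambda>n. c n * t ^ n)" for t
    using summable_semigroup[OF assms, of t \<phi>] unfolding eq .
  then have D: "((\<lambda>t. \<Sum>n. c n * t ^ n) has_field_derivative (\<Sum>n. diffs c n * t ^ n)) (at t)"
    by (rule termdiffs_strong_converges_everywhere)
  have "(\<Sum>n. diffs c n * t ^ n) = (\<Sum>n. \<Sum>y\<in>S. Q x y * (t ^ n / fact n * (L ^^ n) \<phi> y))"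
  proof (rule arg_cong[where f = suminf], rule ext)
    fix n
    have "diffs c n * t ^ n = t ^ n / fact n * (L ^^ Suc n) \<phi> x"
      by (simp add: diffs_def c_def field_simps del: of_nat_Suc)
    also have "(L ^^ Suc n) \<phi> x = (\<Sum>y\<in>S. Q x y * (L ^^ n) \<phi> y)"
      using assms(2,3) by (simp add: kernel_on_def)
    finally show "diffs c n * t ^ n = (\<Sum>y\<in>S. Q x y * (t ^ n / fact n * (L ^^ n) \<phi> y))"
      by (simp add: sum_distrib_left mult_ac)
  qed
  also have "\<dots> = (\<Sum>y\<in>S. \<Sum>n. Q x y * (t ^ n / fact n * (L ^^ n) \<phi> y))"
    by (rule suminf_sum) (intro summable_mult summable_semigroup[OF assms(1,2)])
  also have "\<dots> = (\<Sum>y\<in>S. Q x y * markov_semigroup L t \<phi> y)"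
    unfolding markov_semigroup_def
    by (intro sum.cong refl suminf_mult summable_semigroup[OF assms(1,2)])
  also have "\<dots> = L (markov_semigroup L t \<phi>) x"
    using assms(2,3) by (simp add: kernel_on_def)
  finally have "((\<lambda>t. \<Sum>n. c n * t ^ n) has_real_derivative L (markov_semigroup L t \<phi>) x) (at t)"
    using D by simp
  then show ?thesis unfolding markov_semigroup_def[of L _ \<phi> x] eq .
qed

lemma law_markov_process:
  assumes fin: "finite S" and ker: "kernel_on S L Q" and mp: "markov_process S L P X"
    and x: "x \<in> S" and t: "t \<ge> 0"
  shows "measure (P x) {\<omega>\<in>space (P x). X t \<omega> \<in> A} = law L t x A"
proof -
  define k where "k t x y = measure (P x) {\<omega>\<in>space (P x). X t \<omega> = y}" for t x y
  have prob: "prob_space (P x)" and meas: "X t \<in> P x \<rightarrow>\<^sub>M count_space S"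
    if "x \<in> S" "t \<ge> 0" for x t
    using mp that by (auto simp: markov_process_def)
  have Xin: "X t \<omega> \<in> S" if "x \<in> S" "t \<ge> 0" "\<omega> \<in> space (P x)" for x t \<omega>
    using measurable_space[OF meas[OF that(1,2)] that(3)] by simp
  have ev: "{\<omega>\<in>space (P x). X t \<omega> \<in> B} \<in> sets (P x)" if "x \<in> S" "t \<ge> 0" for x t B
  proof -
    have "X t -` (B \<inter> S) \<inter> space (P x) \<in> sets (P x)"
      by (rule measurable_sets[OF meas[OF that]]) auto
    also have "X t -` (B \<inter> S) \<inter> space (P x) = {\<omega>\<in>space (P x). X t \<omega> \<in> B}"
      using Xin[OF that] by auto
    finally show ?thesis .
  qed
  have ev1: "{\<omega>\<in>space (P x). X t \<omega> = y} \<in> sets (P x)" if "x \<in> S" "t \<ge> 0" for x t y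
    using ev[OF that, of "{y}"] by simp
  have split: "measure (P x) E = (\<Sum>y\<in>S. measure (P x) {\<omega>\<in>E. X t \<omega> = y})"
    if "x \<in> S" "t \<ge> 0" "E \<in> sets (P x)" for x t E
  proof -
    interpret prob_space "P x" using prob[OF that(1,2)] .
    have sub: "E \<subseteq> space (P x)" using that(3) by (rule sets.sets_into_space)
    have "E = (\<Union>y\<in>S. {\<omega>\<in>E. X t \<omega> = y})"
      using Xin[OF that(1,2)] sub by auto
    then have "measure (P x) E = measure (P x) (\<Union>y\<in>S. {\<omega>\<in>E. X t \<omega> = y})" by simp
    also have "\<dots> = (\<Sum>y\<in>S. measure (P x) {\<omega>\<in>E. X t \<omega> = y})"
    proof (rule finite_measure_finite_Union[OF fin])
      show "(\<lambda>y. {\<omega>\<in>E. X t \<omega> = y}) ` S \<subseteq> sets (P x)"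
      proof (clarify)
        fix y assume "y \<in> S"
        have "E \<inter> {\<omega>\<in>space (P x). X t \<omega> = y} \<in> sets (P x)"
          using ev1[OF that(1,2)] that(3) by blast
        also have "E \<inter> {\<omega>\<in>space (P x). X t \<omega> = y} = {\<omega>\<in>E. X t \<omega> = y}" using sub by auto
        finally show "{\<omega>\<in>E. X t \<omega> = y} \<in> sets (P x)" .
      qed
    qed (auto simp: disjoint_family_on_def)
    finally show ?thesis .
  qed
  have k1: "(\<Sum>y\<in>S. k t x y) = 1" if "x \<in> S" "t \<ge> 0" for x t
    using split[OF that, of "space (P x)"] prob_space.prob_space[OF prob[OF that]]
    by (simp add: k_def)
  have knn: "k t x y \<ge> 0" for t x y by (simp add: k_def)
  have k0: "k 0 x y = (if y = x then 1 else 0)" if "x \<in> S" "y \<in> S" for x y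
  proof -
    have xx: "k 0 x x = 1" using mp that by (simp add: k_def markov_process_def)
    have "(\<Sum>z\<in>S. k 0 x z) = k 0 x x + (\<Sum>z\<in>S - {x}. k 0 x z)"
      using fin that by (simp add: sum.remove)
    then have "(\<Sum>z\<in>S - {x}. k 0 x z) = 0" using k1[of x 0] xx that by simp
    then have "\<forall>z\<in>S - {x}. k 0 x z = 0"
      using fin knn by (subst (asm) sum_nonneg_eq_0_iff) auto
    then show ?thesis using xx that by auto
  qed
  have CK: "k (s + t) x z = (\<Sum>y\<in>S. k s x y * k t y z)"
    if "x \<in> S" "z \<in> S" "s \<ge> 0" "t \<ge> 0" for x z s t
  proof -
    have "k (s + t) x z =
        (\<Sum>y\<in>S. measure (P x) {\<omega>\<in>{\<omega>\<in>space (P x). X (s + t) \<omega> = z}. X s \<omega> = y})"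
      unfolding k_def using that by (intro split ev1) auto
    also have "\<dots> = (\<Sum>y\<in>S. k s x y * k t y z)"
    proof (intro sum.cong refl)
      fix y assume y: "y \<in> S"
      have top: "space (P x) \<in> sigma_sets (space (P x))
          {{\<omega>\<in>space (P x). X u \<omega> = v} |u v. 0 \<le> u \<and> u \<le> s \<and> v \<in> S}"
        by (rule sigma_sets_top)
      have "measure (P x) {\<omega>\<in>space (P x). X s \<omega> = y \<and> X (s + t) \<omega> = z} = k s x y * k t y z"
        using mp that y top unfolding markov_process_def k_def by blast
      moreover have "{\<omega>\<in>{\<omega>\<in>space (P x). X (s + t) \<omega> = z}. X s \<omega> = y}
          = {\<omega>\<in>space (P x). X s \<omega> = y \<and> X (s + t) \<omega> = z}" by auto
      ultimately show "measure (P x) {\<omega>\<in>{\<omega>\<in>space (P x). X (s + t) \<omega> = z}. X s \<omega> = y}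
          = k s x y * k t y z" by simp
    qed
    finally show ?thesis .
  qed
  have expect: "(\<integral>\<omega>. \<phi> (X t \<omega>) \<partial>P x) = (\<Sum>y\<in>S. k t x y * \<phi> y)"
    if "x \<in> S" "t \<ge> 0" for x t and \<phi> :: "'a \<Rightarrow> real"
  proof -
    interpret prob_space "P x" using prob[OF that] .
    have "(\<integral>\<omega>. \<phi> (X t \<omega>) \<partial>P x)
        = (\<integral>\<omega>. (\<Sum>y\<in>S. \<phi> y * indicator {\<omega>\<in>space (P x). X t \<omega> = y} \<omega>) \<partial>P x)"
    proof (rule Bochner_Integration.integral_cong[OF refl])
      fix \<omega> assume w: "\<omega> \<in> space (P x)"
      have "(\<Sum>y\<in>S. \<phi> y * indicator {\<omega>\<in>space (P x). X t \<omega> = y} \<omega>)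
          = (\<Sum>y\<in>S. if X t \<omega> = y then \<phi> y else 0)"
        by (intro sum.cong refl) (use w in \<open>auto simp: indicator_def\<close>)
      also have "\<dots> = \<phi> (X t \<omega>)" using fin Xin[OF that w] by (simp add: sum.delta)
      finally show "\<phi> (X t \<omega>) = (\<Sum>y\<in>S. \<phi> y * indicator {\<omega>\<in>space (P x). X t \<omega> = y} \<omega>)"
        by simp
    qed
    also have "\<dots> = (\<Sum>y\<in>S. \<integral>\<omega>. \<phi> y * indicator {\<omega>\<in>space (P x). X t \<omega> = y} \<omega> \<partial>P x)"
      by (rule Bochner_Integration.integral_sum)
         (use ev1[OF that] in \<open>auto intro!: integrable_mult_right simp: less_top[symmetric]\<close>)
    also have "\<dots> = (\<Sum>y\<in>S. k t x y * \<phi> y)"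
    proof (intro sum.cong refl)
      fix y
      have "{\<omega>\<in>space (P x). X t \<omega> = y} \<inter> space (P x) = {\<omega>\<in>space (P x). X t \<omega> = y}" by auto
      then show "(\<integral>\<omega>. \<phi> y * indicator {\<omega>\<in>space (P x). X t \<omega> = y} \<omega> \<partial>P x) = k t x y * \<phi> y"
        by (simp add: k_def)
    qed
    finally show ?thesis .
  qed
  have gen: "((\<lambda>h. ((\<Sum>y\<in>S. k h x y * \<phi> y) - \<phi> x) / h) \<longlongrightarrow> L \<phi> x) (at_right 0)"
    if "x \<in> S" for x and \<phi> :: "'a \<Rightarrow> real"
  proof -
    have "((\<lambda>h. ((\<integral>\<omega>. \<phi> (X h \<omega>) \<partial>P x) - \<phi> x) / h) \<longlongrightarrow> L \<phi> x) (at_right 0)"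
      using mp that by (simp add: markov_process_def)
    then show ?thesis
      by (rule Lim_transform_eventually)
         (use expect[OF that] in \<open>auto simp: eventually_at_right_less
            intro!: eventually_at_rightI[of 0 1]\<close>)
  qed
  text \<open>The derivative at \<open>0\<close> of \<open>k\<close> is the kernel of \<open>L\<close>.\<close>
  have q: "((\<lambda>h. (k h y z - k 0 y z) / h) \<longlongrightarrow> Q y z) (at_right 0)"
    if "y \<in> S" "z \<in> S" for y z
  proof -
    have 1: "(\<Sum>w\<in>S. f w * indicator {z} w) = f z" for f :: "'a \<Rightarrow> real"
      using fin that by (simp add: indicator_def if_distrib sum.delta cong: if_cong)
    have "L (indicator {z}) y = Q y z"
      using ker that(1) unfolding kernel_on_def by (simp add: 1)
    moreover have "indicator {z} y = k 0 y z" using k0[OF that] by (auto simp: indicator_def)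
    ultimately show ?thesis using gen[OF that(1), of "indicator {z}"] by (simp add: 1)
  qed
  have q0: "((\<lambda>h. k h y z) \<longlongrightarrow> k 0 y z) (at_right 0)" if "y \<in> S" "z \<in> S" for y z
  proof -
    have "((\<lambda>h. (k h y z - k 0 y z) / h * h + k 0 y z) \<longlongrightarrow> Q y z * 0 + k 0 y z) (at_right 0)"
      by (intro tendsto_intros q that)
    then have "((\<lambda>h. (k h y z - k 0 y z) / h * h + k 0 y z) \<longlongrightarrow> k 0 y z) (at_right 0)" by simp
    then show ?thesis
      by (rule Lim_transform_eventually) (auto intro!: eventually_at_rightI[of 0 1])
  qed
  have incr: "(k (s + h) x z - k s x z) = (\<Sum>y\<in>S. k s x y * (k h y z - k 0 y z))"
    if "x \<in> S" "z \<in> S" "s \<ge> 0" "h \<ge> 0" for x z s h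
    using CK[OF that] CK[OF that(1,2,3), of 0]
    by (simp add: algebra_simps sum_subtractf)
  have right: "((\<lambda>h. (k (s + h) x z - k s x z) / h) \<longlongrightarrow> (\<Sum>y\<in>S. k s x y * Q y z)) (at_right 0)"
    if "x \<in> S" "z \<in> S" "s \<ge> 0" for x z s
  proof -
    have "((\<lambda>h. \<Sum>y\<in>S. k s x y * ((k h y z - k 0 y z) / h)) \<longlongrightarrow> (\<Sum>y\<in>S. k s x y * Q y z))
        (at_right 0)"
      by (intro tendsto_intros q that)
    then show ?thesis
      by (rule Lim_transform_eventually)
         (use that in \<open>auto intro!: eventually_at_rightI[of 0 1] simp: incr sum_divide_distrib\<close>)
  qed
  have kle: "k t x y \<le> 1" if "x \<in> S" "t \<ge> 0" for x y t
    using prob_space.prob_le_1[OF prob[OF that]] by (simp add: k_def)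
  have leftcont: "((\<lambda>h. k (s - h) x z) \<longlongrightarrow> k s x z) (at_right 0)"
    if "x \<in> S" "z \<in> S" "s > 0" for x z s
  proof -
    have "((\<lambda>h. \<Sum>y\<in>S. \<bar>k h y z - k 0 y z\<bar>) \<longlongrightarrow> (\<Sum>y\<in>S. \<bar>k 0 y z - k 0 y z\<bar>)) (at_right 0)"
      by (intro tendsto_intros q0 that)
    then have lim: "((\<lambda>h. \<Sum>y\<in>S. \<bar>k h y z - k 0 y z\<bar>) \<longlongrightarrow> 0) (at_right 0)" by simp
    have "((\<lambda>h. k s x z - k (s - h) x z) \<longlongrightarrow> 0) (at_right 0)"
    proof (rule Lim_null_comparison[OF _ lim], rule eventually_at_rightI[of 0 s])
      fix h assume h: "h \<in> {0<..<s}"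
      have "norm (k s x z - k (s - h) x z)
          = \<bar>\<Sum>y\<in>S. k (s - h) x y * (k h y z - k 0 y z)\<bar>"
        using incr[OF that(1,2), of "s - h" h] h by simp
      also have "\<dots> \<le> (\<Sum>y\<in>S. k (s - h) x y * \<bar>k h y z - k 0 y z\<bar>)"
        by (rule order_trans[OF sum_abs]) (simp add: abs_mult knn)
      also have "\<dots> \<le> (\<Sum>y\<in>S. 1 * \<bar>k h y z - k 0 y z\<bar>)"
        by (intro sum_mono mult_right_mono kle) (use h that in auto)
      finally show "norm (k s x z - k (s - h) x z) \<le> (\<Sum>y\<in>S. \<bar>k h y z - k 0 y z\<bar>)" by simp
    qed (use that in auto)
    then have "((\<lambda>h. k s x z - (k s x z - k (s - h) x z)) \<longlongrightarrow> k s x z - 0) (at_right 0)"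
      by (intro tendsto_intros)
    then show ?thesis by simp
  qed
  have left: "((\<lambda>h. (k (s - h) x z - k s x z) / (- h)) \<longlongrightarrow> (\<Sum>y\<in>S. k s x y * Q y z)) (at_right 0)"
    if "x \<in> S" "z \<in> S" "s > 0" for x z s
  proof -
    have "((\<lambda>h. \<Sum>y\<in>S. k (s - h) x y * ((k h y z - k 0 y z) / h)) \<longlongrightarrow> (\<Sum>y\<in>S. k s x y * Q y z))
        (at_right 0)"
      by (intro tendsto_intros q leftcont that)
    then show ?thesis
    proof (rule Lim_transform_eventually)
      show "\<forall>\<^sub>F h in at_right 0. (\<Sum>y\<in>S. k (s - h) x y * ((k h y z - k 0 y z) / h))
          = (k (s - h) x z - k s x z) / (- h)"
      proof (rule eventually_at_rightI[of 0 s])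
        fix h assume h: "h \<in> {0<..<s}"
        have "(k (s - h) x z - k s x z) / (- h) = (k s x z - k (s - h) x z) / h"
          using h by (simp add: field_simps)
        also have "\<dots> = (\<Sum>y\<in>S. k (s - h) x y * ((k h y z - k 0 y z) / h))"
          using incr[OF that(1,2), of "s - h" h] h by (simp add: sum_divide_distrib)
        finally show "(\<Sum>y\<in>S. k (s - h) x y * ((k h y z - k 0 y z) / h))
          = (k (s - h) x z - k s x z) / (- h)" by simp
      qed (use that in auto)
    qed
  qed
  have deriv: "((\<lambda>s. k s x z) has_real_derivative (\<Sum>y\<in>S. k s x y * Q y z)) (at s)"
    if "x \<in> S" "z \<in> S" "s > 0" for x z s
    unfolding DERIV_def
    using right[OF that(1,2), of s] left[OF that] that(3)
    by (intro filterlim_split_at) (auto simp: filterlim_at_left_to_right)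
  have rightcont: "((\<lambda>s. k s x z) \<longlongrightarrow> k 0 x z) (at_right 0)" if "x \<in> S" "z \<in> S" for x z
    using q0 that .
  define g where "g s = (\<Sum>z\<in>S. k s x z * markov_semigroup L (t - s) (indicator A) z)" for s
  have sg: "((\<lambda>s. markov_semigroup L (t - s) \<phi> z) has_real_derivative - L (markov_semigroup L (t - s) \<phi>) z) (at s)"
    if "z \<in> S" for z s \<phi>
  proof -
    have "((\<lambda>s. t - s) has_real_derivative -1) (at s)" by (auto intro!: derivative_eq_intros)
    from DERIV_chain2[OF semigroup_backward_equation[OF fin ker that] this]
    show ?thesis by simp
  qed
  have g': "(g has_real_derivative 0) (at s)" if "s > 0" for s
  proof -
    let ?f = "markov_semigroup L (t - s) (indicator A)"
    have "(g has_real_derivative (\<Sum>z\<in>S. (\<Sum>y\<in>S. k s x y * Q y z) * ?f z + - L ?f z * k s x z)) (at s)"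
      unfolding g_def by (intro DERIV_sum DERIV_mult deriv sg x that)
    moreover have "(\<Sum>z\<in>S. (\<Sum>y\<in>S. k s x y * Q y z) * ?f z) = (\<Sum>y\<in>S. k s x y * L ?f y)"
    proof -
      have "(\<Sum>z\<in>S. (\<Sum>y\<in>S. k s x y * Q y z) * ?f z) = (\<Sum>y\<in>S. \<Sum>z\<in>S. k s x y * Q y z * ?f z)"
        by (subst sum.swap) (simp add: sum_distrib_right)
      also have "\<dots> = (\<Sum>y\<in>S. k s x y * (\<Sum>z\<in>S. Q y z * ?f z))"
        by (simp add: sum_distrib_left mult_ac)
      also have "\<dots> = (\<Sum>y\<in>S. k s x y * L ?f y)"
        using ker by (intro sum.cong refl) (simp add: kernel_on_def)
      finally show ?thesis .
    qed
    then have "(\<Sum>z\<in>S. (\<Sum>y\<in>S. k s x y * Q y z) * ?f z + - L ?f z * k s x z) = 0"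
      by (simp add: sum_subtractf mult.commute)
    ultimately show ?thesis by simp
  qed
  have "g t = g 0"
  proof (cases "t = 0")
    case False
    have cont: "continuous_on {0..t} g"
      unfolding continuous_on_def
    proof
      fix s assume s: "s \<in> {0..t}"
      show "(g \<longlongrightarrow> g s) (at s within {0..t})"
      proof (cases "s = 0")
        case True
        have "(g \<longlongrightarrow> g 0) (at_right 0)"
          unfolding g_def using DERIV_isCont[OF sg, of _ 0] x
          by (intro tendsto_intros rightcont)
             (auto simp: isCont_def intro: filterlim_mono[OF _ order_refl at_le])
        then show ?thesis using True False t by (simp add: at_within_Icc_at_right)
      next
        case ne: False
        then have "isCont g s" using s g'[of s] by (auto intro: DERIV_isCont)
        then show ?thesis by (simp add: isCont_def tendsto_within_subset[OF _ subset_UNIV])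
      qed
    qed
    show ?thesis
      by (rule DERIV_isconst_end[of 0 t]) (use False t cont g' in auto)
  qed simp
  moreover have "g 0 = law L t x A"
  proof -
    have "g 0 = (\<Sum>z\<in>S. if z = x then markov_semigroup L t (indicator A) z else 0)"
      unfolding g_def by (intro sum.cong refl) (use k0[OF x] in auto)
    then show ?thesis using fin x by (simp add: law_def)
  qed
  moreover have "g t = measure (P x) {\<omega>\<in>space (P x). X t \<omega> \<in> A}"
  proof -
    have "measure (P x) {\<omega>\<in>space (P x). X t \<omega> \<in> A}
        = (\<Sum>y\<in>S. measure (P x) {\<omega>\<in>{\<omega>\<in>space (P x). X t \<omega> \<in> A}. X t \<omega> = y})"
      by (rule split[OF x t ev[OF x t]])
    also have "\<dots> = (\<Sum>y\<in>S. k t x y * indicator A y)"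
    proof (intro sum.cong refl)
      fix y
      have "{\<omega>\<in>{\<omega>\<in>space (P x). X t \<omega> \<in> A}. X t \<omega> = y}
          = (if y \<in> A then {\<omega>\<in>space (P x). X t \<omega> = y} else {})" by auto
      then show "measure (P x) {\<omega>\<in>{\<omega>\<in>space (P x). X t \<omega> \<in> A}. X t \<omega> = y} = k t x y * indicator A y"
        by (simp add: k_def)
    qed
    finally show ?thesis by (simp add: g_def semigroup_0)
  qed
  ultimately show ?thesis by simp
qed

lemma finite_configs: "finite (configs N)"
  by (simp add: configs_def finite_PiE)

lemma kernel_on_ssep:
  assumes "N \<ge> 1"
  shows "kernel_on (configs N) (ssep_generator N p q) (\<lambda>x y. ssep_generator N p q (indicator {y}) x)"
  unfolding kernel_on_def
proof (intro allI ballI)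
  fix \<phi> :: "config \<Rightarrow> real" and \<eta> assume \<eta>: "\<eta> \<in> configs N"
  have e: "\<phi> \<zeta> = (\<Sum>y\<in>configs N. indicator {y} \<zeta> * \<phi> y)" if "\<zeta> \<in> configs N" for \<zeta>
    using that finite_configs by (simp add: indicator_def if_distribR sum.delta cong: if_cong)
  have upd: "\<eta>(i := v) \<in> configs N" if "i \<in> {1..N}" "v \<in> {0, 1}" for i v
    using \<eta> that by (auto simp: configs_def PiE_iff extensional_def)
  have swp: "swap_sites i \<eta> \<in> configs N" if "i \<in> {1..<N}" for i
    using \<eta> that by (auto simp: configs_def swap_sites_def PiE_iff extensional_def)
  have lin: "(\<Sum>i\<in>{1..<N}. (real N)\<^sup>2 * (\<phi> (swap_sites i \<eta>) - \<phi> \<eta>))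
      = (\<Sum>y\<in>configs N. (\<Sum>i\<in>{1..<N}. (real N)\<^sup>2 *
          (indicator {y} (swap_sites i \<eta>) - indicator {y} \<eta>)) * \<phi> y)"
  proof -
    have "(\<Sum>i\<in>{1..<N}. (real N)\<^sup>2 * (\<phi> (swap_sites i \<eta>) - \<phi> \<eta>))
      = (\<Sum>i\<in>{1..<N}. \<Sum>y\<in>configs N. (real N)\<^sup>2 *
          (indicator {y} (swap_sites i \<eta>) - indicator {y} \<eta>) * \<phi> y)"
    proof (intro sum.cong refl)
      fix i assume i: "i \<in> {1..<N}"
      show "(real N)\<^sup>2 * (\<phi> (swap_sites i \<eta>) - \<phi> \<eta>) = (\<Sum>y\<in>configs N. (real N)\<^sup>2 *
          (indicator {y} (swap_sites i \<eta>) - indicator {y} \<eta>) * \<phi> y)"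
        by (subst e[OF swp[OF i]], subst e[OF \<eta>])
           (simp add: sum_distrib_left sum_subtractf algebra_simps)
    qed
    then show ?thesis by (subst (asm) sum.swap) (simp add: sum_distrib_right)
  qed
  have res: "(real N)\<^sup>2 * (r * \<phi> (\<eta>(i := 1)) + (1 - r) * \<phi> (\<eta>(i := 0)) - \<phi> \<eta>)
      = (\<Sum>y\<in>configs N. (real N)\<^sup>2 * (r * indicator {y} (\<eta>(i := 1))
          + (1 - r) * indicator {y} (\<eta>(i := 0)) - indicator {y} \<eta>) * \<phi> y)"
    if "i \<in> {1..N}" for i r
    by (subst e[OF upd[OF that, of 1]], simp, subst e[OF upd[OF that, of 0]], simp, subst e[OF \<eta>])
       (simp add: sum_distrib_left sum_subtractf sum.distrib algebra_simps)
  show "ssep_generator N p q \<phi> \<eta>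
      = (\<Sum>y\<in>configs N. ssep_generator N p q (indicator {y}) \<eta> * \<phi> y)"
    unfolding ssep_generator_def distrib_right sum.distrib
    using lin res[of 1 p] res[of N q] assms by simp
qed

theorem law_ssep_process:
  assumes "N \<ge> 1" and "markov_process (configs N) (ssep_generator N p q) P X"
    and "\<eta> \<in> configs N" and "t \<ge> 0"
  shows "measure (P \<eta>) {\<omega>\<in>space (P \<eta>). X t \<omega> \<in> A} = law (ssep_generator N p q) t \<eta> A"
  using law_markov_process[OF finite_configs kernel_on_ssep[OF assms(1)] assms(2-4)] .

end

theory Submission
  imports Defs
begin

text \<open>
  Upper bound. Write the semigroup as a Poissonian average of the powers of an averaging operator,
  and trace every site back in time until it hits a reservoir. Each reservoir deposits a fair coin
  with a small probability \<open>\<alpha>\<close> and a known value otherwise. A discrepancy between two initial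
  configurations is a tagged particle, which is hidden among the fair coins: it can only be detected
  through its conditional law given the set \<open>J\<close> of unlabelled coins. The squared norm of this law is a
  collision probability of two tagged particles that are conditionally independent given the history
  of \<open>J\<close>. This pair process is reversible for the product Bernoulli law of \<open>J\<close>, whatever \<open>p\<close> and \<open>q\<close>
  are, and a Nash type inequality shows that after a time of order one the collision probability,
  summed over the starting points, is bounded. By Cauchy-Schwarz the tagged particle then costs
  \<open>sqrt N\<close> instead of \<open>N\<close>, while its survival probability decays like \<open>exp (- \<lambda> t)\<close>, where
  \<open>\<lambda>\<close> is close to \<open>\<pi>\<^sup>2\<close>. The initial configuration also has to carry fair coins; this is achieved by
  interpolating from a deterministic configuration to one in which every site is randomized with
  probability \<open>\<theta>\<close>, the price \<open>\<theta>\<^sup>-\<^sup>1\<^sup>/\<^sup>2\<close> being integrable at \<open>0\<close>.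

  Lower bound. Chebyshev's inequality for the eigenfunction \<open>\<Sum>\<^sub>x sin (\<pi> x / (N + 1)) \<eta>\<^sub>x\<close> (Wilson's method).
\<close>

subsection \<open>The discrete skeleton\<close>

text \<open>A factor \<open>N\<close> in front of \<open>exp (- \<lambda> t)\<close> would double
  the leading term, so the tagged particle needs an \<open>L^2\<close> estimate. Fair coins serve,
  for any \<open>p\<close> and \<open>q\<close>, because their signs are orthonormal: a bounded
  function tested against a linear form in the signs is controlled by the Euclidean norm of the
  coefficients. Averaging over a swap is preferred to swapping because it is a projection, and
  because on a bond with two coins it lets the two copies of the tag choose their ends
  independently. The collision estimate wants the environment \<open>J\<close> in equilibrium. For
  an initial coin density \<open>\<theta>\<close> the reservoirs are therefore also read as
  depositing coins with probability \<open>\<theta>\<close>, although \<open>\<alpha>\<close> would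
  be possible. The estimate has constants that do not depend on the density, which makes it usable
  as \<open>\<theta>\<close> tends to 0. The price of order \<open>1 / sqrt \<theta>\<close> is the
  quotient of \<open>sqrt \<theta>\<close>, from Cauchy-Schwarz on an event of probability
  \<open>\<theta>\<close>, by the \<open>\<theta>\<close> that turns a sum over added sites into a
  sum over sites of \<open>J\<close>.\<close>

definition nswap :: "nat \<Rightarrow> nat \<Rightarrow> nat" where
  "nswap e i = (if i = e then Suc e else if i = Suc e then e else i)"

lemma nswap_nswap [simp]: "nswap e (nswap e i) = i"
  by (auto simp: nswap_def)

lemma nswap_comp [simp]: "nswap e \<circ> nswap e = id"
  by (auto simp: fun_eq_iff)

lemma inj_nswap [simp]: "inj_on (nswap e) S"
  by (metis inj_onI nswap_nswap)

lemma nswap_eq_iff [simp]: "nswap e i = nswap e j \<longleftrightarrow> i = j"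
  by (metis nswap_nswap)

lemma nswap_image_image [simp]: "nswap e ` nswap e ` S = S"
  by (simp add: image_image)

lemma mem_nswap_image: "i \<in> nswap e ` S \<longleftrightarrow> nswap e i \<in> S"
  by (metis imageE image_eqI nswap_nswap)

lemma nswap_image_both: "e \<in> S \<Longrightarrow> Suc e \<in> S \<Longrightarrow> nswap e ` S = S"
  by (auto simp: mem_nswap_image nswap_def split: if_splits)

lemma nswap_image_subset: "e \<in> {1..<N} \<Longrightarrow> S \<subseteq> {1..N} \<Longrightarrow> nswap e ` S \<subseteq> {1..N}"
  by (fastforce simp: nswap_def)

lemma card_nswap_image [simp]: "card (nswap e ` S) = card S"
  by (simp add: card_image)

lemma swap_sites_eq: "swap_sites e \<eta> = \<eta> \<circ> nswap e"
  by (auto simp: swap_sites_def nswap_def fun_eq_iff)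

definition bond :: "nat \<Rightarrow> (config \<Rightarrow> real) \<Rightarrow> config \<Rightarrow> real" where
  "bond e f \<eta> = (f \<eta> + f (\<eta> \<circ> nswap e)) / 2"

definition resv :: "nat \<Rightarrow> real \<Rightarrow> (config \<Rightarrow> real) \<Rightarrow> config \<Rightarrow> real" where
  "resv i r f \<eta> = r * f (\<eta>(i := 1)) + (1 - r) * f (\<eta>(i := 0))"

text \<open>A swap at rate \<open>N^2\<close> is an averaging at rate \<open>2 * N^2\<close>, so a
  reservoir of rate \<open>N^2\<close> gets half the weight of a bond. The weights add up to
  \<open>N\<close>, whence the single clock of rate \<open>2 * N^3\<close> in
  \<open>ssep_generator_skel\<close>.\<close>

definition skel :: "nat \<Rightarrow> real \<Rightarrow> real \<Rightarrow> (config \<Rightarrow> real) \<Rightarrow> config \<Rightarrow> real" where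
  "skel N p q f \<eta> =
     ((\<Sum>e\<in>{1..<N}. bond e f \<eta>) + resv 1 p f \<eta> / 2 + resv N q f \<eta> / 2) / real N"

lemma ssep_generator_skel:
  assumes "N \<ge> 1"
  shows "ssep_generator N p q f \<eta> = 2 * real N ^ 3 * (skel N p q f \<eta> - f \<eta>)"
proof -
  have eq: "(\<Sum>i\<in>{1..<N}. (real N)\<^sup>2 * (f (swap_sites i \<eta>) - f \<eta>))
      = 2 * (real N)\<^sup>2 * ((\<Sum>e\<in>{1..<N}. bond e f \<eta>) - (real N - 1) * f \<eta>)"
  proof -
    have "(\<Sum>i\<in>{1..<N}. (real N)\<^sup>2 * (f (swap_sites i \<eta>) - f \<eta>))
        = (\<Sum>i\<in>{1..<N}. 2 * (real N)\<^sup>2 * (bond i f \<eta> - f \<eta>))"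
      by (intro sum.cong) (auto simp: bond_def swap_sites_eq field_simps)
    also have "\<dots> = 2 * (real N)\<^sup>2 * (\<Sum>i\<in>{1..<N}. bond i f \<eta> - f \<eta>)"
      by (simp only: sum_distrib_left)
    also have "(\<Sum>i\<in>{1..<N}. bond i f \<eta> - f \<eta>) = (\<Sum>e\<in>{1..<N}. bond e f \<eta>) - (real N - 1) * f \<eta>"
      using assms by (simp add: sum_subtractf of_nat_diff)
    finally show ?thesis .
  qed
  show ?thesis
    using assms unfolding ssep_generator_def skel_def resv_def eq
    by (simp add: field_simps power2_eq_square power3_eq_cube)
qed

subsection \<open>Averaging over fair coins\<close>

definition coin_cfg :: "nat set \<Rightarrow> nat set \<Rightarrow> config \<Rightarrow> config" where
  "coin_cfg J B \<eta> = (\<lambda>i. if i \<in> J then (if i \<in> B then 1 else 0) else \<eta> i)"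

definition sgn_in :: "nat set \<Rightarrow> nat \<Rightarrow> real" where
  "sgn_in B y = (if y \<in> B then 1 else - 1)"

text \<open>\<open>B\<close> is the set of sites of \<open>J\<close> whose coin shows a particle.\<close>

definition walsh :: "(config \<Rightarrow> real) \<Rightarrow> real \<Rightarrow> (nat \<Rightarrow> real) \<Rightarrow> nat set \<Rightarrow> config \<Rightarrow> real" where
  "walsh f c a J \<eta> =
     (\<Sum>B\<in>Pow J. f (coin_cfg J B \<eta>) * (c + (\<Sum>y\<in>J. a y * sgn_in B y))) / 2 ^ card J"

lemma walsh_cong:
  assumes "\<And>y. y \<in> J \<Longrightarrow> a y = b y"
  shows "walsh f c a J \<eta> = walsh f c b J \<eta>"
proof -
  have "(\<Sum>y\<in>J. a y * sgn_in B y) = (\<Sum>y\<in>J. b y * sgn_in B y)" for B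
    using assms by (intro sum.cong) auto
  then show ?thesis by (simp add: walsh_def)
qed

lemma walsh_empty [simp]: "walsh f c a {} \<eta> = c * f \<eta>"
  by (simp add: walsh_def coin_cfg_def mult.commute)

lemma walsh_insert:
  \<comment> \<open>Revealing one coin moves its sign from the linear form into the constant.
    Carrying the constant \<open>c\<close> in \<open>walsh\<close> is what makes inductions over
    \<open>J\<close> possible.\<close>
  assumes "finite J" "i \<notin> J"
  shows "walsh f c a (insert i J) \<eta> =
    (walsh f (c + a i) a J (\<eta>(i := 1)) + walsh f (c - a i) a J (\<eta>(i := 0))) / 2"
proof -
  have inj: "inj_on (insert i) (Pow J)" using assms by (auto simp: inj_on_def)
  have disj: "Pow J \<inter> insert i ` Pow J = {}" using assms by auto
  have 0: "f (coin_cfg (insert i J) B \<eta>) * (c + (\<Sum>y\<in>insert i J. a y * sgn_in B y))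
      = f (coin_cfg J B (\<eta>(i := 0))) * (c - a i + (\<Sum>y\<in>J. a y * sgn_in B y))" if "B \<in> Pow J" for B
  proof -
    have "coin_cfg (insert i J) B \<eta> = coin_cfg J B (\<eta>(i := 0))"
      using that assms by (auto simp: coin_cfg_def fun_eq_iff)
    then show ?thesis using that assms by (auto simp: sgn_in_def)
  qed
  have 1: "f (coin_cfg (insert i J) (insert i B) \<eta>) * (c + (\<Sum>y\<in>insert i J. a y * sgn_in (insert i B) y))
      = f (coin_cfg J B (\<eta>(i := 1))) * (c + a i + (\<Sum>y\<in>J. a y * sgn_in B y))" if "B \<in> Pow J" for B
  proof -
    have "coin_cfg (insert i J) (insert i B) \<eta> = coin_cfg J B (\<eta>(i := 1))"
      using that assms by (auto simp: coin_cfg_def fun_eq_iff)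
    moreover have "(\<Sum>y\<in>J. a y * sgn_in (insert i B) y) = (\<Sum>y\<in>J. a y * sgn_in B y)"
      using assms by (intro sum.cong) (auto simp: sgn_in_def)
    ultimately show ?thesis using that assms by (auto simp: sgn_in_def)
  qed
  let ?h = "\<lambda>J B. f (coin_cfg J B \<eta>) * (c + (\<Sum>y\<in>J. a y * sgn_in B y))"
  have "sum (?h (insert i J)) (Pow (insert i J))
      = sum (?h (insert i J)) (Pow J) + (\<Sum>B\<in>Pow J. ?h (insert i J) (insert i B))"
    unfolding Pow_insert using assms disj
    by (subst sum.union_disjoint) (auto simp: sum.reindex[OF inj])
  also have "sum (?h (insert i J)) (Pow J)
      = (\<Sum>B\<in>Pow J. f (coin_cfg J B (\<eta>(i := 0))) * (c - a i + (\<Sum>y\<in>J. a y * sgn_in B y)))"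
    by (intro sum.cong refl 0)
  also have "(\<Sum>B\<in>Pow J. ?h (insert i J) (insert i B))
      = (\<Sum>B\<in>Pow J. f (coin_cfg J B (\<eta>(i := 1))) * (c + a i + (\<Sum>y\<in>J. a y * sgn_in B y)))"
    by (intro sum.cong refl 1)
  finally have sum_eq: "sum (?h (insert i J)) (Pow (insert i J)) =
      (\<Sum>B\<in>Pow J. f (coin_cfg J B (\<eta>(i := 0))) * (c - a i + (\<Sum>y\<in>J. a y * sgn_in B y)))
      + (\<Sum>B\<in>Pow J. f (coin_cfg J B (\<eta>(i := 1))) * (c + a i + (\<Sum>y\<in>J. a y * sgn_in B y)))" .
  have half: "(u + v) / (2 * k) = (v / k + u / k) / 2" for u v k :: real
    by (simp add: add_divide_distrib mult.commute)
  show ?thesis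
    unfolding walsh_def card_insert_disjoint[OF assms] power_Suc sum_eq by (rule half)
qed

lemma walsh_add_fun: "walsh (\<lambda>\<eta>. f \<eta> + g \<eta>) c a J \<eta> = walsh f c a J \<eta> + walsh g c a J \<eta>"
  by (simp add: walsh_def distrib_right sum.distrib add_divide_distrib)

lemma walsh_mult_fun: "walsh (\<lambda>\<eta>. k * f \<eta>) c a J \<eta> = k * walsh f c a J \<eta>"
  by (simp add: walsh_def sum_distrib_left mult.assoc)

lemma walsh_sum_fun: "walsh (\<lambda>\<eta>. \<Sum>e\<in>E. f e \<eta>) c a J \<eta> = (\<Sum>e\<in>E. walsh (f e) c a J \<eta>)"
proof (cases "finite E")
  case True
  then show ?thesis by induction (simp_all add: walsh_add_fun, simp add: walsh_def)
qed (simp add: walsh_def)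

lemma walsh_add: "walsh f (c + d) (\<lambda>y. a y + b y) J \<eta> = walsh f c a J \<eta> + walsh f d b J \<eta>"
proof -
  have "f \<zeta> * (c + d + (\<Sum>y\<in>J. (a y + b y) * sgn_in B y)) =
     f \<zeta> * (c + (\<Sum>y\<in>J. a y * sgn_in B y)) + f \<zeta> * (d + (\<Sum>y\<in>J. b y * sgn_in B y))" for \<zeta> B
    by (simp add: algebra_simps sum.distrib)
  then show ?thesis by (simp add: walsh_def sum.distrib add_divide_distrib)
qed

lemma walsh_mult: "walsh f (k * c) (\<lambda>y. k * a y) J \<eta> = k * walsh f c a J \<eta>"
proof -
  have "f \<zeta> * (k * c + (\<Sum>y\<in>J. k * a y * sgn_in B y)) = k * (f \<zeta> * (c + (\<Sum>y\<in>J. a y * sgn_in B y)))" for \<zeta> B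
    by (simp add: distrib_left sum_distrib_left mult_ac)
  then show ?thesis unfolding walsh_def by (simp only: sum_distrib_left[symmetric] times_divide_eq_right)
qed

lemma walsh_const_split: "walsh f (c + d) a J \<eta> = walsh f c a J \<eta> + walsh f d (\<lambda>_. 0) J \<eta>"
  using walsh_add[of f c d a "\<lambda>_. 0" J \<eta>] by simp

text \<open>Constant 1 and zero coefficients give the plain average over the coins. A single unit
  coefficient gives half the discrete derivative at \<open>i\<close>, averaged over the other coins:
  this is the discrepancy at \<open>i\<close> seen as a tagged coin.\<close>

lemma walsh_insert_unit:
  assumes "finite J" "i \<notin> J"
  shows "walsh f 0 (\<lambda>y. of_bool (y = i)) (insert i J) \<eta> =
    (walsh f 1 (\<lambda>_. 0) J (\<eta>(i := 1)) - walsh f 1 (\<lambda>_. 0) J (\<eta>(i := 0))) / 2"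
proof -
  have "walsh f c (\<lambda>y. of_bool (y = i)) J \<zeta> = walsh f c (\<lambda>_. 0) J \<zeta>" for c \<zeta>
    using assms by (intro walsh_cong) auto
  moreover have "walsh f (- 1) (\<lambda>_. 0) J \<zeta> = - walsh f 1 (\<lambda>_. 0) J \<zeta>" for \<zeta>
    using walsh_mult[of f "- 1" 1 "\<lambda>_. 0"] by simp
  ultimately show ?thesis using assms by (simp add: walsh_insert)
qed

lemma walsh_nswap: "walsh (\<lambda>\<eta>. f (\<eta> \<circ> nswap e)) c a J \<eta> = walsh f c (a \<circ> nswap e) (nswap e ` J) (\<eta> \<circ> nswap e)"
proof -
  have cfg: "coin_cfg J B \<eta> \<circ> nswap e = coin_cfg (nswap e ` J) (nswap e ` B) (\<eta> \<circ> nswap e)" for B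
    by (auto simp: coin_cfg_def fun_eq_iff mem_nswap_image)
  have s: "(\<Sum>y\<in>nswap e ` J. a (nswap e y) * sgn_in (nswap e ` B) y) = (\<Sum>y\<in>J. a y * sgn_in B y)" for B
    by (simp add: sum.reindex sgn_in_def mem_nswap_image)
  have "bij_betw ((`) (nswap e)) (Pow J) (Pow (nswap e ` J))"
    by (intro bij_betw_Pow inj_on_imp_bij_betw inj_nswap)
  then have "(\<Sum>B\<in>Pow (nswap e ` J). h B) = (\<Sum>B\<in>Pow J. h (nswap e ` B))" for h :: "nat set \<Rightarrow> real"
    by (rule sum.reindex_bij_betw[symmetric])
  then show ?thesis by (simp add: walsh_def cfg s)
qed

lemma walsh_bond:
  "walsh (bond e f) c a J \<eta> =
     (walsh f c a J \<eta> + walsh f c (a \<circ> nswap e) (nswap e ` J) (\<eta> \<circ> nswap e)) / 2"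
proof -
  have "bond e f = (\<lambda>\<eta>. (1/2) * f \<eta> + (1/2) * f (\<eta> \<circ> nswap e))"
    by (auto simp: bond_def fun_eq_iff)
  then show ?thesis by (simp add: walsh_add_fun walsh_mult_fun walsh_nswap del: times_divide_eq_left)
qed

lemma coin_cfg_upd: "i \<notin> J \<Longrightarrow> coin_cfg J B (\<eta>(i := v)) = (coin_cfg J B \<eta>)(i := v)"
  by (auto simp: coin_cfg_def fun_eq_iff)

lemma walsh_upd: "i \<notin> J \<Longrightarrow> walsh (\<lambda>\<eta>. f (\<eta>(i := v))) c a J \<eta> = walsh f c a J (\<eta>(i := v))"
  by (simp add: walsh_def coin_cfg_upd)

text \<open>
  A reservoir of density \<open>r\<close> places a fair coin with probability \<open>\<alpha>\<close>, and a known particle or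
  hole otherwise.
\<close>

lemma walsh_resv:
  assumes "finite J"
  shows "walsh (resv i r f) c a J \<eta> =
     \<alpha> * walsh f c (a(i := 0)) (insert i J) \<eta>
     + (r - \<alpha> / 2) * walsh f c (a(i := 0)) (J - {i}) (\<eta>(i := 1))
     + (1 - r - \<alpha> / 2) * walsh f c (a(i := 0)) (J - {i}) (\<eta>(i := 0))"
proof -
  define K where "K = J - {i}"
  have K: "finite K" "i \<notin> K" "insert i J = insert i K" using assms by (auto simp: K_def)
  have ind: "walsh (resv i r f) c a K (\<eta>(i := v)) = walsh (resv i r f) c a K \<eta>" for c v
    using K by (simp add: walsh_def coin_cfg_upd resv_def)
  \<comment> \<open>The reservoir overwrites site \<open>i\<close>, so the contributions of
    \<open>a i\<close> and \<open>- a i\<close> cancel: a tag at \<open>i\<close> is lost.\<close>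
  have "walsh (resv i r f) c a J \<eta> = walsh (resv i r f) c a K \<eta>"
  proof (cases "i \<in> J")
    case True
    then have "J = insert i K" by (auto simp: K_def)
    then have "walsh (resv i r f) c a J \<eta> =
        (walsh (resv i r f) (c + a i) a K \<eta> + walsh (resv i r f) (c - a i) a K \<eta>) / 2"
      using K by (simp add: walsh_insert ind)
    also have "\<dots> = walsh (resv i r f) c a K \<eta>"
      using walsh_const_split[of "resv i r f" c "a i" a K \<eta>]
        walsh_const_split[of "resv i r f" c "- a i" a K \<eta>]
        walsh_mult[of "resv i r f" "- 1" "a i" "\<lambda>_. 0" K \<eta>] by simp
    finally show ?thesis .
  qed (simp add: K_def)
  also have "\<dots> = r * walsh f c a K (\<eta>(i := 1)) + (1 - r) * walsh f c a K (\<eta>(i := 0))"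
    using K unfolding resv_def[abs_def] by (simp add: walsh_add_fun walsh_mult_fun walsh_upd)
  also have "\<dots> = r * walsh f c (a(i := 0)) K (\<eta>(i := 1)) + (1 - r) * walsh f c (a(i := 0)) K (\<eta>(i := 0))"
    using K by (subst (1 2) walsh_cong[of K a "a(i := 0)"]) auto
  finally have 1: "walsh (resv i r f) c a J \<eta> = \<dots>" .
  have 2: "walsh f c (a(i := 0)) (insert i K) \<eta> =
      (walsh f c (a(i := 0)) K (\<eta>(i := 1)) + walsh f c (a(i := 0)) K (\<eta>(i := 0))) / 2"
    using walsh_insert[OF K(1,2), of f c "a(i := 0)" \<eta>] by simp
  have mix: "r * u + (1 - r) * v = \<alpha> * ((u + v) / 2) + (r - \<alpha> / 2) * u + (1 - r - \<alpha> / 2) * v"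
    for u v :: real
    by (simp add: field_simps)
  show ?thesis
    unfolding K(3) K_def[symmetric] 1 2 by (rule mix)
qed

lemma walsh_skel:
  "walsh (skel N p q f) c a J \<eta> =
     ((\<Sum>e\<in>{1..<N}. walsh (bond e f) c a J \<eta>) + walsh (resv 1 p f) c a J \<eta> / 2
       + walsh (resv N q f) c a J \<eta> / 2) / real N"
proof -
  have "skel N p q f = (\<lambda>\<eta>. (1 / real N) * ((\<Sum>e\<in>{1..<N}. bond e f \<eta>) + ((1/2) * resv 1 p f \<eta> + (1/2) * resv N q f \<eta>)))"
    by (auto simp: skel_def fun_eq_iff)
  then show ?thesis
    by (simp only: walsh_mult_fun walsh_add_fun walsh_sum_fun) (simp add: field_simps)
qed

text \<open>Bessel's inequality for the Walsh functions of degree one.\<close>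

lemma walsh_square_le:
  assumes "finite J" and f: "\<And>\<zeta>. \<bar>f \<zeta>\<bar> \<le> 1"
  shows "(walsh f c a J \<eta>)\<^sup>2 \<le> c\<^sup>2 + (\<Sum>y\<in>J. (a y)\<^sup>2)"
  using assms(1)
proof (induction J arbitrary: c \<eta>)
  case empty
  have "(c * f \<eta>)\<^sup>2 \<le> c\<^sup>2 * 1"
    unfolding power_mult_distrib using f[of \<eta>] by (intro mult_left_mono) (auto simp: abs_square_le_1)
  then show ?case by simp
next
  case (insert i J)
  let ?u = "walsh f (c + a i) a J (\<eta>(i := 1))" and ?v = "walsh f (c - a i) a J (\<eta>(i := 0))"
  have "((?u + ?v) / 2)\<^sup>2 \<le> (?u\<^sup>2 + ?v\<^sup>2) / 2"
    using zero_le_power2[of "?u - ?v"] by (simp add: power2_eq_square field_simps)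
  also have "\<dots> \<le> ((c + a i)\<^sup>2 + (\<Sum>y\<in>J. (a y)\<^sup>2) + ((c - a i)\<^sup>2 + (\<Sum>y\<in>J. (a y)\<^sup>2))) / 2"
    using insert.IH by (intro divide_right_mono add_mono) auto
  finally show ?case using insert.hyps by (simp add: walsh_insert power2_eq_square algebra_simps)
qed

subsection \<open>Bernoulli random sets\<close>

definition bern :: "nat set \<Rightarrow> real \<Rightarrow> (nat set \<Rightarrow> real) \<Rightarrow> real" where
  "bern I \<alpha> F = (\<Sum>J\<in>Pow I. \<alpha> ^ card J * (1 - \<alpha>) ^ card (I - J) * F J)"

lemma bern_empty [simp]: "bern {} \<alpha> F = F {}"
  by (simp add: bern_def)

lemma bern_insert:
  assumes "finite I" "i \<notin> I"
  shows "bern (insert i I) \<alpha> F = (1 - \<alpha>) * bern I \<alpha> F + \<alpha> * bern I \<alpha> (\<lambda>J. F (insert i J))"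
proof -
  have inj: "inj_on (insert i) (Pow I)" using assms by (auto simp: inj_on_def)
  have disj: "Pow I \<inter> insert i ` Pow I = {}" using assms by auto
  let ?h = "\<lambda>I J. \<alpha> ^ card J * (1 - \<alpha>) ^ card (I - J) * F J"
  have "bern (insert i I) \<alpha> F = sum (?h (insert i I)) (Pow I) + (\<Sum>J\<in>Pow I. ?h (insert i I) (insert i J))"
    unfolding Pow_insert bern_def using assms disj
    by (subst sum.union_disjoint) (auto simp: sum.reindex[OF inj])
  also have "sum (?h (insert i I)) (Pow I) = (1 - \<alpha>) * bern I \<alpha> F"
    unfolding bern_def sum_distrib_left
  proof (intro sum.cong refl)
    fix J assume "J \<in> Pow I"
    then have "insert i I - J = insert i (I - J)" "i \<notin> I - J" "finite (I - J)" using assms by auto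
    then show "?h (insert i I) J = (1 - \<alpha>) * ?h I J" by simp
  qed
  also have "(\<Sum>J\<in>Pow I. ?h (insert i I) (insert i J)) = \<alpha> * bern I \<alpha> (\<lambda>J. F (insert i J))"
    unfolding bern_def sum_distrib_left
  proof (intro sum.cong refl)
    fix J assume "J \<in> Pow I"
    then have "insert i I - insert i J = I - J" "i \<notin> J" "finite J"
      using assms by (auto intro: finite_subset)
    then show "?h (insert i I) (insert i J)
        = \<alpha> * (\<alpha> ^ card J * (1 - \<alpha>) ^ card (I - J) * F (insert i J))" by simp
  qed
  finally show ?thesis .
qed

lemma bern_cong: "(\<And>J. J \<subseteq> I \<Longrightarrow> F J = G J) \<Longrightarrow> bern I \<alpha> F = bern I \<alpha> G"
  by (simp add: bern_def)

lemma bern_add: "bern I \<alpha> (\<lambda>J. F J + G J) = bern I \<alpha> F + bern I \<alpha> G"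
  by (simp add: bern_def sum.distrib distrib_left)

lemma bern_diff: "bern I \<alpha> (\<lambda>J. F J - G J) = bern I \<alpha> F - bern I \<alpha> G"
  by (simp add: bern_def sum_subtractf right_diff_distrib)

lemma bern_mult: "bern I \<alpha> (\<lambda>J. c * F J) = c * bern I \<alpha> F"
  by (simp add: bern_def sum_distrib_left mult_ac)

lemma bern_remove:
  assumes "finite I" "i \<in> I"
  shows "bern I \<alpha> F = bern (I - {i}) \<alpha> (\<lambda>J. (1 - \<alpha>) * F J + \<alpha> * F (insert i J))"
proof -
  have "bern I \<alpha> F = bern (insert i (I - {i})) \<alpha> F" using assms by (simp add: insert_absorb)
  also have "\<dots> = (1 - \<alpha>) * bern (I - {i}) \<alpha> F + \<alpha> * bern (I - {i}) \<alpha> (\<lambda>J. F (insert i J))"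
    using assms by (intro bern_insert) auto
  finally show ?thesis
    by (simp add: bern_add bern_mult)
qed

lemma bern_zero [simp]: "bern I \<alpha> (\<lambda>J. 0) = 0"
  by (simp add: bern_def)

lemma bern_sum: "bern I \<alpha> (\<lambda>J. \<Sum>k\<in>K. F k J) = (\<Sum>k\<in>K. bern I \<alpha> (F k))"
  unfolding bern_def sum_distrib_left by (rule sum.swap)

lemma bern_mono:
  assumes "0 \<le> \<alpha>" "\<alpha> \<le> 1" "\<And>J. J \<subseteq> I \<Longrightarrow> F J \<le> G J"
  shows "bern I \<alpha> F \<le> bern I \<alpha> G"
  unfolding bern_def using assms by (intro sum_mono mult_left_mono) auto

lemma bern_nonneg:
  assumes "0 \<le> \<alpha>" "\<alpha> \<le> 1" "\<And>J. J \<subseteq> I \<Longrightarrow> 0 \<le> F J"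
  shows "0 \<le> bern I \<alpha> F"
  using bern_mono[OF assms(1,2), of I "\<lambda>_. 0" F] assms(3) by simp

lemma bern_abs:
  assumes "0 \<le> \<alpha>" "\<alpha> \<le> 1"
  shows "\<bar>bern I \<alpha> F\<bar> \<le> bern I \<alpha> (\<lambda>J. \<bar>F J\<bar>)"
proof -
  have "bern I \<alpha> F \<le> bern I \<alpha> (\<lambda>J. \<bar>F J\<bar>)" "bern I \<alpha> (\<lambda>J. - F J) \<le> bern I \<alpha> (\<lambda>J. \<bar>F J\<bar>)"
    by (intro bern_mono assms; simp)+
  then show ?thesis using bern_mult[of I \<alpha> "-1" F] by simp
qed

lemma bern_superset:
  assumes "finite I" "A \<subseteq> I"
  shows "bern I \<alpha> (\<lambda>J. of_bool (A \<subseteq> J)) = \<alpha> ^ card A"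
  using assms
proof (induction I arbitrary: A)
  case (insert i I)
  show ?case
  proof (cases "i \<in> A")
    case True
    then obtain B where B: "A = insert i B" "i \<notin> B" by (meson mk_disjoint_insert)
    then have BI: "B \<subseteq> I" "finite B" using insert.prems insert.hyps by (auto intro: finite_subset)
    have "bern I \<alpha> (\<lambda>J. of_bool (A \<subseteq> J)) = bern I \<alpha> (\<lambda>J. 0)"
      using insert.hyps B by (intro bern_cong) auto
    moreover have "bern I \<alpha> (\<lambda>J. of_bool (A \<subseteq> insert i J)) = bern I \<alpha> (\<lambda>J. of_bool (B \<subseteq> J))"
      using B by (intro bern_cong arg_cong[where f = of_bool]) auto
    ultimately show ?thesis
      using insert.hyps insert.IH[OF BI(1)] B BI by (simp add: bern_insert)
  next
    case False
    then have "A \<subseteq> I" and "A \<subseteq> insert i J \<longleftrightarrow> A \<subseteq> J" for J using insert.prems by auto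
    then show ?thesis
      using insert.hyps insert.IH[of A] by (simp add: bern_insert algebra_simps)
  qed
qed simp

lemma bern_one: "finite I \<Longrightarrow> bern I \<alpha> (\<lambda>J. 1) = 1"
  using bern_superset[of I "{}" \<alpha>] by simp

lemma bern_const: "finite I \<Longrightarrow> bern I \<alpha> (\<lambda>J. c) = c"
  using bern_mult[of I \<alpha> c "\<lambda>_. 1"] by (simp add: bern_one)

lemma bern_Cauchy_Schwarz:
  assumes "0 \<le> \<alpha>" "\<alpha> \<le> 1"
  shows "(bern I \<alpha> (\<lambda>J. F J * G J))\<^sup>2 \<le> bern I \<alpha> (\<lambda>J. (F J)\<^sup>2) * bern I \<alpha> (\<lambda>J. (G J)\<^sup>2)"
proof -
  define w where "w J = sqrt (\<alpha> ^ card J * (1 - \<alpha>) ^ card (I - J))" for J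
  have w: "\<alpha> ^ card J * (1 - \<alpha>) ^ card (I - J) = w J * w J" for J
    using assms by (simp add: w_def)
  have "(\<Sum>J\<in>Pow I. (w J * F J) * (w J * G J))\<^sup>2
      \<le> (\<Sum>J\<in>Pow I. (w J * F J)\<^sup>2) * (\<Sum>J\<in>Pow I. (w J * G J)\<^sup>2)"
    by (rule Cauchy_Schwarz_ineq_sum)
  then show ?thesis
    unfolding bern_def w by (simp add: power2_eq_square mult_ac)
qed

lemma bern_nswap:
  assumes "e \<in> {1..<N}"
  shows "bern {1..N} \<alpha> (\<lambda>J. F (nswap e ` J)) = bern {1..N} \<alpha> F"
proof -
  have img: "nswap e ` {1..N} = {1..N}" using assms by (auto intro!: nswap_image_both)
  have bij: "bij_betw ((`) (nswap e)) (Pow {1..N}) (Pow {1..N})"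
    using bij_betw_Pow[OF inj_on_imp_bij_betw[OF inj_nswap[of e "{1..N}"]]] img by simp
  have c: "card ({1..N} - nswap e ` J) = card ({1..N} - J)" for J
  proof -
    have "{1..N} - nswap e ` J = nswap e ` ({1..N} - J)"
      using img by (simp add: image_set_diff inj_nswap)
    then show ?thesis by simp
  qed
  show ?thesis
    unfolding bern_def by (subst (2) sum.reindex_bij_betw[OF bij, symmetric]) (simp only: c card_nswap_image)
qed

text \<open>Conditioning on one site makes \<open>bern\<close> affine in the parameter of that site,
  and the formula is the product rule for these affine factors.\<close>

lemma Russo_formula:
  assumes "finite I"
  shows "((\<lambda>\<theta>. bern I \<theta> F) has_real_derivative
     (\<Sum>x\<in>I. bern (I - {x}) \<theta> (\<lambda>J. F (insert x J) - F J))) (at \<theta>)"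
  using assms
proof (induction I arbitrary: F)
  case (insert i I)
  have eq: "(\<lambda>\<theta>. bern (insert i I) \<theta> F) =
      (\<lambda>\<theta>. (1 - \<theta>) * bern I \<theta> F + \<theta> * bern I \<theta> (\<lambda>J. F (insert i J)))"
    using insert.hyps by (simp add: bern_insert)
  have "bern (insert i I - {x}) \<theta> (\<lambda>J. F (insert x J) - F J) =
      (1 - \<theta>) * bern (I - {x}) \<theta> (\<lambda>J. F (insert x J) - F J)
      + \<theta> * bern (I - {x}) \<theta> (\<lambda>J. F (insert i (insert x J)) - F (insert i J))" if "x \<in> I" for x
  proof -
    have "insert i I - {x} = insert i (I - {x})" using that insert.hyps by auto
    then show ?thesis using insert.hyps by (simp add: bern_insert insert_commute)
  qed
  then have "(\<Sum>x\<in>insert i I. bern (insert i I - {x}) \<theta> (\<lambda>J. F (insert x J) - F J)) =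
     bern I \<theta> (\<lambda>J. F (insert i J)) - bern I \<theta> F
     + ((1 - \<theta>) * (\<Sum>x\<in>I. bern (I - {x}) \<theta> (\<lambda>J. F (insert x J) - F J))
     + \<theta> * (\<Sum>x\<in>I. bern (I - {x}) \<theta> (\<lambda>J. F (insert i (insert x J)) - F (insert i J))))"
    using insert.hyps by (simp add: bern_diff sum.distrib sum_distrib_left)
  then show ?case
    unfolding eq
    by (auto intro!: derivative_eq_intros insert.IH simp: insert_commute algebra_simps)
qed simp

subsection \<open>Two tagged particles in a common environment\<close>

text \<open>
  The tagged particles \<open>x, y \<in> J\<close> are conditionally independent given the history of the unlabelled
  set \<open>J\<close>: a bond with both ends in \<open>J\<close> leaves \<open>J\<close> unchanged and moves them by independent coins,
  any other bond carries them along with \<open>J\<close>.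
\<close>

definition pbond :: "nat \<Rightarrow> (nat \<Rightarrow> nat \<Rightarrow> nat set \<Rightarrow> real) \<Rightarrow> nat \<Rightarrow> nat \<Rightarrow> nat set \<Rightarrow> real" where
  "pbond e V x y J = (if e \<in> J \<and> Suc e \<in> J
     then (V x y J + V (nswap e x) y J + V x (nswap e y) J + V (nswap e x) (nswap e y) J) / 4
     else (V x y J + V (nswap e x) (nswap e y) (nswap e ` J)) / 2)"

text \<open>A known particle and a known hole both remove \<open>i\<close> from \<open>J\<close>, so
  only their total weight \<open>1 - \<alpha>\<close> survives. This is how the densities of the
  reservoirs drop out of the pair process. A tag at \<open>i\<close> is killed.\<close>

definition presv :: "real \<Rightarrow> nat \<Rightarrow> (nat \<Rightarrow> nat \<Rightarrow> nat set \<Rightarrow> real) \<Rightarrow> nat \<Rightarrow> nat \<Rightarrow> nat set \<Rightarrow> real" where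
  "presv \<alpha> i V x y J = (if x = i \<or> y = i then 0
     else \<alpha> * V x y (insert i J) + (1 - \<alpha>) * V x y (J - {i}))"

definition pskel :: "nat \<Rightarrow> real \<Rightarrow> (nat \<Rightarrow> nat \<Rightarrow> nat set \<Rightarrow> real) \<Rightarrow> nat \<Rightarrow> nat \<Rightarrow> nat set \<Rightarrow> real" where
  "pskel N \<alpha> V x y J =
     ((\<Sum>e\<in>{1..<N}. pbond e V x y J) + presv \<alpha> 1 V x y J / 2 + presv \<alpha> N V x y J / 2) / real N"

definition qform :: "(nat \<Rightarrow> nat \<Rightarrow> nat set \<Rightarrow> real) \<Rightarrow> (nat \<Rightarrow> real) \<Rightarrow> nat set \<Rightarrow> real" where
  "qform V a J = (\<Sum>x\<in>J. \<Sum>y\<in>J. a x * a y * V x y J)"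

text \<open>Jensen's inequality for the weights of \<open>skel\<close>; the defect is the weighted
  variance around \<open>m\<close>.\<close>

lemma skel_convexity:
  fixes z :: "nat \<Rightarrow> real"
  assumes "N \<ge> 1"
  shows "(((\<Sum>e\<in>{1..<N}. z e) + u / 2 + v / 2) / real N)\<^sup>2
     \<le> ((\<Sum>e\<in>{1..<N}. (z e)\<^sup>2) + u\<^sup>2 / 2 + v\<^sup>2 / 2) / real N"
proof -
  define m where "m = ((\<Sum>e\<in>{1..<N}. z e) + u / 2 + v / 2) / real N"
  have m: "(\<Sum>e\<in>{1..<N}. z e) + u / 2 + v / 2 = real N * m" using assms by (simp add: m_def)
  have "0 \<le> (\<Sum>e\<in>{1..<N}. (z e - m)\<^sup>2) + (u - m)\<^sup>2 / 2 + (v - m)\<^sup>2 / 2"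
    by (intro add_nonneg_nonneg sum_nonneg) auto
  also have "(\<Sum>e\<in>{1..<N}. (z e - m)\<^sup>2) = (\<Sum>e\<in>{1..<N}. (z e)\<^sup>2) - 2 * m * (\<Sum>e\<in>{1..<N}. z e) + (real N - 1) * m\<^sup>2"
    using assms by (simp add: power2_diff sum.distrib sum_subtractf sum_distrib_left of_nat_diff mult_ac)
  also have "\<dots> + (u - m)\<^sup>2 / 2 + (v - m)\<^sup>2 / 2 = (\<Sum>e\<in>{1..<N}. (z e)\<^sup>2) + u\<^sup>2 / 2 + v\<^sup>2 / 2
      - 2 * m * ((\<Sum>e\<in>{1..<N}. z e) + u / 2 + v / 2) + real N * m\<^sup>2"
    by (simp add: power2_eq_square field_simps)
  also have "\<dots> = (\<Sum>e\<in>{1..<N}. (z e)\<^sup>2) + u\<^sup>2 / 2 + v\<^sup>2 / 2 - real N * m\<^sup>2"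
    unfolding m by (simp add: power2_eq_square)
  finally show ?thesis
    unfolding m_def[symmetric] using assms by (simp add: field_simps)
qed

lemma qform_pskel:
  "qform (pskel N \<alpha> V) a J =
     ((\<Sum>e\<in>{1..<N}. qform (pbond e V) a J) + qform (presv \<alpha> 1 V) a J / 2 + qform (presv \<alpha> N V) a J / 2) / real N"
proof -
  have "qform (pskel N \<alpha> V) a J = (\<Sum>x\<in>J. \<Sum>y\<in>J. ((\<Sum>e\<in>{1..<N}. a x * a y * pbond e V x y J)
      + a x * a y * presv \<alpha> 1 V x y J / 2 + a x * a y * presv \<alpha> N V x y J / 2) / real N)"
    by (simp add: qform_def pskel_def sum_distrib_left distrib_left)
  also have "\<dots> = ((\<Sum>x\<in>J. \<Sum>y\<in>J. \<Sum>e\<in>{1..<N}. a x * a y * pbond e V x y J) 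
       + qform (presv \<alpha> 1 V) a J / 2 + qform (presv \<alpha> N V) a J / 2) / real N"
    by (simp add: qform_def sum.distrib sum_divide_distrib[symmetric])
  also have "(\<Sum>x\<in>J. \<Sum>y\<in>J. \<Sum>e\<in>{1..<N}. a x * a y * pbond e V x y J) = (\<Sum>e\<in>{1..<N}. qform (pbond e V) a J)"
    unfolding qform_def by (subst sum.swap[of _ "{1..<N}"], subst sum.swap[of _ "{1..<N}"]) (rule refl)
  finally show ?thesis .
qed

lemma sum_nswap: "(\<Sum>x\<in>nswap e ` J. h x) = (\<Sum>x\<in>J. h (nswap e x))"
  by (simp add: sum.reindex)

text \<open>If both ends carry coins, the swap cannot be seen in the configuration and the averaging
  acts linearly on the coefficients. No convexity is spent, and squaring the averaged coefficients
  yields four terms, that is, independent moves of the two tags. Otherwise the swap moves the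
  environment; Jensen's inequality is applied, and both tags move together.\<close>

lemma walsh_bond_square_le:
  assumes V: "\<And>a J \<eta>. J \<subseteq> {1..N} \<Longrightarrow> (walsh f 0 a J \<eta>)\<^sup>2 \<le> qform V a J"
    and e: "e \<in> {1..<N}" and J: "J \<subseteq> {1..N}"
  shows "(walsh (bond e f) 0 a J \<eta>)\<^sup>2 \<le> qform (pbond e V) a J"
proof (cases "e \<in> J \<and> Suc e \<in> J")
  case True
  then have img: "nswap e ` J = J" by (simp add: nswap_image_both)
  \<comment> \<open>Both ends lie in \<open>J\<close>, so the values of \<open>\<eta>\<close> there
    are overwritten by coins.\<close>
  have idem: "walsh f 0 b J (\<eta> \<circ> nswap e) = walsh f 0 b J \<eta>" for b
  proof -
    have "coin_cfg J B (\<eta> \<circ> nswap e) = coin_cfg J B \<eta>" for B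
      using True by (auto simp: coin_cfg_def fun_eq_iff nswap_def)
    then show ?thesis by (simp add: walsh_def)
  qed
  let ?b = "\<lambda>x. 1/2 * (a x + a (nswap e x))"
  have sw: "(\<Sum>x\<in>J. h (nswap e x)) = (\<Sum>x\<in>J. h x)" for h :: "nat \<Rightarrow> real"
    using sum_nswap[of h e J] by (simp add: img)
  have "walsh (bond e f) 0 a J \<eta> = walsh f 0 ?b J \<eta>"
    using walsh_add[of f 0 0 a "a \<circ> nswap e" J \<eta>] walsh_mult[of f "1/2" 0 "\<lambda>x. a x + a (nswap e x)" J \<eta>]
    by (simp add: walsh_bond img idem)
  also have "(\<dots>)\<^sup>2 \<le> qform V ?b J" by (rule V[OF J])
  also have "\<dots> = (\<Sum>x\<in>J. \<Sum>y\<in>J. (a x * a y * V x y J + a (nswap e x) * a y * V x y J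
        + a x * a (nswap e y) * V x y J + a (nswap e x) * a (nswap e y) * V x y J) / 4)"
    unfolding qform_def by (intro sum.cong refl) (simp add: field_simps)
  also have "\<dots> = ((\<Sum>x\<in>J. \<Sum>y\<in>J. a x * a y * V x y J) + (\<Sum>x\<in>J. \<Sum>y\<in>J. a (nswap e x) * a y * V x y J)
        + (\<Sum>x\<in>J. \<Sum>y\<in>J. a x * a (nswap e y) * V x y J) + (\<Sum>x\<in>J. \<Sum>y\<in>J. a (nswap e x) * a (nswap e y) * V x y J)) / 4"
    by (simp add: sum.distrib sum_divide_distrib[symmetric])
  also have "(\<Sum>x\<in>J. \<Sum>y\<in>J. a (nswap e x) * a y * V x y J) = (\<Sum>x\<in>J. \<Sum>y\<in>J. a x * a y * V (nswap e x) y J)"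
    using sw[of "\<lambda>x. \<Sum>y\<in>J. a x * a y * V (nswap e x) y J"] by simp
  also have "(\<Sum>x\<in>J. \<Sum>y\<in>J. a x * a (nswap e y) * V x y J) = (\<Sum>x\<in>J. \<Sum>y\<in>J. a x * a y * V x (nswap e y) J)"
  proof (rule sum.cong[OF refl])
    fix x
    show "(\<Sum>y\<in>J. a x * a (nswap e y) * V x y J) = (\<Sum>y\<in>J. a x * a y * V x (nswap e y) J)"
      using sw[of "\<lambda>y. a x * a y * V x (nswap e y) J"] by simp
  qed
  also have "(\<Sum>x\<in>J. \<Sum>y\<in>J. a (nswap e x) * a (nswap e y) * V x y J) = (\<Sum>x\<in>J. \<Sum>y\<in>J. a x * a y * V (nswap e x) (nswap e y) J)"
  proof -
    have "(\<Sum>y\<in>J. a (nswap e x) * a (nswap e y) * V x y J) = (\<Sum>y\<in>J. a (nswap e x) * a y * V x (nswap e y) J)" for x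
      using sw[of "\<lambda>y. a (nswap e x) * a y * V x (nswap e y) J"] by simp
    then show ?thesis using sw[of "\<lambda>x. \<Sum>y\<in>J. a x * a y * V (nswap e x) (nswap e y) J"] by simp
  qed
  finally show ?thesis
    using True unfolding qform_def pbond_def
    by (simp add: sum.distrib sum_divide_distrib[symmetric] distrib_left)
next
  case False
  let ?u = "walsh f 0 a J \<eta>" and ?v = "walsh f 0 (a \<circ> nswap e) (nswap e ` J) (\<eta> \<circ> nswap e)"
  have "(walsh (bond e f) 0 a J \<eta>)\<^sup>2 = ((?u + ?v) / 2)\<^sup>2" by (simp add: walsh_bond)
  also have "\<dots> \<le> (?u\<^sup>2 + ?v\<^sup>2) / 2"
    using zero_le_power2[of "?u - ?v"] by (simp add: power2_eq_square field_simps)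
  also have "\<dots> \<le> (qform V a J + qform V (a \<circ> nswap e) (nswap e ` J)) / 2"
    using V J nswap_image_subset[OF e J] by (intro divide_right_mono add_mono) auto
  also have "qform V (a \<circ> nswap e) (nswap e ` J) = (\<Sum>x\<in>J. \<Sum>y\<in>J. a x * a y * V (nswap e x) (nswap e y) (nswap e ` J))"
    by (simp add: qform_def sum_nswap)
  also have "(qform V a J + \<dots>) / 2 = qform (pbond e V) a J"
    unfolding qform_def pbond_def if_not_P[OF False]
    by (simp add: sum.distrib sum_divide_distrib[symmetric] distrib_left)
  finally show ?thesis .
qed

lemma square_convex3:
  fixes u v w :: real
  assumes "0 \<le> a" "0 \<le> b" "0 \<le> c" "a + b + c = 1"
  shows "(a * u + b * v + c * w)\<^sup>2 \<le> a * u\<^sup>2 + b * v\<^sup>2 + c * w\<^sup>2"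
proof -
  have "0 \<le> a * b * (u - v)\<^sup>2 + a * c * (u - w)\<^sup>2 + b * c * (v - w)\<^sup>2"
    using assms by auto
  also have "\<dots> = (a + b + c) * (a * u\<^sup>2 + b * v\<^sup>2 + c * w\<^sup>2) - (a * u + b * v + c * w)\<^sup>2"
    by (simp add: power2_eq_square algebra_simps)
  finally show ?thesis using assms by simp
qed

lemma walsh_resv_square_le:
  assumes V: "\<And>a J \<eta>. J \<subseteq> {1..N} \<Longrightarrow> (walsh f 0 a J \<eta>)\<^sup>2 \<le> qform V a J"
    and i: "i \<in> {1..N}" and J: "J \<subseteq> {1..N}"
    and \<alpha>: "0 \<le> \<alpha>" "\<alpha> / 2 \<le> r" "\<alpha> / 2 \<le> 1 - r"
  shows "(walsh (resv i r f) 0 a J \<eta>)\<^sup>2 \<le> qform (presv \<alpha> i V) a J"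
proof -
  have fin: "finite J" using J by (rule finite_subset) simp
  let ?b = "a(i := 0)"
  let ?u = "walsh f 0 ?b (insert i J) \<eta>"
    and ?v = "walsh f 0 ?b (J - {i}) (\<eta>(i := 1))" and ?w = "walsh f 0 ?b (J - {i}) (\<eta>(i := 0))"
  have "(walsh (resv i r f) 0 a J \<eta>)\<^sup>2 = (\<alpha> * ?u + (r - \<alpha> / 2) * ?v + (1 - r - \<alpha> / 2) * ?w)\<^sup>2"
    by (subst walsh_resv[OF fin, where \<alpha> = \<alpha>]) (rule refl)
  also have "\<dots> \<le> \<alpha> * ?u\<^sup>2 + (r - \<alpha> / 2) * ?v\<^sup>2 + (1 - r - \<alpha> / 2) * ?w\<^sup>2"
    using \<alpha> by (intro square_convex3) auto
  also have "\<dots> \<le> \<alpha> * qform V ?b (insert i J) + (r - \<alpha> / 2) * qform V ?b (J - {i})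
      + (1 - r - \<alpha> / 2) * qform V ?b (J - {i})"
    using \<alpha> J i by (intro add_mono mult_left_mono V) auto
  also have "\<dots> = \<alpha> * qform V ?b (insert i J) + (1 - \<alpha>) * qform V ?b (J - {i})"
    by (simp add: algebra_simps)
  also have "\<dots> = qform (presv \<alpha> i V) a J"
  proof -
    \<comment> \<open>The coefficient at \<open>i\<close> is 0, so both quadratic forms live on
      \<open>J - {i}\<close>, whether or not \<open>i\<close> belongs to the set.\<close>
    have z: "(\<Sum>x\<in>K. \<Sum>y\<in>K. ?b x * ?b y * h x y) = (\<Sum>x\<in>J - {i}. \<Sum>y\<in>J - {i}. a x * a y * h x y)"
      if "K - {i} = J - {i}" "finite K" for K and h :: "nat \<Rightarrow> nat \<Rightarrow> real"
    proof -
      have "(\<Sum>x\<in>K. \<Sum>y\<in>K. ?b x * ?b y * h x y) = (\<Sum>x\<in>K - {i}. \<Sum>y\<in>K. ?b x * ?b y * h x y)"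
        using that(2) by (intro sum.mono_neutral_right) auto
      also have "\<dots> = (\<Sum>x\<in>K - {i}. \<Sum>y\<in>K - {i}. ?b x * ?b y * h x y)"
        using that(2) by (intro sum.cong refl sum.mono_neutral_right) auto
      finally show ?thesis using that(1) by simp
    qed
    have "qform (presv \<alpha> i V) a J = (\<Sum>x\<in>J - {i}. \<Sum>y\<in>J. a x * a y * presv \<alpha> i V x y J)"
      unfolding qform_def using fin by (intro sum.mono_neutral_right) (auto simp: presv_def)
    also have "\<dots> = (\<Sum>x\<in>J - {i}. \<Sum>y\<in>J - {i}. a x * a y * presv \<alpha> i V x y J)"
      using fin by (intro sum.cong refl sum.mono_neutral_right) (auto simp: presv_def)
    also have "\<dots> = (\<Sum>x\<in>J - {i}. \<Sum>y\<in>J - {i}. \<alpha> * (a x * a y * V x y (insert i J))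
        + (1 - \<alpha>) * (a x * a y * V x y (J - {i})))"
      by (intro sum.cong refl) (auto simp: presv_def algebra_simps)
    also have "\<dots> = \<alpha> * (\<Sum>x\<in>J - {i}. \<Sum>y\<in>J - {i}. a x * a y * V x y (insert i J))
        + (1 - \<alpha>) * (\<Sum>x\<in>J - {i}. \<Sum>y\<in>J - {i}. a x * a y * V x y (J - {i}))"
      by (simp only: sum.distrib sum_distrib_left)
    finally show ?thesis
      unfolding qform_def using fin by (subst (1 2) z) auto
  qed
  finally show ?thesis .
qed

lemma walsh_skel_square_le:
  assumes V: "\<And>a J \<eta>. J \<subseteq> {1..N} \<Longrightarrow> (walsh f 0 a J \<eta>)\<^sup>2 \<le> qform V a J"
    and N: "N \<ge> 1" and J: "J \<subseteq> {1..N}"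
    and \<alpha>: "0 \<le> \<alpha>" "\<alpha> / 2 \<le> p" "\<alpha> / 2 \<le> 1 - p" "\<alpha> / 2 \<le> q" "\<alpha> / 2 \<le> 1 - q"
  shows "(walsh (skel N p q f) 0 a J \<eta>)\<^sup>2 \<le> qform (pskel N \<alpha> V) a J"
proof -
  have "(walsh (skel N p q f) 0 a J \<eta>)\<^sup>2 \<le>
     ((\<Sum>e\<in>{1..<N}. (walsh (bond e f) 0 a J \<eta>)\<^sup>2) + (walsh (resv 1 p f) 0 a J \<eta>)\<^sup>2 / 2
       + (walsh (resv N q f) 0 a J \<eta>)\<^sup>2 / 2) / real N"
    unfolding walsh_skel by (rule skel_convexity[OF N])
  also have "\<dots> \<le> qform (pskel N \<alpha> V) a J"
    unfolding qform_pskel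
    using N by (intro divide_right_mono add_mono sum_mono walsh_bond_square_le[OF V _ J]
        walsh_resv_square_le[OF V _ J]) (use \<alpha> in auto)
  finally show ?thesis .
qed

definition pdiag :: "nat \<Rightarrow> nat \<Rightarrow> nat set \<Rightarrow> real" where
  "pdiag x y J = of_bool (x = y)"

text \<open>Bessel's inequality at time 0 is propagated backwards. The kernel on the right is the
  probability that two tags, conditionally independent given the history of the environment, are
  alive and at the same site after \<open>n\<close> steps.\<close>

lemma walsh_skel_power_square_le:
  assumes f: "\<And>\<zeta>. \<bar>f \<zeta>\<bar> \<le> 1" and N: "N \<ge> 1" and J: "J \<subseteq> {1..N}"
    and \<alpha>: "0 \<le> \<alpha>" "\<alpha> / 2 \<le> p" "\<alpha> / 2 \<le> 1 - p" "\<alpha> / 2 \<le> q" "\<alpha> / 2 \<le> 1 - q"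
  shows "(walsh ((skel N p q ^^ n) f) 0 a J \<eta>)\<^sup>2 \<le> qform ((pskel N \<alpha> ^^ n) pdiag) a J"
  using J
proof (induction n arbitrary: a J \<eta>)
  case 0
  then have fin: "finite J" by (rule finite_subset) simp
  have "(\<Sum>y\<in>J. a x * a y * of_bool (x = y)) = (a x)\<^sup>2" if "x \<in> J" for x
  proof -
    have "(\<Sum>y\<in>J. a x * a y * of_bool (x = y)) = (\<Sum>y\<in>J. if x = y then a x * a y else 0)"
      by (intro sum.cong) auto
    then show ?thesis using fin that by (simp add: sum.delta power2_eq_square)
  qed
  then have "qform pdiag a J = (\<Sum>y\<in>J. (a y)\<^sup>2)"
    by (simp add: qform_def pdiag_def)
  then show ?case using walsh_square_le[OF fin, of f 0 a \<eta>] f by simp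
next
  case (Suc n)
  then show ?case
    using walsh_skel_square_le[OF Suc.IH N Suc.prems \<alpha>] by simp
qed

subsection \<open>The collision estimate\<close>

text \<open>The inner product of the reversible measure: product Bernoulli for \<open>J\<close>,
  counting measure for the two tags in \<open>J\<close>.\<close>

definition pair_ip :: "nat \<Rightarrow> real \<Rightarrow> (nat \<Rightarrow> nat \<Rightarrow> nat set \<Rightarrow> real) \<Rightarrow> (nat \<Rightarrow> nat \<Rightarrow> nat set \<Rightarrow> real) \<Rightarrow> real" where
  "pair_ip N \<alpha> g h = bern {1..N} \<alpha> (\<lambda>J. \<Sum>x\<in>J. \<Sum>y\<in>J. g x y J * h x y J)"

lemma pair_ip_commute: "pair_ip N \<alpha> g h = pair_ip N \<alpha> h g"
  by (simp add: pair_ip_def mult.commute)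

lemma pair_ip_add: "pair_ip N \<alpha> (\<lambda>x y J. g x y J + g' x y J) h = pair_ip N \<alpha> g h + pair_ip N \<alpha> g' h"
  by (simp add: pair_ip_def distrib_right sum.distrib bern_add)

lemma pair_ip_diff: "pair_ip N \<alpha> (\<lambda>x y J. g x y J - g' x y J) h = pair_ip N \<alpha> g h - pair_ip N \<alpha> g' h"
  by (simp add: pair_ip_def left_diff_distrib sum_subtractf bern_diff)

lemma pair_ip_mult: "pair_ip N \<alpha> (\<lambda>x y J. c * g x y J) h = c * pair_ip N \<alpha> g h"
  by (simp add: pair_ip_def mult.assoc sum_distrib_left[symmetric] bern_mult)

lemma pair_ip_sum: "pair_ip N \<alpha> (\<lambda>x y J. \<Sum>e\<in>E. g e x y J) h = (\<Sum>e\<in>E. pair_ip N \<alpha> (g e) h)"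
proof (cases "finite E")
  case True
  then show ?thesis by induction (simp_all add: pair_ip_add, simp add: pair_ip_def)
qed (simp add: pair_ip_def)

lemma pair_ip_mono:
  assumes "0 \<le> \<alpha>" "\<alpha> \<le> 1" "\<And>x y J. g x y J * h x y J \<le> g' x y J * h' x y J"
  shows "pair_ip N \<alpha> g h \<le> pair_ip N \<alpha> g' h'"
  unfolding pair_ip_def using assms by (intro bern_mono sum_mono) auto

lemma pair_ip_nonneg: "0 \<le> \<alpha> \<Longrightarrow> \<alpha> \<le> 1 \<Longrightarrow> 0 \<le> pair_ip N \<alpha> g g"
  unfolding pair_ip_def by (intro bern_nonneg sum_nonneg) auto

section \<open>Reversibility and dissipation of the pair operator\<close>

lemma pbond_idem: "pbond e (pbond e V) = pbond e V"
proof (intro ext)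
  fix x y J
  show "pbond e (pbond e V) x y J = pbond e V x y J"
  proof (cases "e \<in> J \<and> Suc e \<in> J")
    case False
    then have "\<not> (e \<in> nswap e ` J \<and> Suc e \<in> nswap e ` J)"
      by (auto simp: mem_nswap_image nswap_def)
    with False show ?thesis by (auto simp: pbond_def add_divide_distrib)
  qed (simp add: pbond_def add_divide_distrib)
qed

lemma presv_idem: "presv \<alpha> i (presv \<alpha> i V) = presv \<alpha> i V"
proof (intro ext)
  fix x y J
  have "insert i J - {i} = J - {i}" "insert i (J - {i}) = insert i J" by auto
  then show "presv \<alpha> i (presv \<alpha> i V) x y J = presv \<alpha> i V x y J"
    by (simp add: presv_def algebra_simps)
qed

lemma pbond_self_adjoint:
  assumes e: "e \<in> {1..<N}"
  shows "pair_ip N \<alpha> (pbond e V) g = pair_ip N \<alpha> V (pbond e g)"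
proof -
  \<comment> \<open>The defect of symmetry changes sign when the two ends are exchanged, while the
    Bernoulli law is invariant; hence its mean vanishes.\<close>
  define D where "D J = (\<Sum>x\<in>J. \<Sum>y\<in>J. pbond e V x y J * g x y J) - (\<Sum>x\<in>J. \<Sum>y\<in>J. V x y J * pbond e g x y J)" for J
  have anti: "D (nswap e ` J) = - D J" for J
  proof (cases "e \<in> J \<and> Suc e \<in> J")
    case True
    then have img: "nswap e ` J = J" by (simp add: nswap_image_both)
    have sw: "(\<Sum>x\<in>J. h (nswap e x)) = (\<Sum>x\<in>J. h x)" for h :: "nat \<Rightarrow> real"
      using sum_nswap[of h e J] by (simp add: img)
    have A: "(\<Sum>x\<in>J. \<Sum>y\<in>J. V (nswap e x) y J * g x y J) = (\<Sum>x\<in>J. \<Sum>y\<in>J. V x y J * g (nswap e x) y J)" for V g :: "nat \<Rightarrow> nat \<Rightarrow> nat set \<Rightarrow> real"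
      using sw[of "\<lambda>x. \<Sum>y\<in>J. V (nswap e x) y J * g x y J"] by simp
    have B: "(\<Sum>x\<in>J. \<Sum>y\<in>J. V x (nswap e y) J * g x y J) = (\<Sum>x\<in>J. \<Sum>y\<in>J. V x y J * g x (nswap e y) J)" for V g :: "nat \<Rightarrow> nat \<Rightarrow> nat set \<Rightarrow> real"
    proof (rule sum.cong[OF refl])
      fix x
      show "(\<Sum>y\<in>J. V x (nswap e y) J * g x y J) = (\<Sum>y\<in>J. V x y J * g x (nswap e y) J)"
        using sw[of "\<lambda>y. V x (nswap e y) J * g x y J"] by simp
    qed
    have C: "(\<Sum>x\<in>J. \<Sum>y\<in>J. V (nswap e x) (nswap e y) J * g x y J) = (\<Sum>x\<in>J. \<Sum>y\<in>J. V x y J * g (nswap e x) (nswap e y) J)" for V g :: "nat \<Rightarrow> nat \<Rightarrow> nat set \<Rightarrow> real"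
      using A[of "\<lambda>x y J. V x (nswap e y) J" g] B[of V "\<lambda>x y J. g (nswap e x) y J"] by simp
    have "D J = 0"
      using True A[of V g] B[of V g] C[of V g] unfolding D_def pbond_def
      by (simp add: sum.distrib sum_divide_distrib[symmetric] distrib_right distrib_left)
    then show ?thesis by (simp add: img)
  next
    case False
    then have F: "\<not> (e \<in> nswap e ` J \<and> Suc e \<in> nswap e ` J)"
      by (auto simp: mem_nswap_image nswap_def)
    let ?t = "nswap e"
    have 1: "2 * D J = (\<Sum>x\<in>J. \<Sum>y\<in>J. V (?t x) (?t y) (?t ` J) * g x y J) - (\<Sum>x\<in>J. \<Sum>y\<in>J. V x y J * g (?t x) (?t y) (?t ` J))"
      if "\<not> (e \<in> J \<and> Suc e \<in> J)" for J
      unfolding D_def pbond_def if_not_P[OF that]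
      by (simp add: sum.distrib sum_divide_distrib[symmetric] distrib_right distrib_left)
        (simp add: add_divide_distrib)
    show ?thesis
      using 1[OF False] 1[OF F] by (simp add: sum_nswap)
  qed
  have "bern {1..N} \<alpha> D = bern {1..N} \<alpha> (\<lambda>J. D (nswap e ` J))"
    by (rule bern_nswap[OF e, symmetric])
  also have "\<dots> = - bern {1..N} \<alpha> D"
    using bern_mult[of "{1..N}" \<alpha> "-1" D] by (simp add: anti)
  finally have "bern {1..N} \<alpha> D = 0" by simp
  then show ?thesis by (simp add: D_def[abs_def] bern_diff pair_ip_def)
qed

text \<open>Given \<open>J - {i}\<close>, the operator is the conditional expectation over the
  membership of \<open>i\<close>, put to 0 when a tag sits at \<open>i\<close>. The pairing thus
  becomes symmetric in \<open>V\<close> and \<open>g\<close>.\<close>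

lemma presv_self_adjoint:
  assumes i: "i \<in> {1..N}"
  shows "pair_ip N \<alpha> (presv \<alpha> i V) g = pair_ip N \<alpha> V (presv \<alpha> i g)"
proof -
  let ?R = "presv \<alpha> i"
  have *: "pair_ip N \<alpha> (?R V) g = bern ({1..N} - {i}) \<alpha> (\<lambda>J. \<Sum>x\<in>J. \<Sum>y\<in>J. ?R V x y J * ?R g x y J)" for V g
  proof -
    have "(1 - \<alpha>) * (\<Sum>x\<in>J. \<Sum>y\<in>J. ?R V x y J * g x y J)
        + \<alpha> * (\<Sum>x\<in>insert i J. \<Sum>y\<in>insert i J. ?R V x y (insert i J) * g x y (insert i J))
        = (\<Sum>x\<in>J. \<Sum>y\<in>J. ?R V x y J * ?R g x y J)" if "J \<subseteq> {1..N} - {i}" for J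
    proof -
      have J: "finite J" "i \<notin> J" using that by (auto intro: finite_subset)
      have z: "?R V i y K = 0" "?R V x i K = 0" for x y K by (auto simp: presv_def)
      have e: "?R V x y (insert i J) = ?R V x y J" for x y
      proof -
        have "insert i J - {i} = J - {i}" by auto
        then show ?thesis by (simp add: presv_def)
      qed
      have "(\<Sum>x\<in>insert i J. \<Sum>y\<in>insert i J. ?R V x y (insert i J) * g x y (insert i J))
          = (\<Sum>x\<in>J. \<Sum>y\<in>J. ?R V x y J * g x y (insert i J))"
        using J by (simp add: z e)
      then have "(1 - \<alpha>) * (\<Sum>x\<in>J. \<Sum>y\<in>J. ?R V x y J * g x y J)
        + \<alpha> * (\<Sum>x\<in>insert i J. \<Sum>y\<in>insert i J. ?R V x y (insert i J) * g x y (insert i J))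
        = (\<Sum>x\<in>J. \<Sum>y\<in>J. ?R V x y J * (\<alpha> * g x y (insert i J) + (1 - \<alpha>) * g x y J))"
        by (simp add: sum_distrib_left sum.distrib[symmetric] algebra_simps)
      also have "\<dots> = (\<Sum>x\<in>J. \<Sum>y\<in>J. ?R V x y J * ?R g x y J)"
        using J by (intro sum.cong refl) (auto simp: presv_def)
      finally show ?thesis .
    qed
    then show ?thesis
      unfolding pair_ip_def using i by (subst bern_remove[of _ i]) (auto intro!: bern_cong)
  qed
  show ?thesis
    using *[of V g] *[of g V] by (simp add: pair_ip_commute[of N \<alpha> V] mult.commute)
qed

lemma pskel_self_adjoint:
  assumes "N \<ge> 1"
  shows "pair_ip N \<alpha> (pskel N \<alpha> V) g = pair_ip N \<alpha> V (pskel N \<alpha> g)"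
proof -
  have eq: "pair_ip N \<alpha> (pskel N \<alpha> V) g = (1 / real N) * ((\<Sum>e\<in>{1..<N}. pair_ip N \<alpha> (pbond e V) g)
     + ((1/2) * pair_ip N \<alpha> (presv \<alpha> 1 V) g + (1/2) * pair_ip N \<alpha> (presv \<alpha> N V) g))" for V g
  proof -
    have "pskel N \<alpha> V = (\<lambda>x y J. (1 / real N) * ((\<Sum>e\<in>{1..<N}. pbond e V x y J) +
        ((1/2) * presv \<alpha> 1 V x y J + (1/2) * presv \<alpha> N V x y J)))"
      by (intro ext) (simp add: pskel_def)
    then show ?thesis by (simp only: pair_ip_mult pair_ip_add pair_ip_sum)
  qed
  have "pair_ip N \<alpha> (pskel N \<alpha> V) g = pair_ip N \<alpha> (pskel N \<alpha> g) V"
    unfolding eq using assms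
    by (simp add: pbond_self_adjoint presv_self_adjoint pair_ip_commute[of N \<alpha> V])
  then show ?thesis by (simp add: pair_ip_commute)
qed

lemma pskel_power_self_adjoint:
  assumes "N \<ge> 1"
  shows "pair_ip N \<alpha> ((pskel N \<alpha> ^^ n) V) g = pair_ip N \<alpha> V ((pskel N \<alpha> ^^ n) g)"
proof (induction n arbitrary: g)
  case (Suc n)
  have "pair_ip N \<alpha> ((pskel N \<alpha> ^^ Suc n) V) g = pair_ip N \<alpha> V ((pskel N \<alpha> ^^ n) (pskel N \<alpha> g))"
    by (simp add: pskel_self_adjoint[OF assms] Suc.IH)
  then show ?case by (simp add: funpow_swap1)
qed simp

lemma projection_norm:
  assumes "pair_ip N \<alpha> (P g) g = pair_ip N \<alpha> g (P g)" "pair_ip N \<alpha> (P g) (P g) = pair_ip N \<alpha> g (P g)"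
  shows "pair_ip N \<alpha> (P g) (P g) =
    pair_ip N \<alpha> g g - pair_ip N \<alpha> (\<lambda>x y J. P g x y J - g x y J) (\<lambda>x y J. P g x y J - g x y J)"
proof -
  let ?d = "\<lambda>x y J. P g x y J - g x y J"
  have "pair_ip N \<alpha> ?d ?d = pair_ip N \<alpha> (P g) ?d - pair_ip N \<alpha> g ?d" by (rule pair_ip_diff)
  also have "\<dots> = pair_ip N \<alpha> ?d (P g) - pair_ip N \<alpha> ?d g" by (simp add: pair_ip_commute)
  also have "\<dots> = pair_ip N \<alpha> (P g) (P g) - pair_ip N \<alpha> g (P g) - (pair_ip N \<alpha> (P g) g - pair_ip N \<alpha> g g)"
    by (simp add: pair_ip_diff)
  finally show ?thesis using assms by simp
qed

text \<open>All pieces are orthogonal projections, so each loses the squared norm of its complement.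
  Only the losses on bonds are kept, since the comparison along paths uses nothing else.\<close>

lemma pskel_norm_le:
  assumes N: "N \<ge> 1" and \<alpha>: "0 \<le> \<alpha>" "\<alpha> \<le> 1"
  shows "pair_ip N \<alpha> (pskel N \<alpha> g) (pskel N \<alpha> g) \<le> pair_ip N \<alpha> g g
     - (\<Sum>e\<in>{1..<N}. pair_ip N \<alpha> (\<lambda>x y J. pbond e g x y J - g x y J) (\<lambda>x y J. pbond e g x y J - g x y J)) / real N"
proof -
  let ?n = "\<lambda>g. pair_ip N \<alpha> g g"
  have B: "?n (pbond e g) = ?n g - ?n (\<lambda>x y J. pbond e g x y J - g x y J)" if "e \<in> {1..<N}" for e
    using that by (intro projection_norm) (simp_all add: pbond_self_adjoint pbond_idem)
  have R: "?n (presv \<alpha> i g) \<le> ?n g" if "i \<in> {1..N}" for i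
  proof -
    have "?n (presv \<alpha> i g) = ?n g - ?n (\<lambda>x y J. presv \<alpha> i g x y J - g x y J)"
      using that by (intro projection_norm) (simp_all add: presv_self_adjoint presv_idem)
    then show ?thesis using pair_ip_nonneg[OF \<alpha>, of N] by simp
  qed
  let ?q = "\<lambda>x y J. (1 / real N) * ((\<Sum>e\<in>{1..<N}. (pbond e g x y J)\<^sup>2) +
      ((1/2) * (presv \<alpha> 1 g x y J)\<^sup>2 + (1/2) * (presv \<alpha> N g x y J)\<^sup>2))"
  have sq: "pair_ip N \<alpha> (\<lambda>x y J. (h x y J)\<^sup>2) (\<lambda>_ _ _. 1) = ?n h" for h
    by (simp add: pair_ip_def power2_eq_square)
  have "?n (pskel N \<alpha> g) \<le> pair_ip N \<alpha> ?q (\<lambda>_ _ _. 1)"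
  proof (rule pair_ip_mono[OF \<alpha>])
    fix x y J
    show "pskel N \<alpha> g x y J * pskel N \<alpha> g x y J \<le> ?q x y J * 1"
      using skel_convexity[OF N, of "\<lambda>e. pbond e g x y J" "presv \<alpha> 1 g x y J" "presv \<alpha> N g x y J"]
      by (simp add: pskel_def power2_eq_square add.assoc)
  qed
  also have "\<dots> = (1 / real N) * ((\<Sum>e\<in>{1..<N}. ?n (pbond e g)) + ((1/2) * ?n (presv \<alpha> 1 g) + (1/2) * ?n (presv \<alpha> N g)))"
    by (simp only: pair_ip_mult pair_ip_add pair_ip_sum sq)
  also have "\<dots> \<le> (1 / real N) * ((\<Sum>e\<in>{1..<N}. ?n g - ?n (\<lambda>x y J. pbond e g x y J - g x y J)) + ((1/2) * ?n g + (1/2) * ?n g))"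
    using N by (intro mult_left_mono add_mono sum_mono R) (auto simp: B)
  also have "\<dots> = ?n g - (\<Sum>e\<in>{1..<N}. ?n (\<lambda>x y J. pbond e g x y J - g x y J)) / real N"
    using N by (simp add: sum_subtractf of_nat_diff field_simps)
  finally show ?thesis .
qed

section \<open>A Nash type inequality for the pair operator\<close>

lemma sum_of_bool_subset:
  fixes h :: "'a \<Rightarrow> real"
  assumes "finite I" "J \<subseteq> I"
  shows "(\<Sum>x\<in>I. of_bool (x \<in> J) * h x) = (\<Sum>x\<in>J. h x)"
  using assms by (intro sum.mono_neutral_cong_right) auto

lemma sum_le_sqrt:
  fixes s :: "'a \<Rightarrow> real"
  shows "(\<Sum>k\<in>K. s k) \<le> sqrt (real (card K)) * sqrt (\<Sum>k\<in>K. (s k)\<^sup>2)"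
proof -
  have "(\<Sum>k\<in>K. s k)\<^sup>2 \<le> real (card K) * (\<Sum>k\<in>K. (s k)\<^sup>2)"
    using Cauchy_Schwarz_ineq_sum[of "\<lambda>_. 1" s K] by simp
  then have "sqrt ((\<Sum>k\<in>K. s k)\<^sup>2) \<le> sqrt (real (card K) * (\<Sum>k\<in>K. (s k)\<^sup>2))"
    by (rule real_sqrt_le_mono)
  then show ?thesis by (simp add: real_sqrt_mult)
qed

lemma bern_variance:
  assumes "finite I"
  shows "bern I \<alpha> (\<lambda>J. (real (card I) * \<alpha> - (\<Sum>z\<in>I. of_bool (z \<in> J)))\<^sup>2) = real (card I) * \<alpha> * (1 - \<alpha>)"
  using assms
proof (induction I)
  case (insert i I)
  let ?D = "\<lambda>J. real (card I) * \<alpha> - (\<Sum>z\<in>I. of_bool (z \<in> J))"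
  have 0: "bern I \<alpha> (\<lambda>J. (real (card (insert i I)) * \<alpha> - (\<Sum>z\<in>insert i I. of_bool (z \<in> J)))\<^sup>2)
     = bern I \<alpha> (\<lambda>J. (?D J)\<^sup>2 + 2 * \<alpha> * ?D J + \<alpha>\<^sup>2)"
  proof (rule bern_cong)
    fix J assume "J \<subseteq> I"
    then have "(\<Sum>z\<in>insert i I. of_bool (z \<in> J)) = (\<Sum>z\<in>I. of_bool (z \<in> J) :: real)"
      using insert.hyps by (subst sum.insert) auto
    then have "real (card (insert i I)) * \<alpha> - (\<Sum>z\<in>insert i I. of_bool (z \<in> J)) = ?D J + \<alpha>"
      using insert.hyps by (simp only: card_insert_disjoint) (simp add: distrib_right del: sum_of_bool_eq)
    then show "(real (card (insert i I)) * \<alpha> - (\<Sum>z\<in>insert i I. of_bool (z \<in> J)))\<^sup>2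
      = (?D J)\<^sup>2 + 2 * \<alpha> * ?D J + \<alpha>\<^sup>2"
      by (simp only: power2_sum) (simp only: mult_ac add_ac)
  qed
  have 1: "bern I \<alpha> (\<lambda>J. (real (card (insert i I)) * \<alpha> - (\<Sum>z\<in>insert i I. of_bool (z \<in> insert i J)))\<^sup>2)
     = bern I \<alpha> (\<lambda>J. (?D J)\<^sup>2 + 2 * (\<alpha> - 1) * ?D J + (\<alpha> - 1)\<^sup>2)"
  proof (rule bern_cong)
    fix J
    have "(\<Sum>z\<in>I. of_bool (z \<in> insert i J)) = (\<Sum>z\<in>I. of_bool (z \<in> J) :: real)"
      using insert.hyps by (intro sum.cong) auto
    then have "(\<Sum>z\<in>insert i I. of_bool (z \<in> insert i J)) = 1 + (\<Sum>z\<in>I. of_bool (z \<in> J) :: real)"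
      using insert.hyps by (subst sum.insert) auto
    then have "real (card (insert i I)) * \<alpha> - (\<Sum>z\<in>insert i I. of_bool (z \<in> insert i J)) = ?D J + (\<alpha> - 1)"
      using insert.hyps by (simp only: card_insert_disjoint) (simp add: distrib_right del: sum_of_bool_eq)
    then show "(real (card (insert i I)) * \<alpha> - (\<Sum>z\<in>insert i I. of_bool (z \<in> insert i J)))\<^sup>2
      = (?D J)\<^sup>2 + 2 * (\<alpha> - 1) * ?D J + (\<alpha> - 1)\<^sup>2"
      by (simp only: power2_sum) (simp only: mult_ac add_ac)
  qed
  show ?case
    unfolding bern_insert[OF insert.hyps] 0 1
    using insert.hyps
    by (simp only: bern_add bern_mult bern_const insert.IH) (simp add: power2_eq_square algebra_simps del: sum_of_bool_eq)
qed simp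

text \<open>
  The diagonal is compared with the whole pair space along the paths that bring a particle of the
  environment from \<open>z\<close> to a neighbour of the doubly occupied site \<open>x\<close>, separate the tagged
  particles there, and move one of them back to \<open>z\<close>. Multiplying by the number of sites \<open>z\<close> of the
  environment and replacing it by its mean costs only a binomial standard deviation.
\<close>

lemma diagonal_bound:
  fixes g :: "nat \<Rightarrow> nat \<Rightarrow> nat set \<Rightarrow> real"
  assumes N: "N \<ge> 2" and \<alpha>: "0 < \<alpha>" "\<alpha> \<le> 1"
  shows "bern {1..N} \<alpha> (\<lambda>J. \<Sum>x\<in>J. g x x J) \<le> 4 * sqrt (pair_ip N \<alpha> g g)
    + 8 * real N * sqrt (\<Sum>e\<in>{1..<N}. pair_ip N \<alpha> (\<lambda>x y J. pbond e g x y J - g x y J) (\<lambda>x y J. pbond e g x y J - g x y J))"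
proof -
  define E where "E = bern {1..N} \<alpha>"
  have \<alpha>0: "0 \<le> \<alpha>" using \<alpha> by simp
  define d where "d w x y J = pbond w g x y J - g x y J" for w x y J
  \<comment> \<open>\<open>\<delta> w x\<close> dominates the increments on bond \<open>w\<close>
    for every position of the second tag in \<open>J\<close>. The squares, summed over
    \<open>w\<close> and \<open>x\<close>, give exactly the total dissipation on bonds.\<close>
  define \<delta> where "\<delta> w x = sqrt (E (\<lambda>J. of_bool (x \<in> J) * (\<Sum>y\<in>J. (d w x y J)\<^sup>2)))" for w x
  \<comment> \<open>\<open>G0\<close> has both tags at \<open>x\<close> and an untagged site of
    \<open>J\<close> at \<open>z\<close>; in \<open>G1\<close> the second tag sits at
    \<open>z\<close>. The path argument bounds their difference \<open>H\<close>.\<close>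
  define G0 where "G0 x z = E (\<lambda>J. of_bool (x \<in> J \<and> z \<in> J) * g x x J)" for x z
  define G1 where "G1 x z = E (\<lambda>J. of_bool (x \<in> J \<and> z \<in> J) * g x z J)" for x z
  define H where "H x z = G1 x z - G0 x z" for x z
  have fin: "finite J" if "J \<subseteq> {1..N}" for J using that by (rule finite_subset) simp
  note E_sum_in = sum_of_bool_subset[OF finite_atLeastAtMost, of _ 1 N]
  have E_pair: "E (\<lambda>J. of_bool (x \<in> J \<and> z \<in> J)) = \<alpha>\<^sup>2" if "x \<in> {1..N}" "z \<in> {1..N}" "x \<noteq> z" for x z
    using bern_superset[of "{1..N}" "{x, z}" \<alpha>] that by (simp add: E_def power2_eq_square)
  \<comment> \<open>The event has probability \<open>\<alpha>^2\<close>, which produces a factor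
    \<open>\<alpha>\<close>. Every term below carries this factor and it cancels at the end, so the
    final constants do not depend on \<open>\<alpha>\<close>.\<close>
  have CS: "\<bar>E (\<lambda>J. of_bool (x \<in> J \<and> z \<in> J) * h J)\<bar> \<le> \<alpha> * sqrt (E (\<lambda>J. of_bool (x \<in> J \<and> z \<in> J) * (h J)\<^sup>2))"
    if "x \<in> {1..N}" "z \<in> {1..N}" "x \<noteq> z" for x z h
  proof -
    let ?b = "\<lambda>J. of_bool (x \<in> J \<and> z \<in> J) :: real"
    have b: "?b J * (?b J * h J) = ?b J * h J" "(?b J)\<^sup>2 = ?b J" "(?b J * h J)\<^sup>2 = ?b J * (h J)\<^sup>2" for J
      by auto
    have "(E (\<lambda>J. ?b J * (?b J * h J)))\<^sup>2 \<le> E (\<lambda>J. (?b J)\<^sup>2) * E (\<lambda>J. (?b J * h J)\<^sup>2)"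
      unfolding E_def by (rule bern_Cauchy_Schwarz[OF \<alpha>0 \<alpha>(2)])
    then have "(E (\<lambda>J. ?b J * h J))\<^sup>2 \<le> \<alpha>\<^sup>2 * E (\<lambda>J. ?b J * (h J)\<^sup>2)"
      by (simp only: b E_pair[OF that])
    then have "sqrt ((E (\<lambda>J. ?b J * h J))\<^sup>2) \<le> sqrt (\<alpha>\<^sup>2 * E (\<lambda>J. ?b J * (h J)\<^sup>2))"
      by (rule real_sqrt_le_mono)
    then show ?thesis using \<alpha>0 by (simp add: real_sqrt_mult)
  qed
  have d_bound: "\<bar>E (\<lambda>J. of_bool (x \<in> J \<and> z \<in> J) * d w x y J)\<bar> \<le> \<alpha> * \<delta> w x"
    if "x \<in> {1..N}" "z \<in> {1..N}" "x \<noteq> z" "y = x \<or> y = z" for x z w y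
  proof -
    have "E (\<lambda>J. of_bool (x \<in> J \<and> z \<in> J) * (d w x y J)\<^sup>2) \<le> E (\<lambda>J. of_bool (x \<in> J) * (\<Sum>y\<in>J. (d w x y J)\<^sup>2))"
      unfolding E_def
    proof (rule bern_mono[OF \<alpha>0 \<alpha>(2)])
      fix J assume "J \<subseteq> {1..N}"
      then have "(d w x y J)\<^sup>2 \<le> (\<Sum>y\<in>J. (d w x y J)\<^sup>2)" if "y \<in> J"
        using that fin by (intro member_le_sum[where f = "\<lambda>y. (d w x y J)\<^sup>2"]) auto
      then show "of_bool (x \<in> J \<and> z \<in> J) * (d w x y J)\<^sup>2 \<le> of_bool (x \<in> J) * (\<Sum>y\<in>J. (d w x y J)\<^sup>2)"
        using that(4) by (auto intro: sum_nonneg)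
    qed
    then have "sqrt (E (\<lambda>J. of_bool (x \<in> J \<and> z \<in> J) * (d w x y J)\<^sup>2)) \<le> \<delta> w x"
      unfolding \<delta>_def by (rule real_sqrt_le_mono)
    then have "\<alpha> * sqrt (E (\<lambda>J. of_bool (x \<in> J \<and> z \<in> J) * (d w x y J)\<^sup>2)) \<le> \<alpha> * \<delta> w x"
      by (rule mult_left_mono[OF _ \<alpha>0])
    with CS[OF that(1-3), of "d w x y"] show ?thesis by (rule order_trans)
  qed
  \<comment> \<open>For a bond away from \<open>x\<close>, both cases of \<open>pbond\<close>
    average just two values, so the full exchange is twice the increment \<open>d\<close>.\<close>
  have swap_step: "E (\<lambda>J. of_bool (x \<in> J \<and> v \<in> J) * g x (nswap w y) J) - E (\<lambda>J. of_bool (x \<in> J \<and> u \<in> J) * g x y J)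
      = 2 * E (\<lambda>J. of_bool (x \<in> J \<and> u \<in> J) * d w x y J)"
    if w: "w \<in> {1..<N}" and u: "u \<in> {w, Suc w}" and v: "v = nswap w u" and x: "x \<notin> {w, Suc w}" for w u v x y
  proof -
    have t: "nswap w x = x" "nswap w u = v" "nswap w v = u" using x v by (auto simp: nswap_def)
    have both: "(w \<in> J \<and> Suc w \<in> J) \<longleftrightarrow> (u \<in> J \<and> v \<in> J)" for J
      using u v by (auto simp: nswap_def)
    have "E (\<lambda>J. of_bool (x \<in> J \<and> v \<in> J) * g x (nswap w y) J)
        = E (\<lambda>J. of_bool (x \<in> J \<and> u \<in> J) * g x (nswap w y) (nswap w ` J))"
      unfolding E_def by (subst bern_nswap[OF w, symmetric]) (simp only: mem_nswap_image t)
    then have "E (\<lambda>J. of_bool (x \<in> J \<and> v \<in> J) * g x (nswap w y) J) - E (\<lambda>J. of_bool (x \<in> J \<and> u \<in> J) * g x y J)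
        = E (\<lambda>J. of_bool (x \<in> J \<and> u \<in> J) * g x (nswap w y) (nswap w ` J) - of_bool (x \<in> J \<and> u \<in> J) * g x y J)"
      unfolding E_def by (simp only: bern_diff)
    also have "\<dots> = E (\<lambda>J. 2 * (of_bool (x \<in> J \<and> u \<in> J) * d w x y J))"
      unfolding E_def
    proof (rule bern_cong)
      fix J
      have "g x (nswap w y) (nswap w ` J) - g x y J = 2 * d w x y J" if "u \<in> J"
      proof (cases "v \<in> J")
        case True
        then have b: "w \<in> J \<and> Suc w \<in> J" using that both by simp
        then show ?thesis using nswap_image_both[of w J] by (simp add: d_def pbond_def t)
      next
        case False
        then have "\<not> (w \<in> J \<and> Suc w \<in> J)" using both by simp
        then have "pbond w g x y J = (g x y J + g x (nswap w y) (nswap w ` J)) / 2"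
          unfolding pbond_def by (simp only: if_False t)
        then show ?thesis by (simp add: d_def)
      qed
      then show "of_bool (x \<in> J \<and> u \<in> J) * g x (nswap w y) (nswap w ` J) - of_bool (x \<in> J \<and> u \<in> J) * g x y J
          = 2 * (of_bool (x \<in> J \<and> u \<in> J) * d w x y J)" by auto
    qed
    finally show ?thesis by (simp add: E_def bern_mult)
  qed
  have H_step: "\<bar>H x v\<bar> \<le> \<bar>H x u\<bar> + 4 * \<alpha> * \<delta> w x"
    if w: "w \<in> {1..<N}" and u: "u \<in> {w, Suc w}" and v: "v = nswap w u" and x: "x \<notin> {w, Suc w}" "x \<in> {1..N}" for w u v x
  proof -
    have xu: "u \<in> {1..N}" "x \<noteq> u" "nswap w x = x" using w u x by (auto simp: nswap_def)
    have "G0 x v - G0 x u = 2 * E (\<lambda>J. of_bool (x \<in> J \<and> u \<in> J) * d w x x J)"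
      using swap_step[OF w u v x(1), of x] unfolding G0_def xu(3) .
    moreover have "G1 x v - G1 x u = 2 * E (\<lambda>J. of_bool (x \<in> J \<and> u \<in> J) * d w x u J)"
      using swap_step[OF w u v x(1), of u] unfolding G1_def v[symmetric] .
    ultimately show ?thesis
      using xu d_bound[of x u x w] d_bound[of x u u w] x(2)
      unfolding H_def by linarith
  qed
  \<comment> \<open>Here the tags separate: if both ends lie in \<open>J\<close>, the averaged
    function agrees at \<open>(x, x)\<close> and \<open>(x, v)\<close>, so the difference of
    \<open>g\<close> consists of two increments. The bound is relaxed from 2 to 4 to match
    \<open>H_step\<close>.\<close>
  have H_split: "\<bar>H x v\<bar> \<le> 4 * \<alpha> * \<delta> w x"
    if w: "w \<in> {1..<N}" and x: "x \<in> {w, Suc w}" and v: "v = nswap w x" for w v x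
  proof -
    have v': "v \<in> {1..N}" "x \<in> {1..N}" "x \<noteq> v" and t: "nswap w x = v" "nswap w v = x"
      using w x v by (auto simp: nswap_def)
    have both: "(x \<in> J \<and> v \<in> J) \<longleftrightarrow> (w \<in> J \<and> Suc w \<in> J)" for J
      using x v by (auto simp: nswap_def)
    have "H x v = E (\<lambda>J. of_bool (x \<in> J \<and> v \<in> J) * g x v J - of_bool (x \<in> J \<and> v \<in> J) * g x x J)"
      unfolding H_def G0_def G1_def E_def by (simp only: bern_diff)
    also have "\<dots> = E (\<lambda>J. of_bool (x \<in> J \<and> v \<in> J) * d w x x J - of_bool (x \<in> J \<and> v \<in> J) * d w x v J)"
      unfolding E_def
    proof (rule bern_cong)
      fix J
      have "g x v J - g x x J = d w x x J - d w x v J" if "x \<in> J \<and> v \<in> J"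
      proof -
        have "w \<in> J \<and> Suc w \<in> J" using that both by simp
        then have "pbond w g x x J = pbond w g x v J" by (simp add: pbond_def t)
        then show ?thesis by (simp add: d_def)
      qed
      then show "of_bool (x \<in> J \<and> v \<in> J) * g x v J - of_bool (x \<in> J \<and> v \<in> J) * g x x J =
          of_bool (x \<in> J \<and> v \<in> J) * d w x x J - of_bool (x \<in> J \<and> v \<in> J) * d w x v J"
        by (cases "x \<in> J"; cases "v \<in> J") simp_all
    qed
    also have "\<dots> = E (\<lambda>J. of_bool (x \<in> J \<and> v \<in> J) * d w x x J) - E (\<lambda>J. of_bool (x \<in> J \<and> v \<in> J) * d w x v J)"
      unfolding E_def by (simp only: bern_diff)
    finally have "\<bar>H x v\<bar> \<le> 2 * (\<alpha> * \<delta> w x)"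
      using d_bound[OF v'(2,1,3), of x w] d_bound[OF v'(2,1,3), of v w] by linarith
    moreover have "0 \<le> \<alpha> * \<delta> w x" using d_bound[OF v'(2,1,3), of x w] by linarith
    ultimately show ?thesis by linarith
  qed
  have \<delta>0: "0 \<le> \<delta> w x" for w x
    unfolding \<delta>_def E_def by (intro real_sqrt_ge_zero bern_nonneg \<alpha>0 \<alpha>(2) mult_nonneg_nonneg sum_nonneg) auto
  have H_right: "\<bar>H x (Suc (x + k))\<bar> \<le> 4 * \<alpha> * (\<Sum>w\<in>{x..x + k}. \<delta> w x)" if "1 \<le> x" "Suc (x + k) \<le> N" for x k
    using that(2)
  proof (induction k)
    case 0
    have "\<bar>H x (Suc x)\<bar> \<le> 4 * \<alpha> * \<delta> x x"
      by (rule H_split) (use 0 that(1) in \<open>auto simp: nswap_def\<close>)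
    then show ?case by simp
  next
    case (Suc k)
    have "\<bar>H x (Suc (x + Suc k))\<bar> \<le> \<bar>H x (Suc (x + k))\<bar> + 4 * \<alpha> * \<delta> (Suc (x + k)) x"
      by (rule H_step) (use Suc.prems that(1) in \<open>auto simp: nswap_def\<close>)
    also have "\<bar>H x (Suc (x + k))\<bar> \<le> 4 * \<alpha> * (\<Sum>w\<in>{x..x + k}. \<delta> w x)"
      by (rule Suc.IH) (use Suc.prems in auto)
    finally show ?case by (simp add: distrib_left)
  qed
  have H_left: "\<bar>H x m\<bar> \<le> 4 * \<alpha> * (\<Sum>w\<in>{m..<x}. \<delta> w x)" if "x \<le> N" "1 \<le> m" "x = m + Suc k" for x k m
    using that(2,3)
  proof (induction k arbitrary: m)
    case 0
    then have "{m..<x} = {m}" by auto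
    moreover have "\<bar>H x m\<bar> \<le> 4 * \<alpha> * \<delta> m x"
      by (rule H_split) (use 0 that(1) in \<open>auto simp: nswap_def\<close>)
    ultimately show ?case by (simp only: sum.insert sum.empty) simp
  next
    case (Suc k)
    have "\<bar>H x m\<bar> \<le> \<bar>H x (Suc m)\<bar> + 4 * \<alpha> * \<delta> m x"
      by (rule H_step) (use Suc.prems that(1) in \<open>auto simp: nswap_def\<close>)
    also have "\<bar>H x (Suc m)\<bar> \<le> 4 * \<alpha> * (\<Sum>w\<in>{Suc m..<x}. \<delta> w x)"
      by (rule Suc.IH) (use Suc.prems in auto)
    also have "(\<Sum>w\<in>{Suc m..<x}. \<delta> w x) = (\<Sum>w\<in>{m..<x}. \<delta> w x) - \<delta> m x"
      using Suc.prems(2) by (subst (2) sum.atLeast_Suc_lessThan) simp_all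
    finally show ?case by (simp add: right_diff_distrib)
  qed
  \<comment> \<open>The path crosses each bond at most once, so the sum over all bonds dominates for
    every \<open>z\<close>.\<close>
  have H_bound: "\<bar>H x z\<bar> \<le> 4 * \<alpha> * (\<Sum>w\<in>{1..<N}. \<delta> w x)" if xz: "x \<in> {1..N}" "z \<in> {1..N} - {x}" for x z
  proof (cases "x < z")
    case True
    define k where "k = z - Suc x"
    have k: "z = Suc (x + k)" using True by (simp add: k_def)
    have "\<bar>H x z\<bar> \<le> 4 * \<alpha> * (\<Sum>w\<in>{x..x + k}. \<delta> w x)"
      unfolding k by (rule H_right) (use k xz in auto)
    also have "\<dots> \<le> 4 * \<alpha> * (\<Sum>w\<in>{1..<N}. \<delta> w x)"
      by (intro mult_left_mono sum_mono2 \<delta>0) (use \<alpha>0 k xz in auto)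
    finally show ?thesis .
  next
    case False
    define k where "k = x - Suc z"
    have k: "x = z + Suc k" using False xz by (auto simp: k_def)
    have "\<bar>H x z\<bar> \<le> 4 * \<alpha> * (\<Sum>w\<in>{z..<x}. \<delta> w x)"
      by (rule H_left[OF _ _ k]) (use xz in auto)
    also have "\<dots> \<le> 4 * \<alpha> * (\<Sum>w\<in>{1..<N}. \<delta> w x)"
      by (intro mult_left_mono sum_mono2 \<delta>0) (use \<alpha>0 xz in auto)
    finally show ?thesis .
  qed

  define A where "A x y = E (\<lambda>J. of_bool (x \<in> J \<and> y \<in> J) * (g x y J)\<^sup>2)" for x y
  have A0: "0 \<le> A x y" for x y
    unfolding A_def E_def by (intro bern_nonneg \<alpha>0 \<alpha>(2)) auto
  have A_sum: "(\<Sum>x\<in>{1..N}. \<Sum>y\<in>{1..N}. A x y) = pair_ip N \<alpha> g g"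
  proof -
    have "(\<Sum>x\<in>{1..N}. \<Sum>y\<in>{1..N}. A x y) = E (\<lambda>J. \<Sum>x\<in>{1..N}. \<Sum>y\<in>{1..N}. of_bool (x \<in> J \<and> y \<in> J) * (g x y J)\<^sup>2)"
      unfolding A_def E_def by (simp only: bern_sum)
    also have "\<dots> = pair_ip N \<alpha> g g"
      unfolding E_def pair_ip_def
    proof (rule bern_cong)
      fix J assume J: "J \<subseteq> {1..N}"
      have "(\<Sum>x\<in>{1..N}. \<Sum>y\<in>{1..N}. of_bool (x \<in> J \<and> y \<in> J) * (g x y J)\<^sup>2)
         = (\<Sum>x\<in>{1..N}. of_bool (x \<in> J) * (\<Sum>y\<in>{1..N}. of_bool (y \<in> J) * (g x y J)\<^sup>2))"
        by (simp only: of_bool_conj sum_distrib_left mult.assoc)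
      also have "\<dots> = (\<Sum>x\<in>J. \<Sum>y\<in>J. g x y J * g x y J)"
        by (simp only: E_sum_in[OF J] power2_eq_square)
      finally show "(\<Sum>x\<in>{1..N}. \<Sum>y\<in>{1..N}. of_bool (x \<in> J \<and> y \<in> J) * (g x y J)\<^sup>2) = \<dots>" .
    qed
    finally show ?thesis .
  qed
  let ?norm = "sqrt (pair_ip N \<alpha> g g)"
  let ?D = "sqrt (\<Sum>e\<in>{1..<N}. pair_ip N \<alpha> (d e) (d e))"
  \<comment> \<open>Cauchy-Schwarz against the centred number of other sites in \<open>J\<close>,
    which is independent of the event that \<open>x\<close> lies in \<open>J\<close> and has
    variance at most \<open>N * \<alpha>\<close>.\<close>
  have mean: "E (\<lambda>J. of_bool (x \<in> J) * g x x J) * (real (N - 1) * \<alpha>)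
      \<le> sqrt (real N) * \<alpha> * sqrt (A x x) + (\<Sum>z\<in>{1..N} - {x}. G0 x z)" if x: "x \<in> {1..N}" for x
  proof -
    let ?S = "\<lambda>J. real (N - 1) * \<alpha> - (\<Sum>z\<in>{1..N} - {x}. of_bool (z \<in> J))"
    have c: "card ({1..N} - {x}) = N - 1" using x by simp
    have var: "E (\<lambda>J. (of_bool (x \<in> J) * ?S J)\<^sup>2) = \<alpha> * (real (N - 1) * \<alpha> * (1 - \<alpha>))"
    proof -
      have "E (\<lambda>J. (of_bool (x \<in> J) * ?S J)\<^sup>2) = bern ({1..N} - {x}) \<alpha> (\<lambda>J. \<alpha> * (?S J)\<^sup>2)"
        unfolding E_def
      proof (subst bern_remove[OF _ x], simp, rule bern_cong)
        fix J assume "J \<subseteq> {1..N} - {x}"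
        moreover have "(\<Sum>z\<in>{1..N} - {x}. of_bool (z \<in> insert x J)) = (\<Sum>z\<in>{1..N} - {x}. of_bool (z \<in> J))"
          by (intro sum.cong) auto
        ultimately show "(1 - \<alpha>) * (of_bool (x \<in> J) * ?S J)\<^sup>2 + \<alpha> * (of_bool (x \<in> insert x J) * ?S (insert x J))\<^sup>2 = \<alpha> * (?S J)\<^sup>2"
          by auto
      qed
      also have "\<dots> = \<alpha> * (real (N - 1) * \<alpha> * (1 - \<alpha>))"
        using bern_variance[of "{1..N} - {x}" \<alpha>] unfolding bern_mult c by simp
      finally show ?thesis .
    qed
    have "(E (\<lambda>J. (of_bool (x \<in> J) * g x x J) * (of_bool (x \<in> J) * ?S J)))\<^sup>2
        \<le> E (\<lambda>J. (of_bool (x \<in> J) * g x x J)\<^sup>2) * E (\<lambda>J. (of_bool (x \<in> J) * ?S J)\<^sup>2)"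
      unfolding E_def by (rule bern_Cauchy_Schwarz[OF \<alpha>0 \<alpha>(2)])
    also have "\<dots> = A x x * (\<alpha> * (real (N - 1) * \<alpha> * (1 - \<alpha>)))"
    proof -
      have "(of_bool (x \<in> J) * g x x J)\<^sup>2 = of_bool (x \<in> J \<and> x \<in> J) * (g x x J)\<^sup>2" for J by simp
      then show ?thesis unfolding var A_def by (simp only:)
    qed
    also have "\<dots> \<le> A x x * (\<alpha> * (real N * \<alpha> * 1))"
      using \<alpha> A0 by (intro mult_left_mono mult_mono) auto
    also have "\<dots> = (sqrt (real N) * \<alpha> * sqrt (A x x))\<^sup>2"
      using A0 by (simp add: power_mult_distrib power2_eq_square[of \<alpha>])
    finally have 1: "E (\<lambda>J. (of_bool (x \<in> J) * g x x J) * (of_bool (x \<in> J) * ?S J)) \<le> sqrt (real N) * \<alpha> * sqrt (A x x)"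
      by (rule power2_le_imp_le) (use \<alpha> A0 in auto)
    have "E (\<lambda>J. (of_bool (x \<in> J) * g x x J) * (of_bool (x \<in> J) * ?S J))
        = E (\<lambda>J. (real (N - 1) * \<alpha>) * (of_bool (x \<in> J) * g x x J) - (\<Sum>z\<in>{1..N} - {x}. of_bool (x \<in> J \<and> z \<in> J) * g x x J))"
      unfolding E_def
    proof (rule bern_cong)
      fix J
      have s: "(\<Sum>z\<in>{1..N} - {x}. of_bool (x \<in> J \<and> z \<in> J) * g x x J)
          = of_bool (x \<in> J) * g x x J * (\<Sum>z\<in>{1..N} - {x}. of_bool (z \<in> J))"
        unfolding sum_distrib_left by (rule sum.cong) auto
      have "b = 0 \<or> b = 1 \<Longrightarrow> b * h * (b * (c - S)) = c * (b * h) - b * h * S" for b h c S :: real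
        by (auto simp: algebra_simps)
      note bool_eq = this
      show "(of_bool (x \<in> J) * g x x J) * (of_bool (x \<in> J) * ?S J)
        = (real (N - 1) * \<alpha>) * (of_bool (x \<in> J) * g x x J) - (\<Sum>z\<in>{1..N} - {x}. of_bool (x \<in> J \<and> z \<in> J) * g x x J)"
        unfolding s by (rule bool_eq) (cases "x \<in> J"; simp only: of_bool_eq simp_thms)
    qed
    also have "\<dots> = (real (N - 1) * \<alpha>) * E (\<lambda>J. of_bool (x \<in> J) * g x x J) - (\<Sum>z\<in>{1..N} - {x}. G0 x z)"
      unfolding E_def G0_def by (simp only: bern_diff bern_mult bern_sum)
    finally show ?thesis using 1 by (simp add: mult.commute)
  qed
  have lhs: "E (\<lambda>J. \<Sum>x\<in>J. g x x J) = (\<Sum>x\<in>{1..N}. E (\<lambda>J. of_bool (x \<in> J) * g x x J))"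
    unfolding E_def bern_sum[symmetric] by (rule bern_cong) (simp only: E_sum_in)
  have "E (\<lambda>J. \<Sum>x\<in>J. g x x J) * (real (N - 1) * \<alpha>)
      \<le> (\<Sum>x\<in>{1..N}. sqrt (real N) * \<alpha> * sqrt (A x x) + (\<Sum>z\<in>{1..N} - {x}. G0 x z))"
    unfolding lhs sum_distrib_right by (intro sum_mono mean)
  also have "\<dots> \<le> (\<Sum>x\<in>{1..N}. sqrt (real N) * \<alpha> * sqrt (A x x)
      + (\<Sum>z\<in>{1..N} - {x}. \<alpha> * sqrt (A x z) + 4 * \<alpha> * (\<Sum>w\<in>{1..<N}. \<delta> w x)))"
  proof (intro sum_mono add_left_mono)
    fix x z assume xz: "x \<in> {1..N}" "z \<in> {1..N} - {x}"
    have "\<bar>G1 x z\<bar> \<le> \<alpha> * sqrt (A x z)"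
      unfolding G1_def A_def using xz by (intro CS) auto
    then show "G0 x z \<le> \<alpha> * sqrt (A x z) + 4 * \<alpha> * (\<Sum>w\<in>{1..<N}. \<delta> w x)"
      using H_bound[OF xz] unfolding H_def by linarith
  qed
  also have "\<dots> \<le> (\<Sum>x\<in>{1..N}. sqrt (real N) * \<alpha> * sqrt (A x x)
      + (\<Sum>z\<in>{1..N}. \<alpha> * sqrt (A x z) + 4 * \<alpha> * (\<Sum>w\<in>{1..<N}. \<delta> w x)))"
    using \<alpha>0 A0 \<delta>0 by (intro sum_mono add_left_mono sum_mono2 add_nonneg_nonneg mult_nonneg_nonneg sum_nonneg) auto
  also have "\<dots> = sqrt (real N) * \<alpha> * (\<Sum>x\<in>{1..N}. sqrt (A x x))
      + \<alpha> * (\<Sum>(x, z)\<in>{1..N} \<times> {1..N}. sqrt (A x z))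
      + 4 * \<alpha> * real N * (\<Sum>(x, w)\<in>{1..N} \<times> {1..<N}. \<delta> w x)"
    by (simp add: sum.distrib sum_distrib_left sum.cartesian_product[symmetric] mult_ac)
  also have "\<dots> \<le> sqrt (real N) * \<alpha> * (sqrt (real N) * ?norm) + \<alpha> * (real N * ?norm) + 4 * \<alpha> * real N * (real N * ?D)"
  proof (intro add_mono mult_left_mono)
    have "(\<Sum>x\<in>{1..N}. sqrt (A x x)) \<le> sqrt (real (card {1..N})) * sqrt (\<Sum>x\<in>{1..N}. (sqrt (A x x))\<^sup>2)"
      by (rule sum_le_sqrt)
    also have "(\<Sum>x\<in>{1..N}. (sqrt (A x x))\<^sup>2) = (\<Sum>x\<in>{1..N}. A x x)" using A0 by simp
    also have "sqrt (real (card {1..N})) * sqrt (\<Sum>x\<in>{1..N}. A x x)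
        \<le> sqrt (real (card {1..N})) * sqrt (\<Sum>x\<in>{1..N}. \<Sum>y\<in>{1..N}. A x y)"
      using A0 by (intro mult_left_mono real_sqrt_le_mono sum_mono member_le_sum) auto
    finally show "(\<Sum>x\<in>{1..N}. sqrt (A x x)) \<le> sqrt (real N) * ?norm"
      unfolding A_sum by simp
    have "(\<Sum>(x, z)\<in>{1..N} \<times> {1..N}. sqrt (A x z)) \<le> sqrt (real (card ({1..N} \<times> {1..N})))
        * sqrt (\<Sum>k\<in>{1..N} \<times> {1..N}. (case k of (x, z) \<Rightarrow> sqrt (A x z))\<^sup>2)"
      by (rule sum_le_sqrt)
    also have "(\<Sum>k\<in>{1..N} \<times> {1..N}. (case k of (x, z) \<Rightarrow> sqrt (A x z))\<^sup>2) = pair_ip N \<alpha> g g"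
      using A0 by (simp add: A_sum[symmetric] sum.cartesian_product split_beta)
    finally show "(\<Sum>(x, z)\<in>{1..N} \<times> {1..N}. sqrt (A x z)) \<le> real N * ?norm"
      by (simp add: real_sqrt_mult)
    have sq: "(\<delta> w x)\<^sup>2 = E (\<lambda>J. of_bool (x \<in> J) * (\<Sum>y\<in>J. (d w x y J)\<^sup>2))" for w x
      unfolding \<delta>_def E_def
      by (intro real_sqrt_pow2 bern_nonneg \<alpha>0 \<alpha>(2) mult_nonneg_nonneg sum_nonneg) auto
    have "(\<Sum>(x, w)\<in>{1..N} \<times> {1..<N}. \<delta> w x) \<le> sqrt (real (card ({1..N} \<times> {1..<N})))
        * sqrt (\<Sum>k\<in>{1..N} \<times> {1..<N}. (case k of (x, w) \<Rightarrow> \<delta> w x)\<^sup>2)"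
      by (rule sum_le_sqrt)
    also have "(\<Sum>k\<in>{1..N} \<times> {1..<N}. (case k of (x, w) \<Rightarrow> \<delta> w x)\<^sup>2) = (\<Sum>x\<in>{1..N}. \<Sum>w\<in>{1..<N}. (\<delta> w x)\<^sup>2)"
      by (simp add: sum.cartesian_product split_beta)
    also have "\<dots> = (\<Sum>w\<in>{1..<N}. pair_ip N \<alpha> (d w) (d w))"
    proof (subst sum.swap, rule sum.cong[OF refl])
      fix w
      have "(\<Sum>x\<in>{1..N}. (\<delta> w x)\<^sup>2) = E (\<lambda>J. \<Sum>x\<in>{1..N}. of_bool (x \<in> J) * (\<Sum>y\<in>J. (d w x y J)\<^sup>2))"
        unfolding sq E_def by (simp only: bern_sum)
      also have "\<dots> = pair_ip N \<alpha> (d w) (d w)"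
        unfolding pair_ip_def E_def by (rule bern_cong) (simp only: E_sum_in power2_eq_square)
      finally show "(\<Sum>x\<in>{1..N}. (\<delta> w x)\<^sup>2) = pair_ip N \<alpha> (d w) (d w)" .
    qed
    finally have "(\<Sum>(x, w)\<in>{1..N} \<times> {1..<N}. \<delta> w x) \<le> sqrt (real (N * (N - 1))) * ?D" by simp
    also have "\<dots> \<le> sqrt (real (N * N)) * ?D"
      using pair_ip_nonneg[OF \<alpha>0 \<alpha>(2)] by (intro mult_right_mono real_sqrt_le_mono real_sqrt_ge_zero sum_nonneg) (auto intro!: mult_left_mono)
    finally show "(\<Sum>(x, w)\<in>{1..N} \<times> {1..<N}. \<delta> w x) \<le> real N * ?D" by (simp add: real_sqrt_mult)
  qed (use \<alpha>0 in auto)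
  also have "\<dots> = \<alpha> * (real N * (2 * ?norm + 4 * real N * ?D))"
    by (simp add: algebra_simps)
  finally have "\<alpha> * (E (\<lambda>J. \<Sum>x\<in>J. g x x J) * real (N - 1)) \<le> \<alpha> * (real N * (2 * ?norm + 4 * real N * ?D))"
    by (simp add: mult_ac)
  then have "E (\<lambda>J. \<Sum>x\<in>J. g x x J) * real (N - 1) \<le> real N * (2 * ?norm + 4 * real N * ?D)"
    using \<alpha> by simp
  \<comment> \<open>\<open>N \<le> 2 * (N - 1)\<close> doubles the constants to 4 and 8.\<close>
  also have "\<dots> \<le> (2 * real (N - 1)) * (2 * ?norm + 4 * real N * ?D)"
    using N pair_ip_nonneg[OF \<alpha>0 \<alpha>(2)]
    by (intro mult_right_mono add_nonneg_nonneg mult_nonneg_nonneg real_sqrt_ge_zero sum_nonneg) auto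
  also have "\<dots> = (4 * ?norm + 8 * real N * ?D) * real (N - 1)"
    by (simp add: algebra_simps)
  finally have "E (\<lambda>J. \<Sum>x\<in>J. g x x J) \<le> 4 * ?norm + 8 * real N * ?D"
    by (rule mult_right_le_imp_le) (use N in simp)
  then show ?thesis by (simp add: E_def d_def[abs_def])
qed

text \<open>A discrete Riccati inequality. As long as \<open>e m > 64\<close>, the term
  \<open>4 * sqrt (e m)\<close> is at most half of \<open>e m\<close>, so the remaining term forces
  \<open>1 / e\<close> to grow by at least \<open>1 / (256 * M)\<close> per step. After
  \<open>4 * M\<close> steps this gives \<open>1 / e \<ge> 1 / 64\<close>; hence the same 64
  twice.\<close>

lemma riccati_decay:
  fixes e :: "nat \<Rightarrow> real" and M :: real
  assumes dec: "\<And>m. e (Suc m) \<le> e m" and nn: "\<And>m. 0 \<le> e m" and M: "0 < M"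
    and step: "\<And>m. e m \<le> 4 * sqrt (e m) + 8 * sqrt (M * (e m - e (Suc m)))"
    and n: "4 * M \<le> real n"
  shows "e n \<le> 64"
proof (rule ccontr)
  assume c: "\<not> e n \<le> 64"
  have anti: "e m \<ge> e n" if "m \<le> n" for m
    using that by (rule lift_Suc_antimono_le[of e, rotated]) (rule dec)
  have big: "e m > 64" if "m \<le> n" for m using anti[OF that] c by simp
  have "real m / (256 * M) \<le> 1 / e m" if "m \<le> n" for m
    using that
  proof (induction m)
    case 0
    then show ?case using nn by simp
  next
    case (Suc m)
    let ?s = "sqrt (e m)"
    have e: "e m > 64" "e (Suc m) > 64" using big Suc.prems by auto
    have "sqrt (8\<^sup>2) \<le> ?s" using e by (intro real_sqrt_le_mono) auto
    then have s: "8 \<le> ?s" by simp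
    have ss: "?s * ?s = e m" using nn by simp
    have "8 * ?s \<le> e m" using mult_right_mono[OF s, of ?s] ss nn by simp
    then have "e m / 16 \<le> sqrt (M * (e m - e (Suc m)))" using step[of m] by linarith
    then have "(e m / 16)\<^sup>2 \<le> (sqrt (M * (e m - e (Suc m))))\<^sup>2" using nn by (intro power_mono) auto
    also have "\<dots> = M * (e m - e (Suc m))" using M dec by simp
    finally have "e m * e m \<le> 256 * M * (e m - e (Suc m))" by (simp add: power2_eq_square)
    moreover have "e m * e (Suc m) \<le> e m * e m" using dec nn by (intro mult_left_mono) auto
    ultimately have "e m * e (Suc m) \<le> 256 * M * (e m - e (Suc m))" by linarith
    then have "1 / (256 * M) \<le> 1 / e (Suc m) - 1 / e m"
      using e M by (simp add: field_simps)
    then show ?case using Suc by (simp add: add_divide_distrib)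
  qed
  from this[of n] have "real n / (256 * M) \<le> 1 / e n" by simp
  moreover have "1 / 64 \<le> real n / (256 * M)" using n M by (simp add: field_simps)
  ultimately have "1 / 64 \<le> 1 / e n" by linarith
  then show False using c by (simp add: field_simps)
qed

text \<open>By reversibility the squared norm after \<open>n\<close> steps is the diagonal after
  \<open>2 * n\<close> steps, so the Nash type inequality becomes a recursion for one sequence. With
  \<open>M = N^3\<close> it needs \<open>4 * N^3\<close> steps of \<open>e\<close>; \<open>e\<close>
  runs at every second step and the diagonal at twice that speed, which makes
  \<open>16 * N^3\<close> steps, that is, time 8 for the clock of rate
  \<open>2 * N^3\<close>.\<close>

lemma collision_bound:
  assumes N: "N \<ge> 2" and \<alpha>: "0 < \<alpha>" "\<alpha> \<le> 1"
  shows "bern {1..N} \<alpha> (\<lambda>J. \<Sum>x\<in>J. (pskel N \<alpha> ^^ (16 * N ^ 3)) pdiag x x J) \<le> 64"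
proof -
  define g where "g n = (pskel N \<alpha> ^^ n) pdiag" for n
  define c where "c n = pair_ip N \<alpha> (g n) (g n)" for n
  define dd where "dd n = (\<Sum>e\<in>{1..<N}. pair_ip N \<alpha> (\<lambda>x y J. pbond e (g n) x y J - g n x y J) (\<lambda>x y J. pbond e (g n) x y J - g n x y J))" for n
  have \<alpha>0: "0 \<le> \<alpha>" and N1: "N \<ge> 1" using \<alpha> N by auto
  have diag: "bern {1..N} \<alpha> (\<lambda>J. \<Sum>x\<in>J. V x x J) = pair_ip N \<alpha> pdiag V" for V
    unfolding pair_ip_def
  proof (rule bern_cong)
    fix J assume "J \<subseteq> {1..N}"
    then have fin: "finite J" by (rule finite_subset) simp
    have "(\<Sum>y\<in>J. pdiag x y J * V x y J) = V x x J" if "x \<in> J" for x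
    proof -
      have "(\<Sum>y\<in>J. pdiag x y J * V x y J) = (\<Sum>y\<in>J. if x = y then V x y J else 0)"
        by (intro sum.cong) (auto simp: pdiag_def)
      then show ?thesis using fin that by (simp add: sum.delta)
    qed
    then show "(\<Sum>x\<in>J. V x x J) = (\<Sum>x\<in>J. \<Sum>y\<in>J. pdiag x y J * V x y J)" by simp
  qed
  have c_diag: "c n = pair_ip N \<alpha> pdiag (g (2 * n))" for n
    unfolding c_def g_def pskel_power_self_adjoint[OF N1]
    by (simp add: mult_2 funpow_add)
  have dd0: "0 \<le> dd n" for n
    unfolding dd_def by (intro sum_nonneg pair_ip_nonneg \<alpha>0 \<alpha>(2))
  have c_step: "c (Suc n) \<le> c n - dd n / real N" for n
    using pskel_norm_le[OF N1 \<alpha>0 \<alpha>(2), of "g n"] by (simp add: c_def g_def dd_def)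
  have c_dec: "c (Suc n) \<le> c n" for n
    using c_step[of n] divide_nonneg_nonneg[OF dd0[of n] of_nat_0_le_iff[of N]] by linarith
  have c_anti: "c n \<le> c m" if "m \<le> n" for m n
    using that by (rule lift_Suc_antimono_le[of c, rotated]) (rule c_dec)
  have c0: "0 \<le> c n" for n unfolding c_def by (rule pair_ip_nonneg[OF \<alpha>0 \<alpha>(2)])
  define e where "e m = c (2 * m)" for m
  have "e (4 * N ^ 3) \<le> 64"
  proof (rule riccati_decay[where M = "real N ^ 3"])
    show "e (Suc m) \<le> e m" "0 \<le> e m" for m unfolding e_def by (auto intro: c_anti c0)
    show "0 < real N ^ 3" using N by simp
    show "4 * real N ^ 3 \<le> real (4 * N ^ 3)" by simp
    fix m
    \<comment> \<open>\<open>c m\<close> is the diagonal at step \<open>2 * m\<close>. Monotonicity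
      replaces it by \<open>c (2 * m)\<close>, so that the same quantity stands on both
      sides.\<close>
    have "e m \<le> c m" unfolding e_def by (rule c_anti) simp
    also have "\<dots> \<le> 4 * sqrt (c (2 * m)) + 8 * real N * sqrt (dd (2 * m))"
      using diagonal_bound[OF N \<alpha>, of "g (2 * m)"] unfolding diag c_diag[of m] c_def[of "2 * m"] dd_def .
    finally have "e m \<le> 4 * sqrt (c (2 * m)) + 8 * (real N * sqrt (dd (2 * m)))" by simp
    moreover have "real N * sqrt (dd (2 * m)) \<le> sqrt (real N ^ 3 * (e m - e (Suc m)))"
    proof -
      have "dd (2 * m) \<le> real N * (c (2 * m) - c (Suc (2 * m)))"
        using c_step[of "2 * m"] N by (simp add: field_simps)
      also have "\<dots> \<le> real N * (e m - e (Suc m))"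
        unfolding e_def by (intro mult_left_mono diff_mono c_anti) auto
      finally have "(real N)\<^sup>2 * dd (2 * m) \<le> (real N)\<^sup>2 * (real N * (e m - e (Suc m)))"
        by (rule mult_left_mono) simp
      then have "sqrt ((real N)\<^sup>2 * dd (2 * m)) \<le> sqrt (real N ^ 3 * (e m - e (Suc m)))"
        by (intro real_sqrt_le_mono) (simp add: power3_eq_cube power2_eq_square mult.assoc)
      then show ?thesis by (simp add: real_sqrt_mult)
    qed
    ultimately have "e m \<le> 4 * sqrt (c (2 * m)) + 8 * sqrt (real N ^ 3 * (e m - e (Suc m)))"
      by linarith
    then show "e m \<le> 4 * sqrt (e m) + 8 * sqrt (real N ^ 3 * (e m - e (Suc m)))"
      by (simp only: e_def)
  qed
  then show ?thesis
    unfolding diag using c_diag[of "8 * N ^ 3"] by (simp add: e_def g_def)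
qed

subsection \<open>One tagged particle\<close>

abbreviation unit_at :: "nat \<Rightarrow> nat \<Rightarrow> real" where
  "unit_at x \<equiv> (\<lambda>y. of_bool (y = x))"

text \<open>One case suffices for a single tag: if both ends lie in \<open>J\<close>, the image of
  \<open>J\<close> is \<open>J\<close> itself, and the tag still picks either end with probability
  1/2.\<close>

definition mbond :: "nat \<Rightarrow> (nat \<Rightarrow> nat set \<Rightarrow> real) \<Rightarrow> nat \<Rightarrow> nat set \<Rightarrow> real" where
  "mbond e v x J = (v x J + v (nswap e x) (nswap e ` J)) / 2"

definition mresv :: "real \<Rightarrow> nat \<Rightarrow> (nat \<Rightarrow> nat set \<Rightarrow> real) \<Rightarrow> nat \<Rightarrow> nat set \<Rightarrow> real" where
  "mresv \<alpha> i v x J = (if x = i then 0 else \<alpha> * v x (insert i J) + (1 - \<alpha>) * v x (J - {i}))"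

definition mskel :: "nat \<Rightarrow> real \<Rightarrow> (nat \<Rightarrow> nat set \<Rightarrow> real) \<Rightarrow> nat \<Rightarrow> nat set \<Rightarrow> real" where
  "mskel N \<alpha> v x J = ((\<Sum>e\<in>{1..<N}. mbond e v x J) + mresv \<alpha> 1 v x J / 2 + mresv \<alpha> N v x J / 2) / real N"

lemma walsh_bond_le:
  assumes v: "\<And>x J \<eta>. J \<subseteq> {1..N} \<Longrightarrow> x \<in> J \<Longrightarrow> \<bar>walsh f 0 (unit_at x) J \<eta>\<bar> \<le> v x J"
    and e: "e \<in> {1..<N}" and J: "J \<subseteq> {1..N}" and x: "x \<in> J"
  shows "\<bar>walsh (bond e f) 0 (unit_at x) J \<eta>\<bar> \<le> mbond e v x J"
proof -
  have "unit_at x \<circ> nswap e = unit_at (nswap e x)"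
    by (auto simp: fun_eq_iff)
  then have eq: "walsh (bond e f) 0 (unit_at x) J \<eta> = (walsh f 0 (unit_at x) J \<eta>
      + walsh f 0 (unit_at (nswap e x)) (nswap e ` J) (\<eta> \<circ> nswap e)) / 2"
    by (simp only: walsh_bond)
  have 2: "\<bar>walsh f 0 (unit_at (nswap e x)) (nswap e ` J) (\<eta> \<circ> nswap e)\<bar> \<le> v (nswap e x) (nswap e ` J)"
    by (rule v) (use nswap_image_subset[OF e J] x in auto)
  have half: "\<bar>(a + b) / 2\<bar> \<le> (u + w) / 2" if "\<bar>a\<bar> \<le> u" "\<bar>b\<bar> \<le> w" for a b u w :: real
    using that by (simp add: abs_le_iff)
  show ?thesis
    unfolding mbond_def eq by (rule half[OF v[OF J x] 2])
qed

lemma walsh_resv_le: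
  assumes v: "\<And>x J \<eta>. J \<subseteq> {1..N} \<Longrightarrow> x \<in> J \<Longrightarrow> \<bar>walsh f 0 (unit_at x) J \<eta>\<bar> \<le> v x J"
    and i: "i \<in> {1..N}" and J: "J \<subseteq> {1..N}" and x: "x \<in> J"
    and \<alpha>: "0 \<le> \<alpha>" "\<alpha> / 2 \<le> r" "\<alpha> / 2 \<le> 1 - r"
  shows "\<bar>walsh (resv i r f) 0 (unit_at x) J \<eta>\<bar> \<le> mresv \<alpha> i v x J"
proof -
  have fin: "finite J" using J by (rule finite_subset) simp
  show ?thesis
  proof (cases "x = i")
    case True
    then have "(unit_at x)(i := 0) = (\<lambda>_. 0)" by auto
    moreover have "walsh f 0 (\<lambda>_. 0) K \<zeta> = 0" for K \<zeta>
      by (simp add: walsh_def)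
    ultimately show ?thesis
      using True by (subst walsh_resv[OF fin, where \<alpha> = \<alpha>]) (simp add: mresv_def)
  next
    case False
    then have u: "(unit_at x)(i := 0) = unit_at x" by auto
    let ?u = "walsh f 0 (unit_at x) (insert i J) \<eta>"
    let ?v = "\<lambda>b. walsh f 0 (unit_at x) (J - {i}) (\<eta>(i := b))"
    have "\<bar>\<alpha> * ?u + (r - \<alpha> / 2) * ?v 1 + (1 - r - \<alpha> / 2) * ?v 0\<bar>
        \<le> \<bar>\<alpha> * ?u\<bar> + \<bar>(r - \<alpha> / 2) * ?v 1\<bar> + \<bar>(1 - r - \<alpha> / 2) * ?v 0\<bar>" by linarith
    also have "\<dots> = \<alpha> * \<bar>?u\<bar> + (r - \<alpha> / 2) * \<bar>?v 1\<bar> + (1 - r - \<alpha> / 2) * \<bar>?v 0\<bar>"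
      using \<alpha> by (simp add: abs_mult)
    also have "\<dots> \<le> \<alpha> * v x (insert i J) + (r - \<alpha> / 2) * v x (J - {i}) + (1 - r - \<alpha> / 2) * v x (J - {i})"
      using \<alpha> J i x False by (intro add_mono mult_left_mono v) auto
    also have "\<dots> = mresv \<alpha> i v x J" using False by (simp add: mresv_def algebra_simps)
    finally show ?thesis by (subst walsh_resv[OF fin, where \<alpha> = \<alpha>]) (simp only: u)
  qed
qed

lemma walsh_skel_le:
  assumes v: "\<And>x J \<eta>. J \<subseteq> {1..N} \<Longrightarrow> x \<in> J \<Longrightarrow> \<bar>walsh f 0 (unit_at x) J \<eta>\<bar> \<le> v x J"
    and N: "N \<ge> 1" and J: "J \<subseteq> {1..N}" and x: "x \<in> J"
    and \<alpha>: "0 \<le> \<alpha>" "\<alpha> / 2 \<le> p" "\<alpha> / 2 \<le> 1 - p" "\<alpha> / 2 \<le> q" "\<alpha> / 2 \<le> 1 - q"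
  shows "\<bar>walsh (skel N p q f) 0 (unit_at x) J \<eta>\<bar> \<le> mskel N \<alpha> v x J"
proof -
  let ?W = "\<lambda>f. walsh f 0 (unit_at x) J \<eta>"
  have "\<bar>?W (skel N p q f)\<bar> \<le> ((\<Sum>e\<in>{1..<N}. \<bar>?W (bond e f)\<bar>) + \<bar>?W (resv 1 p f)\<bar> / 2 + \<bar>?W (resv N q f)\<bar> / 2) / real N"
    unfolding walsh_skel abs_divide abs_of_nat
    by (intro divide_right_mono order_trans[OF abs_triangle_ineq] add_mono sum_abs) auto
  also have "\<dots> \<le> mskel N \<alpha> v x J"
    unfolding mskel_def using N
    by (intro divide_right_mono add_mono sum_mono walsh_bond_le[OF v _ J x] walsh_resv_le[OF v _ J x])
       (use \<alpha> in auto)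
  finally show ?thesis .
qed

section \<open>Reduction of one tag to a killed walk\<close>

definition tag_sum :: "nat \<Rightarrow> real \<Rightarrow> (nat \<Rightarrow> real) \<Rightarrow> (nat \<Rightarrow> nat set \<Rightarrow> real) \<Rightarrow> real" where
  "tag_sum N \<alpha> c v = bern {1..N} \<alpha> (\<lambda>J. \<Sum>x\<in>J. c x * v x J)"

definition kwalk :: "nat \<Rightarrow> (nat \<Rightarrow> real) \<Rightarrow> nat \<Rightarrow> real" where
  "kwalk N c x = ((\<Sum>e\<in>{1..<N}. (c x + c (nswap e x)) / 2) + (if x = 1 then 0 else c x) / 2
     + (if x = N then 0 else c x) / 2) / real N"

lemma tag_sum_mbond:
  assumes e: "e \<in> {1..<N}"
  shows "tag_sum N \<alpha> c (mbond e v) = tag_sum N \<alpha> (\<lambda>x. (c x + c (nswap e x)) / 2) v"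
proof -
  have "tag_sum N \<alpha> c (mbond e v) = bern {1..N} \<alpha> (\<lambda>J. 1/2 * (\<Sum>x\<in>J. c x * v x J)
      + 1/2 * (\<Sum>x\<in>J. c x * v (nswap e x) (nswap e ` J)))"
    unfolding tag_sum_def mbond_def
    by (rule bern_cong) (simp add: sum.distrib sum_distrib_left distrib_left add_divide_distrib)
  also have "\<dots> = 1/2 * bern {1..N} \<alpha> (\<lambda>J. \<Sum>x\<in>J. c x * v x J)
      + 1/2 * bern {1..N} \<alpha> (\<lambda>J. \<Sum>x\<in>J. c x * v (nswap e x) (nswap e ` J))"
    by (simp only: bern_add bern_mult)
  also have "bern {1..N} \<alpha> (\<lambda>J. \<Sum>x\<in>J. c x * v (nswap e x) (nswap e ` J))
      = bern {1..N} \<alpha> (\<lambda>J. \<Sum>x\<in>J. c (nswap e x) * v x J)"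
    by (subst bern_nswap[OF e, symmetric]) (simp add: sum_nswap)
  also have "1/2 * bern {1..N} \<alpha> (\<lambda>J. \<Sum>x\<in>J. c x * v x J) + 1/2 * \<dots>
      = bern {1..N} \<alpha> (\<lambda>J. 1/2 * (\<Sum>x\<in>J. c x * v x J) + 1/2 * (\<Sum>x\<in>J. c (nswap e x) * v x J))"
    by (simp only: bern_add bern_mult)
  also have "\<dots> = tag_sum N \<alpha> (\<lambda>x. (c x + c (nswap e x)) / 2) v"
    unfolding tag_sum_def
    by (rule bern_cong) (simp add: sum.distrib[symmetric] sum_distrib_left algebra_simps add_divide_distrib)
  finally show ?thesis .
qed

lemma tag_sum_mresv:
  assumes i: "i \<in> {1..N}"
  shows "tag_sum N \<alpha> c (mresv \<alpha> i v) = tag_sum N \<alpha> (\<lambda>x. if x = i then 0 else c x) v"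
  unfolding tag_sum_def bern_remove[of "{1..N}" i, OF finite_atLeastAtMost i]
proof (rule bern_cong)
  fix J assume "J \<subseteq> {1..N} - {i}"
  then have J: "finite J" "i \<notin> J" by (auto intro: finite_subset)
  then have Ji: "insert i J - {i} = J" by auto
  have 1: "(\<Sum>x\<in>J. c x * mresv \<alpha> i v x K) = \<alpha> * (\<Sum>x\<in>J. c x * v x (insert i K)) + (1 - \<alpha>) * (\<Sum>x\<in>J. c x * v x (K - {i}))" for K
  proof -
    have "(\<Sum>x\<in>J. c x * mresv \<alpha> i v x K) = (\<Sum>x\<in>J. \<alpha> * (c x * v x (insert i K)) + (1 - \<alpha>) * (c x * v x (K - {i})))"
      using J by (intro sum.cong) (auto simp: mresv_def algebra_simps)
    then show ?thesis by (simp only: sum.distrib sum_distrib_left)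
  qed
  have 2: "(\<Sum>x\<in>J. (if x = i then 0 else c x) * v x K) = (\<Sum>x\<in>J. c x * v x K)" for K
    using J by (intro sum.cong) auto
  have 3: "(\<Sum>x\<in>insert i J. c x * mresv \<alpha> i v x K) = (\<Sum>x\<in>J. c x * mresv \<alpha> i v x K)" for K
    using J by (simp add: mresv_def)
  have 4: "(\<Sum>x\<in>insert i J. (if x = i then 0 else c x) * v x K) = (\<Sum>x\<in>J. (if x = i then 0 else c x) * v x K)" for K
    using J by simp
  show "(1 - \<alpha>) * (\<Sum>x\<in>J. c x * mresv \<alpha> i v x J) + \<alpha> * (\<Sum>x\<in>insert i J. c x * mresv \<alpha> i v x (insert i J))
    = (1 - \<alpha>) * (\<Sum>x\<in>J. (if x = i then 0 else c x) * v x J) + \<alpha> * (\<Sum>x\<in>insert i J. (if x = i then 0 else c x) * v x (insert i J))"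
    unfolding 3 4 1 2 using J Ji by (simp add: algebra_simps)
qed

lemma tag_sum_add_left: "tag_sum N \<alpha> (\<lambda>x. c x + d x) v = tag_sum N \<alpha> c v + tag_sum N \<alpha> d v"
  by (simp add: tag_sum_def distrib_right sum.distrib bern_add)

lemma tag_sum_mult_left: "tag_sum N \<alpha> (\<lambda>x. k * c x) v = k * tag_sum N \<alpha> c v"
  by (simp add: tag_sum_def mult.assoc sum_distrib_left[symmetric] bern_mult)

lemma tag_sum_sum_left: "tag_sum N \<alpha> (\<lambda>x. \<Sum>e\<in>E. c e x) v = (\<Sum>e\<in>E. tag_sum N \<alpha> (c e) v)"
proof (cases "finite E")
  case True
  then show ?thesis by induction (simp_all add: tag_sum_add_left, simp add: tag_sum_def)
qed (simp add: tag_sum_def)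

lemma tag_sum_add_right: "tag_sum N \<alpha> c (\<lambda>x J. v x J + w x J) = tag_sum N \<alpha> c v + tag_sum N \<alpha> c w"
  by (simp add: tag_sum_def distrib_left sum.distrib bern_add)

lemma tag_sum_mult_right: "tag_sum N \<alpha> c (\<lambda>x J. k * v x J) = k * tag_sum N \<alpha> c v"
  by (simp add: tag_sum_def mult.left_commute[of _ k] sum_distrib_left[symmetric] bern_mult)

lemma tag_sum_sum_right: "tag_sum N \<alpha> c (\<lambda>x J. \<Sum>e\<in>E. v e x J) = (\<Sum>e\<in>E. tag_sum N \<alpha> c (v e))"
proof (cases "finite E")
  case True
  then show ?thesis by induction (simp_all add: tag_sum_add_right, simp add: tag_sum_def)
qed (simp add: tag_sum_def)

text \<open>Duality: a Bernoulli environment containing the tag stays Bernoulli, so one step changes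
  only the weight given to the position of the tag, and this weight evolves by a walk killed at the
  reservoirs.\<close>

lemma tag_sum_mskel:
  assumes N: "N \<ge> 1"
  shows "tag_sum N \<alpha> c (mskel N \<alpha> v) = tag_sum N \<alpha> (kwalk N c) v"
proof -
  have "mskel N \<alpha> v = (\<lambda>x J. (1 / real N) * ((\<Sum>e\<in>{1..<N}. mbond e v x J) +
      ((1/2) * mresv \<alpha> 1 v x J + (1/2) * mresv \<alpha> N v x J)))"
    by (intro ext) (simp add: mskel_def)
  then have "tag_sum N \<alpha> c (mskel N \<alpha> v) = (1 / real N) * ((\<Sum>e\<in>{1..<N}. tag_sum N \<alpha> c (mbond e v)) +
      ((1/2) * tag_sum N \<alpha> c (mresv \<alpha> 1 v) + (1/2) * tag_sum N \<alpha> c (mresv \<alpha> N v)))"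
    by (simp only: tag_sum_mult_right tag_sum_add_right tag_sum_sum_right)
  also have "(\<Sum>e\<in>{1..<N}. tag_sum N \<alpha> c (mbond e v)) = (\<Sum>e\<in>{1..<N}. tag_sum N \<alpha> (\<lambda>x. (c x + c (nswap e x)) / 2) v)"
    by (rule sum.cong[OF refl]) (rule tag_sum_mbond)
  also have "tag_sum N \<alpha> c (mresv \<alpha> 1 v) = tag_sum N \<alpha> (\<lambda>x. if x = 1 then 0 else c x) v"
    using N by (intro tag_sum_mresv) auto
  also have "tag_sum N \<alpha> c (mresv \<alpha> N v) = tag_sum N \<alpha> (\<lambda>x. if x = N then 0 else c x) v"
    using N by (intro tag_sum_mresv) auto
  also have "(1 / real N) * ((\<Sum>e\<in>{1..<N}. tag_sum N \<alpha> (\<lambda>x. (c x + c (nswap e x)) / 2) v) +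
      ((1/2) * tag_sum N \<alpha> (\<lambda>x. if x = 1 then 0 else c x) v + (1/2) * tag_sum N \<alpha> (\<lambda>x. if x = N then 0 else c x) v))
    = tag_sum N \<alpha> (\<lambda>x. (1 / real N) * ((\<Sum>e\<in>{1..<N}. (c x + c (nswap e x)) / 2) +
      ((1/2) * (if x = 1 then 0 else c x) + (1/2) * (if x = N then 0 else c x)))) v"
    by (simp only: tag_sum_mult_left tag_sum_add_left tag_sum_sum_left)
  also have "(\<lambda>x. (1 / real N) * ((\<Sum>e\<in>{1..<N}. (c x + c (nswap e x)) / 2) +
      ((1/2) * (if x = 1 then 0 else c x) + (1/2) * (if x = N then 0 else c x)))) = kwalk N c"
    by (intro ext) (simp add: kwalk_def)
  finally show ?thesis .
qed

lemma tag_sum_mskel_power: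
  assumes N: "N \<ge> 1"
  shows "tag_sum N \<alpha> c ((mskel N \<alpha> ^^ m) v) = tag_sum N \<alpha> ((kwalk N ^^ m) c) v"
proof (induction m arbitrary: c)
  case (Suc m)
  have "tag_sum N \<alpha> c ((mskel N \<alpha> ^^ Suc m) v) = tag_sum N \<alpha> ((kwalk N ^^ m) (kwalk N c)) v"
    by (simp add: tag_sum_mskel[OF N] Suc.IH)
  then show ?case by (simp add: funpow_swap1)
qed simp

subsection \<open>The killed walk\<close>

text \<open>The eigenvalue of \<open>kwalk\<close> on the Dirichlet mode \<open>smode\<close>. In
  continuous time the decay rate is \<open>2 * N^3 * (1 - skappa N)\<close>.\<close>

definition skappa :: "nat \<Rightarrow> real" where
  "skappa N = 1 - (1 - cos (pi / (real N + 1))) / real N"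

definition smode :: "nat \<Rightarrow> nat \<Rightarrow> real" where
  "smode N x = sin (pi * real x / (real N + 1))"

lemma smode_0 [simp]: "smode N 0 = 0"
  by (simp add: smode_def)

lemma smode_end [simp]: "smode N (Suc N) = 0"
proof -
  have "pi * real (Suc N) / (real N + 1) = pi" by (simp add: field_simps)
  then show ?thesis by (simp add: smode_def)
qed

lemma smode_pos:
  assumes "x \<in> {1..N}"
  shows "0 < smode N x"
proof -
  have "pi * real x < pi * (real N + 1)" using assms by (intro mult_strict_left_mono) auto
  then have "pi * real x / (real N + 1) < pi" by (simp add: pos_divide_less_eq)
  then show ?thesis unfolding smode_def using assms by (intro sin_gt_zero) (auto simp: field_simps)
qed

lemma smode_laplacian: "smode N (Suc (Suc x)) + smode N x = 2 * cos (pi / (real N + 1)) * smode N (Suc x)"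
proof -
  have 1: "pi * real (Suc (Suc x)) / (real N + 1) = pi * real (Suc x) / (real N + 1) + pi / (real N + 1)"
    and 2: "pi * real x / (real N + 1) = pi * real (Suc x) / (real N + 1) - pi / (real N + 1)"
    by (simp_all add: add_divide_distrib algebra_simps)
  show ?thesis unfolding smode_def 1 2 sin_add sin_diff by simp
qed

text \<open>Being killed with weight 1/2 at an end is the same as averaging with a fictitious site 0
  or \<open>Suc N\<close> where \<open>c\<close> vanishes. The walk is thus a Dirichlet Laplacian
  without boundary cases; writing the site as \<open>Suc x\<close> gives it a left neighbour
  \<open>x\<close>.\<close>

lemma kwalk_eq:
  assumes N: "N \<ge> 1" and x: "Suc x \<in> {1..N}" and c: "c 0 = 0" "c (Suc N) = 0"
  shows "kwalk N c (Suc x) = c (Suc x) + (c (Suc (Suc x)) + c x - 2 * c (Suc x)) / (2 * real N)"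
proof -
  have "(\<Sum>e\<in>{1..<N}. (c (Suc x) + c (nswap e (Suc x))) / 2)
      = (\<Sum>e\<in>{1..<N}. c (Suc x) + (if e = Suc x then (c (Suc (Suc x)) - c (Suc x)) / 2 else 0)
          + (if e = x then (c x - c (Suc x)) / 2 else 0))"
    by (intro sum.cong) (auto simp: nswap_def field_simps)
  also have "\<dots> = (real N - 1) * c (Suc x) + (if Suc x < N then (c (Suc (Suc x)) - c (Suc x)) / 2 else 0)
      + (if 1 \<le> x then (c x - c (Suc x)) / 2 else 0)"
    using N x by (simp add: sum.distrib sum.delta of_nat_diff)
  finally have eq: "(\<Sum>e\<in>{1..<N}. (c (Suc x) + c (nswap e (Suc x))) / 2) = \<dots>" .
  have "real N * kwalk N c (Suc x) = (real N - 1) * c (Suc x) + (c (Suc (Suc x)) - c (Suc x)) / 2 + (c x - c (Suc x)) / 2 + c (Suc x)"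
  proof -
    have r: "(if Suc x < N then (c (Suc (Suc x)) - c (Suc x)) / 2 else 0) + (if Suc x = N then 0 else c (Suc x)) / 2
        = (c (Suc (Suc x)) - c (Suc x)) / 2 + c (Suc x) / 2"
      using x c by (cases "Suc x = N") (auto simp: field_simps)
    have l: "(if 1 \<le> x then (c x - c (Suc x)) / 2 else 0) + (if Suc x = 1 then 0 else c (Suc x)) / 2
        = (c x - c (Suc x)) / 2 + c (Suc x) / 2"
      using c by (cases "x = 0") (auto simp: field_simps)
    have "real N * kwalk N c (Suc x) = (real N - 1) * c (Suc x)
      + ((if Suc x < N then (c (Suc (Suc x)) - c (Suc x)) / 2 else 0) + (if Suc x = N then 0 else c (Suc x)) / 2)
      + ((if 1 \<le> x then (c x - c (Suc x)) / 2 else 0) + (if Suc x = 1 then 0 else c (Suc x)) / 2)"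
      using N unfolding kwalk_def eq by simp
    then show ?thesis unfolding r l by simp
  qed
  also have "\<dots> = real N * (c (Suc x) + (c (Suc (Suc x)) + c x - 2 * c (Suc x)) / (2 * real N))"
    using N by (simp add: field_simps)
  finally show ?thesis using N by simp
qed

lemma weighted_square3:
  fixes a b c :: real
  assumes "0 \<le> a" "0 \<le> b" "0 \<le> c"
  shows "(a * t + b * u + c * v)\<^sup>2 \<le> (a + b + c) * (a * t\<^sup>2 + b * u\<^sup>2 + c * v\<^sup>2)"
proof -
  have "0 \<le> a * b * (t - u)\<^sup>2 + a * c * (t - v)\<^sup>2 + b * c * (u - v)\<^sup>2"
    using assms by auto
  also have "\<dots> = (a + b + c) * (a * t\<^sup>2 + b * u\<^sup>2 + c * v\<^sup>2) - (a * t + b * u + c * v)\<^sup>2"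
    by (simp add: power2_eq_square algebra_simps)
  finally show ?thesis by simp
qed

text \<open>Schur's test with the positive eigenvector.\<close>

lemma kwalk_norm:
  assumes N: "N \<ge> 1"
  shows "(\<Sum>x\<in>{1..N}. (kwalk N c x)\<^sup>2) \<le> (skappa N)\<^sup>2 * (\<Sum>x\<in>{1..N}. (c x)\<^sup>2)"
proof -
  \<comment> \<open>\<open>t\<close> is the ratio to the positive eigenvector. \<open>d\<close> is
    \<open>c\<close> extended by 0 to the fictitious sites, so that \<open>kwalk_eq\<close> applies
    to it.\<close>
  define t where "t x = (if x \<in> {1..N} then c x / smode N x else 0)" for x
  define d where "d x = smode N x * t x" for x
  have d: "d x = c x" if "x \<in> {1..N}" for x
    using smode_pos[OF that] that by (simp add: d_def t_def)
  have d0: "d 0 = 0" "d (Suc N) = 0" by (simp_all add: d_def)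
  have s0: "0 \<le> smode N x" if "x \<le> Suc N" for x
    using that smode_pos[of x N] by (cases "x = 0"; cases "x = Suc N") (auto intro: less_imp_le)
  define w where "w = 1 / (2 * real N)"
  have w: "0 \<le> w" "0 \<le> 1 - 2 * w" using N by (auto simp: w_def field_simps)
  have kap: "w * smode N x + (1 - 2 * w) * smode N (Suc x) + w * smode N (Suc (Suc x)) = skappa N * smode N (Suc x)" for x
  proof -
    have "w * smode N x + (1 - 2 * w) * smode N (Suc x) + w * smode N (Suc (Suc x))
      = (1 - 2 * w) * smode N (Suc x) + w * (smode N (Suc (Suc x)) + smode N x)" by (simp add: algebra_simps)
    also have "\<dots> = skappa N * smode N (Suc x)"
      unfolding smode_laplacian skappa_def w_def using N by (simp add: field_simps)
    finally show ?thesis .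
  qed
  have kd: "kwalk N c x = kwalk N d x" if "x \<in> {1..N}" for x
  proof -
    have "nswap e x \<in> {1..N}" if "e \<in> {1..<N}" for e
      using that \<open>x \<in> {1..N}\<close> by (auto simp: nswap_def)
    then show ?thesis using that unfolding kwalk_def by (simp add: d)
  qed
  have "(kwalk N c (Suc x))\<^sup>2 \<le> skappa N * smode N (Suc x) * (w * smode N x * (t x)\<^sup>2
      + (1 - 2 * w) * smode N (Suc x) * (t (Suc x))\<^sup>2 + w * smode N (Suc (Suc x)) * (t (Suc (Suc x)))\<^sup>2)"
    if x: "Suc x \<in> {1..N}" for x
  proof -
    have "kwalk N c (Suc x) = d (Suc x) + (d (Suc (Suc x)) + d x - 2 * d (Suc x)) / (2 * real N)"
      unfolding kd[OF x] by (rule kwalk_eq[OF N x d0])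
    also have "\<dots> = (w * smode N x) * t x + ((1 - 2 * w) * smode N (Suc x)) * t (Suc x) + (w * smode N (Suc (Suc x))) * t (Suc (Suc x))"
      by (simp add: d_def w_def add_divide_distrib diff_divide_distrib algebra_simps)
    also have "(\<dots>)\<^sup>2 \<le> (w * smode N x + (1 - 2 * w) * smode N (Suc x) + w * smode N (Suc (Suc x)))
       * ((w * smode N x) * (t x)\<^sup>2 + ((1 - 2 * w) * smode N (Suc x)) * (t (Suc x))\<^sup>2 + (w * smode N (Suc (Suc x))) * (t (Suc (Suc x)))\<^sup>2)"
      using x w s0 by (intro weighted_square3 mult_nonneg_nonneg) auto
    finally show ?thesis unfolding kap .
  qed
  then have "(\<Sum>x\<in>{..<N}. (kwalk N c (Suc x))\<^sup>2) \<le> (\<Sum>x\<in>{..<N}. skappa N * smode N (Suc x) * (w * smode N x * (t x)\<^sup>2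
      + (1 - 2 * w) * smode N (Suc x) * (t (Suc x))\<^sup>2 + w * smode N (Suc (Suc x)) * (t (Suc (Suc x)))\<^sup>2))"
    by (intro sum_mono) auto
  also have "\<dots> = skappa N * ((\<Sum>x\<in>{..<N}. w * smode N (Suc x) * (smode N x * (t x)\<^sup>2))
      + (\<Sum>x\<in>{..<N}. (1 - 2 * w) * smode N (Suc x) * (smode N (Suc x) * (t (Suc x))\<^sup>2))
      + (\<Sum>x\<in>{..<N}. w * smode N (Suc x) * (smode N (Suc (Suc x)) * (t (Suc (Suc x)))\<^sup>2)))"
    by (simp add: sum.distrib[symmetric] sum_distrib_left algebra_simps)
  \<comment> \<open>Shifting the two outer sums gives all three the same factor in
    \<open>t (Suc x)\<close>. The boundary terms vanish with the mode at 0 and at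
    \<open>Suc N\<close>.\<close>
  also have "(\<Sum>x\<in>{..<N}. w * smode N (Suc x) * (smode N x * (t x)\<^sup>2))
      = (\<Sum>x\<in>{..<N}. w * smode N (Suc (Suc x)) * (smode N (Suc x) * (t (Suc x))\<^sup>2))"
  proof -
    let ?h = "\<lambda>x. w * smode N (Suc x) * (smode N x * (t x)\<^sup>2)"
    have "(\<Sum>x\<in>{..<N}. ?h x) + ?h N = ?h 0 + (\<Sum>x\<in>{..<N}. ?h (Suc x))"
      using sum.lessThan_Suc[of ?h N] sum.lessThan_Suc_shift[of ?h N] by simp
    then show ?thesis by simp
  qed
  also have "(\<Sum>x\<in>{..<N}. w * smode N (Suc x) * (smode N (Suc (Suc x)) * (t (Suc (Suc x)))\<^sup>2))
      = (\<Sum>x\<in>{..<N}. w * smode N x * (smode N (Suc x) * (t (Suc x))\<^sup>2))"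
  proof -
    let ?h = "\<lambda>x. w * smode N x * (smode N (Suc x) * (t (Suc x))\<^sup>2)"
    have "(\<Sum>x\<in>{..<N}. ?h x) + ?h N = ?h 0 + (\<Sum>x\<in>{..<N}. ?h (Suc x))"
      using sum.lessThan_Suc[of ?h N] sum.lessThan_Suc_shift[of ?h N] by simp
    then show ?thesis by simp
  qed
  also have "(\<Sum>x\<in>{..<N}. w * smode N (Suc (Suc x)) * (smode N (Suc x) * (t (Suc x))\<^sup>2))
      + (\<Sum>x\<in>{..<N}. (1 - 2 * w) * smode N (Suc x) * (smode N (Suc x) * (t (Suc x))\<^sup>2))
      + (\<Sum>x\<in>{..<N}. w * smode N x * (smode N (Suc x) * (t (Suc x))\<^sup>2))
    = (\<Sum>x\<in>{..<N}. (w * smode N x + (1 - 2 * w) * smode N (Suc x) + w * smode N (Suc (Suc x))) * (smode N (Suc x) * (t (Suc x))\<^sup>2))"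
    by (simp add: sum.distrib[symmetric] algebra_simps)
  also have "skappa N * \<dots> = (skappa N)\<^sup>2 * (\<Sum>x\<in>{..<N}. (d (Suc x))\<^sup>2)"
    unfolding kap by (simp add: sum_distrib_left power2_eq_square d_def mult_ac)
  also have "(\<Sum>x\<in>{..<N}. (d (Suc x))\<^sup>2) = (\<Sum>x\<in>{..<N}. (c (Suc x))\<^sup>2)"
    by (intro sum.cong) (auto simp: d)
  finally show ?thesis
    by (simp add: sum.atLeast1_atMost_eq)
qed

lemma skappa_nonneg: "N \<ge> 2 \<Longrightarrow> 0 \<le> skappa N"
proof -
  assume N: "N \<ge> 2"
  have "1 - cos (pi / (real N + 1)) \<le> 2" using cos_ge_minus_one[of "pi / (real N + 1)"] by linarith
  then show ?thesis using N by (simp add: skappa_def field_simps)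
qed

lemma kwalk_power_norm:
  assumes N: "N \<ge> 1"
  shows "(\<Sum>x\<in>{1..N}. ((kwalk N ^^ m) (\<lambda>_. 1) x)\<^sup>2) \<le> ((skappa N) ^ m)\<^sup>2 * real N"
proof (induction m)
  case (Suc m)
  have "(\<Sum>x\<in>{1..N}. ((kwalk N ^^ Suc m) (\<lambda>_. 1) x)\<^sup>2) \<le> (skappa N)\<^sup>2 * (\<Sum>x\<in>{1..N}. ((kwalk N ^^ m) (\<lambda>_. 1) x)\<^sup>2)"
    using kwalk_norm[OF N] by simp
  also have "\<dots> \<le> (skappa N)\<^sup>2 * (((skappa N) ^ m)\<^sup>2 * real N)"
    using Suc by (intro mult_left_mono) auto
  finally show ?case by (simp add: power_mult_distrib mult_ac)
qed simp

text \<open>Cauchy-Schwarz is used twice: on the event that \<open>x\<close> lies in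
  \<open>J\<close>, whose probability gives the factor \<open>\<alpha>\<close>, and then over the
  sites.\<close>

lemma tag_sum_Cauchy_Schwarz:
  assumes \<alpha>: "0 \<le> \<alpha>" "\<alpha> \<le> 1"
  shows "tag_sum N \<alpha> c v \<le> sqrt (\<alpha> * (\<Sum>x\<in>{1..N}. (c x)\<^sup>2)) * sqrt (bern {1..N} \<alpha> (\<lambda>J. \<Sum>x\<in>J. (v x J)\<^sup>2))"
proof -
  let ?E = "bern {1..N} \<alpha>"
  define m where "m x = ?E (\<lambda>J. of_bool (x \<in> J) * v x J)" for x
  note E_sum_in = sum_of_bool_subset[OF finite_atLeastAtMost, of _ 1 N]
  have "tag_sum N \<alpha> c v = ?E (\<lambda>J. \<Sum>x\<in>{1..N}. c x * (of_bool (x \<in> J) * v x J))"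
    unfolding tag_sum_def
    by (rule bern_cong) (simp only: mult.left_commute[of "c _"] E_sum_in)
  also have "\<dots> = (\<Sum>x\<in>{1..N}. c x * m x)"
    unfolding m_def by (simp only: bern_sum bern_mult)
  finally have eq: "tag_sum N \<alpha> c v = (\<Sum>x\<in>{1..N}. c x * m x)" .
  have m: "(m x)\<^sup>2 \<le> \<alpha> * ?E (\<lambda>J. of_bool (x \<in> J) * (v x J)\<^sup>2)" if "x \<in> {1..N}" for x
  proof -
    let ?b = "\<lambda>J. of_bool (x \<in> J) :: real"
    have b: "?b J * (?b J * h) = ?b J * h" "(?b J)\<^sup>2 = ?b J" "(?b J * h)\<^sup>2 = ?b J * h\<^sup>2" for J h
      by auto
    have p: "?E ?b = \<alpha>" using bern_superset[of "{1..N}" "{x}" \<alpha>] that by simp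
    show ?thesis
      using bern_Cauchy_Schwarz[OF \<alpha>, of "{1..N}" ?b "\<lambda>J. ?b J * v x J"]
      unfolding m_def by (simp only: b p)
  qed
  have "(tag_sum N \<alpha> c v)\<^sup>2 \<le> (\<Sum>x\<in>{1..N}. (c x)\<^sup>2) * (\<Sum>x\<in>{1..N}. (m x)\<^sup>2)"
    unfolding eq by (rule Cauchy_Schwarz_ineq_sum)
  also have "\<dots> \<le> (\<Sum>x\<in>{1..N}. (c x)\<^sup>2) * (\<Sum>x\<in>{1..N}. \<alpha> * ?E (\<lambda>J. of_bool (x \<in> J) * (v x J)\<^sup>2))"
    by (intro mult_left_mono sum_mono m sum_nonneg) auto
  also have "(\<Sum>x\<in>{1..N}. \<alpha> * ?E (\<lambda>J. of_bool (x \<in> J) * (v x J)\<^sup>2))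
      = \<alpha> * ?E (\<lambda>J. \<Sum>x\<in>{1..N}. of_bool (x \<in> J) * (v x J)\<^sup>2)"
    by (simp only: bern_sum sum_distrib_left)
  also have "?E (\<lambda>J. \<Sum>x\<in>{1..N}. of_bool (x \<in> J) * (v x J)\<^sup>2) = ?E (\<lambda>J. \<Sum>x\<in>J. (v x J)\<^sup>2)"
    by (rule bern_cong) (simp only: E_sum_in)
  finally have "(tag_sum N \<alpha> c v)\<^sup>2 \<le> (\<alpha> * (\<Sum>x\<in>{1..N}. (c x)\<^sup>2)) * ?E (\<lambda>J. \<Sum>x\<in>J. (v x J)\<^sup>2)"
    by (simp add: mult_ac)
  then have "sqrt ((tag_sum N \<alpha> c v)\<^sup>2) \<le> sqrt ((\<alpha> * (\<Sum>x\<in>{1..N}. (c x)\<^sup>2)) * ?E (\<lambda>J. \<Sum>x\<in>J. (v x J)\<^sup>2))"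
    by (rule real_sqrt_le_mono)
  then have "\<bar>tag_sum N \<alpha> c v\<bar> \<le> sqrt (\<alpha> * (\<Sum>x\<in>{1..N}. (c x)\<^sup>2)) * sqrt (?E (\<lambda>J. \<Sum>x\<in>J. (v x J)\<^sup>2))"
    by (simp only: real_sqrt_mult real_sqrt_abs)
  then show ?thesis by linarith
qed

subsection \<open>Gradient bound and oscillation\<close>

text \<open>The tag spreads in its last \<open>16 * N^3\<close> steps, where the root of the
  collision probability bounds the Walsh coefficient. For the \<open>m\<close> steps before, the
  triangle inequality suffices, and the weight of the tag loses a factor \<open>skappa N\<close> per
  step. The bound \<open>u\<close> is uniform in \<open>\<eta>\<close>, so configurations may later
  be changed site by site.\<close>

lemma gradient_bound:
  assumes f: "\<And>\<zeta>. \<bar>f \<zeta>\<bar> \<le> 1" and N: "N \<ge> 2"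
    and \<alpha>: "0 < \<alpha>" "\<alpha> / 2 \<le> p" "\<alpha> / 2 \<le> 1 - p" "\<alpha> / 2 \<le> q" "\<alpha> / 2 \<le> 1 - q"
  shows "\<exists>u. (\<forall>J x \<eta>. J \<subseteq> {1..N} \<longrightarrow> x \<in> J \<longrightarrow>
      \<bar>walsh ((skel N p q ^^ (m + 16 * N ^ 3)) f) 0 (unit_at x) J \<eta>\<bar> \<le> u x J) \<and>
    bern {1..N} \<alpha> (\<lambda>J. \<Sum>x\<in>J. u x J) \<le> 8 * sqrt (\<alpha> * real N) * skappa N ^ m"
proof -
  define V where "V = (pskel N \<alpha> ^^ (16 * N ^ 3)) pdiag"
  define v where "v x J = sqrt (V x x J)" for x J
  have \<alpha>1: "\<alpha> \<le> 1" and \<alpha>0: "0 \<le> \<alpha>" and N1: "N \<ge> 1" using \<alpha> N by auto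
  let ?Q = "skel N p q"
  have V: "(walsh ((?Q ^^ (16 * N ^ 3)) f) 0 (unit_at x) J \<eta>)\<^sup>2 \<le> V x x J" if "J \<subseteq> {1..N}" "x \<in> J" for x J \<eta>
  proof -
    have fin: "finite J" using that(1) by (rule finite_subset) simp
    have "qform V (unit_at x) J = (\<Sum>y\<in>J. \<Sum>z\<in>J. if y = x then if z = x then V y z J else 0 else 0)"
      unfolding qform_def by (intro sum.cong) auto
    also have "\<dots> = (\<Sum>y\<in>J. if y = x then V y x J else 0)"
      using fin that by (intro sum.cong) (auto simp: sum.delta)
    also have "\<dots> = V x x J" using fin that by (simp add: sum.delta)
    finally show ?thesis
      using walsh_skel_power_square_le[OF f N1 that(1) \<alpha>0 \<alpha>(2-5), where n = "16 * N ^ 3" and a = "unit_at x" and \<eta> = \<eta>] by (simp add: V_def)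
  qed
  have le: "\<bar>walsh ((?Q ^^ (m + 16 * N ^ 3)) f) 0 (unit_at x) J \<eta>\<bar> \<le> (mskel N \<alpha> ^^ m) v x J"
    if "J \<subseteq> {1..N}" "x \<in> J" for x J \<eta>
    using that
  proof (induction m arbitrary: x J \<eta>)
    case 0
    then show ?case
      unfolding v_def using real_sqrt_le_mono[OF V[OF 0]] by simp
  next
    case (Suc m)
    show ?case
      using walsh_skel_le[OF Suc.IH N1 Suc.prems \<alpha>0 \<alpha>(2-5)] by simp
  qed
  have "bern {1..N} \<alpha> (\<lambda>J. \<Sum>x\<in>J. (mskel N \<alpha> ^^ m) v x J) = tag_sum N \<alpha> ((kwalk N ^^ m) (\<lambda>_. 1)) v"
    unfolding tag_sum_mskel_power[OF N1, symmetric] by (simp add: tag_sum_def)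
  also have "\<dots> \<le> sqrt (\<alpha> * (\<Sum>x\<in>{1..N}. ((kwalk N ^^ m) (\<lambda>_. 1) x)\<^sup>2)) * sqrt (bern {1..N} \<alpha> (\<lambda>J. \<Sum>x\<in>J. (v x J)\<^sup>2))"
    by (rule tag_sum_Cauchy_Schwarz[OF \<alpha>0 \<alpha>1])
  also have "\<dots> \<le> sqrt (\<alpha> * ((skappa N ^ m)\<^sup>2 * real N)) * sqrt 64"
  proof (intro mult_mono real_sqrt_le_mono mult_left_mono kwalk_power_norm N1 \<alpha>0)
    have "(v x J)\<^sup>2 = V x x J" if "J \<subseteq> {1..N}" "x \<in> J" for x J
      unfolding v_def using order_trans[OF zero_le_power2 V[OF that]] by simp
    then have "bern {1..N} \<alpha> (\<lambda>J. \<Sum>x\<in>J. (v x J)\<^sup>2) = bern {1..N} \<alpha> (\<lambda>J. \<Sum>x\<in>J. V x x J)"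
      by (intro bern_cong sum.cong) auto
    also have "\<dots> \<le> 64" unfolding V_def by (rule collision_bound[OF N \<alpha>(1) \<alpha>1])
    finally show "bern {1..N} \<alpha> (\<lambda>J. \<Sum>x\<in>J. (v x J)\<^sup>2) \<le> 64" .
    show "0 \<le> sqrt (bern {1..N} \<alpha> (\<lambda>J. \<Sum>x\<in>J. (v x J)\<^sup>2))"
      by (intro real_sqrt_ge_zero bern_nonneg \<alpha>0 \<alpha>1 sum_nonneg) auto
  qed (use \<alpha>0 in \<open>auto intro!: mult_nonneg_nonneg sum_nonneg\<close>)
  also have "\<dots> = 8 * sqrt (\<alpha> * real N) * skappa N ^ m"
  proof -
    have "sqrt (8\<^sup>2) = (8::real)" by (rule real_sqrt_unique) auto
    then have "sqrt 64 = (8::real)" by simp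
    then show ?thesis using skappa_nonneg[OF N] by (simp add: real_sqrt_mult)
  qed
  finally show ?thesis using le by blast
qed

section \<open>Randomizing the initial configuration\<close>

lemma bern_marked:
  \<comment> \<open>A Mecke formula: adding a site to \<open>J\<close> and marking it amounts, up to
    a factor \<open>\<alpha>\<close>, to marking a site of \<open>J\<close>.\<close>
  assumes "finite I"
  shows "\<alpha> * (\<Sum>x\<in>I. bern (I - {x}) \<alpha> (\<lambda>J. u x (insert x J))) = bern I \<alpha> (\<lambda>J. \<Sum>x\<in>J. u x J)"
proof -
  have "bern I \<alpha> (\<lambda>J. \<Sum>x\<in>J. u x J) = bern I \<alpha> (\<lambda>J. \<Sum>x\<in>I. of_bool (x \<in> J) * u x J)"
    by (rule bern_cong) (simp only: sum_of_bool_subset[OF assms])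
  also have "\<dots> = (\<Sum>x\<in>I. bern I \<alpha> (\<lambda>J. of_bool (x \<in> J) * u x J))"
    by (rule bern_sum)
  also have "\<dots> = (\<Sum>x\<in>I. bern (I - {x}) \<alpha> (\<lambda>J. \<alpha> * u x (insert x J)))"
  proof (rule sum.cong[OF refl])
    fix x assume x: "x \<in> I"
    show "bern I \<alpha> (\<lambda>J. of_bool (x \<in> J) * u x J) = bern (I - {x}) \<alpha> (\<lambda>J. \<alpha> * u x (insert x J))"
      unfolding bern_remove[OF assms x] by (rule bern_cong) auto
  qed
  finally show ?thesis by (simp add: bern_mult sum_distrib_left)
qed

lemma bern_0: "finite I \<Longrightarrow> bern I 0 F = F {}"
proof (induction I arbitrary: F rule: finite_induct)
  case (insert i I)
  then show ?case by (simp add: bern_insert)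
qed simp

definition noise :: "nat \<Rightarrow> real \<Rightarrow> (config \<Rightarrow> real) \<Rightarrow> config \<Rightarrow> real" where
  "noise N \<theta> f \<eta> = bern {1..N} \<theta> (\<lambda>J. walsh f 1 (\<lambda>_. 0) J \<eta>)"

text \<open>By Russo's formula the derivative sums the effects of turning one known site into a
  coin. Since the known value is 0 or 1, each effect is plus or minus a Walsh coefficient with its
  tag at that site.\<close>

lemma noise_derivative_bound:
  assumes u: "\<And>x J \<eta>. J \<subseteq> {1..N} \<Longrightarrow> x \<in> J \<Longrightarrow> \<bar>walsh f 0 (unit_at x) J \<eta>\<bar> \<le> u x J"
    and \<theta>: "0 < \<theta>" "\<theta> \<le> 1" and \<eta>: "\<eta> \<in> configs N"
    and B: "bern {1..N} \<theta> (\<lambda>J. \<Sum>x\<in>J. u x J) \<le> B"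
  shows "\<exists>D. ((\<lambda>\<theta>. noise N \<theta> f \<eta>) has_real_derivative D) (at \<theta>) \<and> \<bar>D\<bar> \<le> B / \<theta>"
proof (intro exI conjI)
  let ?F = "\<lambda>J. walsh f 1 (\<lambda>_. 0) J \<eta>"
  let ?D = "\<Sum>x\<in>{1..N}. bern ({1..N} - {x}) \<theta> (\<lambda>J. ?F (insert x J) - ?F J)"
  show "((\<lambda>\<theta>. noise N \<theta> f \<eta>) has_real_derivative ?D) (at \<theta>)"
    unfolding noise_def by (rule Russo_formula) simp
  have "\<bar>?F (insert x J) - ?F J\<bar> \<le> u x (insert x J)" if "x \<in> {1..N}" "J \<subseteq> {1..N} - {x}" for x J
  proof -
    have J: "finite J" "x \<notin> J" using that by (auto intro: finite_subset)
    have ins: "?F (insert x J) = (walsh f 1 (\<lambda>_. 0) J (\<eta>(x := 1)) + walsh f 1 (\<lambda>_. 0) J (\<eta>(x := 0))) / 2"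
      using walsh_insert[OF J, of f 1 "\<lambda>_. 0" \<eta>] by simp
    have "\<eta> x = 0 \<or> \<eta> x = 1" using \<eta> that(1) by (auto simp: configs_def PiE_iff)
    then have "\<eta> = \<eta>(x := 1) \<or> \<eta> = \<eta>(x := 0)" by (metis fun_upd_triv)
    then have "?F J = walsh f 1 (\<lambda>_. 0) J (\<eta>(x := 1)) \<or> ?F J = walsh f 1 (\<lambda>_. 0) J (\<eta>(x := 0))" by metis
    then have "\<bar>?F (insert x J) - ?F J\<bar> = \<bar>walsh f 0 (unit_at x) (insert x J) \<eta>\<bar>"
      unfolding ins walsh_insert_unit[OF J] by (elim disjE) (simp_all add: abs_if field_simps)
    also have "\<dots> \<le> u x (insert x J)" using that by (intro u) auto
    finally show ?thesis .
  qed
  then have "\<bar>?D\<bar> \<le> (\<Sum>x\<in>{1..N}. bern ({1..N} - {x}) \<theta> (\<lambda>J. u x (insert x J)))"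
    using \<theta> by (intro order_trans[OF sum_abs] sum_mono order_trans[OF bern_abs] bern_mono) auto
  also have "\<dots> = bern {1..N} \<theta> (\<lambda>J. \<Sum>x\<in>J. u x J) / \<theta>"
    unfolding bern_marked[OF finite_atLeastAtMost, symmetric] using \<theta> by simp
  also have "\<dots> \<le> B / \<theta>" using B \<theta> by (intro divide_right_mono) auto
  finally show "\<bar>?D\<bar> \<le> B / \<theta>" .
qed

text \<open>Sites of \<open>J\<close> are hidden and the others are changed one at a time. The
  factor 2 appears because a Walsh coefficient is half of a difference.\<close>

lemma walsh_change_config:
  assumes u: "\<And>x J \<eta>. J \<subseteq> {1..N} \<Longrightarrow> x \<in> J \<Longrightarrow> \<bar>walsh f 0 (unit_at x) J \<eta>\<bar> \<le> u x J"
    and J: "J \<subseteq> {1..N}" and S: "finite S" "S \<subseteq> {1..N}"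
    and bin: "\<And>i. i \<in> S \<Longrightarrow> \<eta> i \<in> {0, 1}" "\<And>i. i \<in> S \<Longrightarrow> \<zeta> i \<in> {0, 1}"
    and eq: "\<And>i. i \<notin> S \<Longrightarrow> \<eta> i = \<zeta> i"
  shows "\<bar>walsh f 1 (\<lambda>_. 0) J \<eta> - walsh f 1 (\<lambda>_. 0) J \<zeta>\<bar> \<le> 2 * (\<Sum>k\<in>S - J. u k (insert k J))"
  using S bin eq
proof (induction S arbitrary: \<eta> rule: finite_induct)
  case empty
  then have "\<eta> = \<zeta>" by auto
  then show ?case by simp
next
  case (insert k S)
  let ?W = "\<lambda>\<eta>. walsh f 1 (\<lambda>_. 0) J \<eta>"
  let ?\<eta> = "\<eta>(k := \<zeta> k)"
  have finJ: "finite J" using J by (rule finite_subset) simp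
  have IH: "\<bar>?W ?\<eta> - ?W \<zeta>\<bar> \<le> 2 * (\<Sum>k\<in>S - J. u k (insert k J))"
    by (rule insert.IH) (use insert.prems insert.hyps in auto)
  show ?case
  proof (cases "k \<in> J")
    case True
    then have "coin_cfg J B ?\<eta> = coin_cfg J B \<eta>" for B by (auto simp: coin_cfg_def fun_eq_iff)
    then have "?W ?\<eta> = ?W \<eta>" by (simp add: walsh_def)
    moreover have "insert k S - J = S - J" using True by auto
    ultimately show ?thesis using IH by simp
  next
    case False
    have bk: "\<eta> k \<in> {0, 1}" "\<zeta> k \<in> {0, 1}" using insert.prems by auto
    have "\<bar>?W (\<eta>(k := 1)) - ?W (\<eta>(k := 0))\<bar> = 2 * \<bar>walsh f 0 (unit_at k) (insert k J) \<eta>\<bar>"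
      unfolding walsh_insert_unit[OF finJ False] by simp
    also have "\<dots> \<le> 2 * u k (insert k J)"
      using u[of "insert k J" k \<eta>] J insert.prems(1) by auto
    finally have le: "\<bar>?W (\<eta>(k := 1)) - ?W (\<eta>(k := 0))\<bar> \<le> 2 * u k (insert k J)" .
    have "\<bar>?W \<eta> - ?W ?\<eta>\<bar> \<le> 2 * u k (insert k J)"
    proof (cases "\<eta> k = \<zeta> k")
      case True
      then have "?\<eta> = \<eta>" by auto
      then show ?thesis using le by simp
    next
      case False
      consider "\<eta> k = 0" "\<zeta> k = 1" | "\<eta> k = 1" "\<zeta> k = 0" using bk False by auto
      then show ?thesis
      proof cases
        case 1
        then have "\<eta>(k := 0) = \<eta>" by auto
        then show ?thesis using le 1 by (simp only: abs_minus_commute)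
      next
        case 2
        then have "\<eta>(k := 1) = \<eta>" by auto
        then show ?thesis using le 2 by simp
      qed
    qed
    moreover have "(\<Sum>k\<in>insert k S - J. u k (insert k J)) = u k (insert k J) + (\<Sum>k\<in>S - J. u k (insert k J))"
      using False insert.hyps by (simp add: insert_Diff_if)
    ultimately show ?thesis using IH by (simp add: algebra_simps) 
  qed
qed

text \<open>After randomization the configurations differ only outside \<open>J\<close>; each such
  site, once added to \<open>J\<close>, becomes a tag.\<close>

lemma noise_oscillation:
  assumes u: "\<And>x J \<eta>. J \<subseteq> {1..N} \<Longrightarrow> x \<in> J \<Longrightarrow> \<bar>walsh f 0 (unit_at x) J \<eta>\<bar> \<le> u x J"
    and \<alpha>: "0 < \<alpha>" "\<alpha> \<le> 1" and \<eta>: "\<eta> \<in> configs N" "\<zeta> \<in> configs N"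
    and B: "bern {1..N} \<alpha> (\<lambda>J. \<Sum>x\<in>J. u x J) \<le> B"
  shows "\<bar>noise N \<alpha> f \<eta> - noise N \<alpha> f \<zeta>\<bar> \<le> 2 * B / \<alpha>"
proof -
  let ?E = "bern {1..N} \<alpha>"
  have u0: "0 \<le> u x J" if "J \<subseteq> {1..N}" "x \<in> J" for x J
    using order_trans[OF abs_ge_zero u[OF that]] .
  have "\<bar>noise N \<alpha> f \<eta> - noise N \<alpha> f \<zeta>\<bar> = \<bar>?E (\<lambda>J. walsh f 1 (\<lambda>_. 0) J \<eta> - walsh f 1 (\<lambda>_. 0) J \<zeta>)\<bar>"
    by (simp add: noise_def bern_diff)
  also have "\<dots> \<le> ?E (\<lambda>J. \<bar>walsh f 1 (\<lambda>_. 0) J \<eta> - walsh f 1 (\<lambda>_. 0) J \<zeta>\<bar>)"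
    using \<alpha> by (intro bern_abs) auto
  also have "\<dots> \<le> ?E (\<lambda>J. 2 * (\<Sum>k\<in>{1..N}. of_bool (k \<notin> J) * u k (insert k J)))"
  proof (intro bern_mono)
    fix J assume J: "J \<subseteq> {1..N}"
    have "\<bar>walsh f 1 (\<lambda>_. 0) J \<eta> - walsh f 1 (\<lambda>_. 0) J \<zeta>\<bar> \<le> 2 * (\<Sum>k\<in>{1..N} - J. u k (insert k J))"
      by (rule walsh_change_config[OF u J]) (use \<eta> in \<open>auto simp: configs_def PiE_iff extensional_def\<close>)
    also have "(\<Sum>k\<in>{1..N} - J. u k (insert k J)) = (\<Sum>k\<in>{1..N}. of_bool (k \<notin> J) * u k (insert k J))"
      by (rule sum.mono_neutral_cong_left) auto
    finally show "\<bar>walsh f 1 (\<lambda>_. 0) J \<eta> - walsh f 1 (\<lambda>_. 0) J \<zeta>\<bar> \<le> 2 * \<dots>" .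
  qed (use \<alpha> in auto)
  also have "\<dots> = 2 * (\<Sum>k\<in>{1..N}. ?E (\<lambda>J. of_bool (k \<notin> J) * u k (insert k J)))"
    by (simp only: bern_mult bern_sum)
  also have "\<dots> \<le> 2 * (\<Sum>k\<in>{1..N}. bern ({1..N} - {k}) \<alpha> (\<lambda>J. u k (insert k J)))"
  proof (intro mult_left_mono sum_mono)
    fix k assume k: "k \<in> {1..N}"
    have "?E (\<lambda>J. of_bool (k \<notin> J) * u k (insert k J)) = bern ({1..N} - {k}) \<alpha> (\<lambda>J. (1 - \<alpha>) * u k (insert k J))"
      unfolding bern_remove[OF finite_atLeastAtMost k] by (rule bern_cong) auto
    also have "\<dots> \<le> bern ({1..N} - {k}) \<alpha> (\<lambda>J. u k (insert k J))"
    proof (intro bern_mono)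
      fix J assume "J \<subseteq> {1..N} - {k}"
      then have "0 \<le> u k (insert k J)" using k by (intro u0) auto
      then show "(1 - \<alpha>) * u k (insert k J) \<le> u k (insert k J)" using \<alpha> by (intro mult_left_le_one_le) auto
    qed (use \<alpha> in auto)
    finally show "?E (\<lambda>J. of_bool (k \<notin> J) * u k (insert k J)) \<le> \<dots>" .
  qed simp
  also have "\<dots> = 2 * (?E (\<lambda>J. \<Sum>x\<in>J. u x J) / \<alpha>)"
    unfolding bern_marked[OF finite_atLeastAtMost, symmetric] using \<alpha> by simp
  also have "\<dots> \<le> 2 * (B / \<alpha>)" using B \<alpha> by (intro mult_left_mono divide_right_mono) auto
  finally show ?thesis by simp
qed

text \<open>
  In the variable \<open>\<tau> = sqrt \<theta>\<close> the derivative of the noise operator stays bounded as \<open>\<theta>\<close> tends to \<open>0\<close>.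
\<close>

lemma skel_oscillation:
  assumes f: "\<And>\<zeta>. \<bar>f \<zeta>\<bar> \<le> 1" and N: "N \<ge> 2"
    and \<alpha>: "0 < \<alpha>" "\<alpha> / 2 \<le> p" "\<alpha> / 2 \<le> 1 - p" "\<alpha> / 2 \<le> q" "\<alpha> / 2 \<le> 1 - q"
    and \<eta>: "\<eta> \<in> configs N" "\<zeta> \<in> configs N"
  shows "\<bar>(skel N p q ^^ (m + 16 * N ^ 3)) f \<eta> - (skel N p q ^^ (m + 16 * N ^ 3)) f \<zeta>\<bar>
    \<le> 48 / sqrt \<alpha> * sqrt (real N) * skappa N ^ m"
proof -
  define g where "g = (skel N p q ^^ (m + 16 * N ^ 3)) f"
  define K where "K = sqrt (real N) * skappa N ^ m"
  have K0: "0 \<le> K" using skappa_nonneg[OF N] by (simp add: K_def)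
  have \<alpha>1: "\<alpha> \<le> 1" using \<alpha> by linarith
  have cancel: "c * sqrt (\<theta> * s) * k / \<theta> = c * (sqrt s * k) / sqrt \<theta>" if "0 < \<theta>" for \<theta> s k c :: real
  proof -
    have "c * (sqrt \<theta> * sqrt s) * k / (sqrt \<theta> * sqrt \<theta>) = c * (sqrt s * k) / sqrt \<theta>"
      using that by (simp add: divide_simps)
    then show ?thesis using that by (simp add: real_sqrt_mult)
  qed
  have near: "\<bar>noise N \<alpha> g \<xi> - g \<xi>\<bar> \<le> 16 * K" if \<xi>: "\<xi> \<in> configs N" for \<xi>
  proof -
    have D: "\<exists>D. ((\<lambda>\<theta>. noise N \<theta> g \<xi>) has_real_derivative D) (at \<theta>) \<and> \<bar>D\<bar> \<le> 8 * K / sqrt \<theta>"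
      if \<theta>: "0 < \<theta>" "\<theta> \<le> \<alpha>" for \<theta>
    proof -
      obtain u where u: "\<And>x J \<eta>. J \<subseteq> {1..N} \<Longrightarrow> x \<in> J \<Longrightarrow> \<bar>walsh g 0 (unit_at x) J \<eta>\<bar> \<le> u x J"
        "bern {1..N} \<theta> (\<lambda>J. \<Sum>x\<in>J. u x J) \<le> 8 * sqrt (\<theta> * real N) * skappa N ^ m"
      proof -
        \<comment> \<open>The reservoirs are used with coin probability \<open>\<theta>\<close>, not
          \<open>\<alpha>\<close>: it has to equal the density of the initial coins for the
          environment to be in equilibrium.\<close>
        have "\<theta> / 2 \<le> p" "\<theta> / 2 \<le> 1 - p" "\<theta> / 2 \<le> q" "\<theta> / 2 \<le> 1 - q" using \<theta> \<alpha> by auto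
        from gradient_bound[where f = f and m = m, OF f N \<theta>(1) this, folded g_def] show thesis
          by (elim exE conjE) (rule that, blast, assumption)
      qed
      have \<theta>1: "\<theta> \<le> 1" using \<theta> \<alpha>1 by simp
      have "8 * sqrt (\<theta> * real N) * skappa N ^ m / \<theta> = 8 * K / sqrt \<theta>"
        unfolding K_def by (rule cancel[OF \<theta>(1)])
      then show ?thesis
        using noise_derivative_bound[OF u(1) \<theta>(1) \<theta>1 \<xi> u(2)] by simp
    qed
    let ?k = "\<lambda>\<tau>. noise N (\<tau>\<^sup>2) g \<xi>"
    have cont: "continuous_on {0..sqrt \<alpha>} ?k"
      unfolding noise_def bern_def by (intro continuous_intros)
    have dk: "\<exists>D. (?k has_real_derivative D) (at \<tau>) \<and> \<bar>D\<bar> \<le> 16 * K" if \<tau>: "0 < \<tau>" "\<tau> < sqrt \<alpha>" for \<tau>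
    proof -
      have "\<tau>\<^sup>2 \<le> (sqrt \<alpha>)\<^sup>2" using \<tau> by (intro power_mono) auto
      then have "0 < \<tau>\<^sup>2" "\<tau>\<^sup>2 \<le> \<alpha>" using \<tau> \<alpha> by auto
      from D[OF this] obtain D where D: "((\<lambda>\<theta>. noise N \<theta> g \<xi>) has_real_derivative D) (at (\<tau>\<^sup>2))"
        "\<bar>D\<bar> \<le> 8 * K / sqrt (\<tau>\<^sup>2)" by auto
      have "((\<lambda>\<tau>. \<tau>\<^sup>2) has_real_derivative 2 * \<tau>) (at \<tau>)" by (auto intro!: derivative_eq_intros)
      then have "(?k has_real_derivative D * (2 * \<tau>)) (at \<tau>)" by (rule DERIV_chain2[where f = "\<lambda>\<theta>. noise N \<theta> g \<xi>" and g = "\<lambda>\<tau>. \<tau>\<^sup>2", OF D(1)])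
      moreover have "\<bar>D * (2 * \<tau>)\<bar> \<le> 16 * K"
      proof -
        have "\<bar>D * (2 * \<tau>)\<bar> = \<bar>D\<bar> * (2 * \<tau>)" using \<tau> by (simp add: abs_mult)
        also have "\<dots> \<le> 8 * K / \<tau> * (2 * \<tau>)" using D(2) \<tau> by (intro mult_right_mono) auto
        also have "\<dots> = 16 * K" using \<tau> by simp
        finally show ?thesis .
      qed
      ultimately show ?thesis by blast
    qed
    have "0 < sqrt \<alpha>" using \<alpha> by simp
    moreover have "?k differentiable (at \<tau>)" if "0 < \<tau>" "\<tau> < sqrt \<alpha>" for \<tau>
      using dk[OF that] by (auto simp: real_differentiable_def)
    ultimately have "\<exists>l z. 0 < z \<and> z < sqrt \<alpha> \<and> (?k has_real_derivative l) (at z) \<and>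
        ?k (sqrt \<alpha>) - ?k 0 = (sqrt \<alpha> - 0) * l"
      using cont by (intro MVT)
    then obtain l z where z: "0 < z" "z < sqrt \<alpha>" "(?k has_real_derivative l) (at z)"
      "?k (sqrt \<alpha>) - ?k 0 = (sqrt \<alpha> - 0) * l" by blast
    from dk[OF z(1,2)] z(3) have "\<bar>l\<bar> \<le> 16 * K" using DERIV_unique by blast
    then have "\<bar>sqrt \<alpha> * l\<bar> \<le> 1 * (16 * K)"
      unfolding abs_mult using \<alpha> \<alpha>1 K0 by (intro mult_mono) auto
    then have "\<bar>?k (sqrt \<alpha>) - ?k 0\<bar> \<le> 16 * K" using z(4) by simp
    then show ?thesis using \<alpha> by (simp add: noise_def bern_0)
  qed
  have far: "\<bar>noise N \<alpha> g \<eta> - noise N \<alpha> g \<zeta>\<bar> \<le> 16 * K / sqrt \<alpha>"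
  proof -
    obtain u where u: "\<And>x J \<eta>. J \<subseteq> {1..N} \<Longrightarrow> x \<in> J \<Longrightarrow> \<bar>walsh g 0 (unit_at x) J \<eta>\<bar> \<le> u x J"
      "bern {1..N} \<alpha> (\<lambda>J. \<Sum>x\<in>J. u x J) \<le> 8 * sqrt (\<alpha> * real N) * skappa N ^ m"
      using gradient_bound[where f = f and m = m, OF f N \<alpha>, folded g_def] by (elim exE conjE) (rule that, blast, assumption)
    have "\<bar>noise N \<alpha> g \<eta> - noise N \<alpha> g \<zeta>\<bar> \<le> 2 * (8 * sqrt (\<alpha> * real N) * skappa N ^ m) / \<alpha>"
      by (rule noise_oscillation[OF u(1) \<alpha>(1) \<alpha>1 \<eta> u(2)])
    also have "\<dots> = 16 * K / sqrt \<alpha>"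
      using cancel[OF \<alpha>(1), of 16 "real N" "skappa N ^ m"] by (simp add: K_def)
    finally show ?thesis .
  qed
  have "\<bar>g \<eta> - g \<zeta>\<bar> \<le> 32 * K + 16 * K / sqrt \<alpha>"
    using near[OF \<eta>(1)] near[OF \<eta>(2)] far by linarith
  \<comment> \<open>\<open>K \<le> K / sqrt \<alpha>\<close> merges the three contributions into the
    constant 48.\<close>
  also have "\<dots> \<le> 32 * (K / sqrt \<alpha>) + 16 * K / sqrt \<alpha>"
    using \<alpha> \<alpha>1 K0 by (intro add_right_mono mult_left_mono) (auto simp: field_simps mult_left_le)
  finally show ?thesis by (simp add: g_def K_def mult_ac)
qed

subsection \<open>Uniformization\<close>

lemma configs_nswap: "\<eta> \<in> configs N \<Longrightarrow> e \<in> {1..<N} \<Longrightarrow> \<eta> \<circ> nswap e \<in> configs N"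
  by (auto simp: configs_def PiE_iff extensional_def nswap_def)

lemma configs_upd: "\<eta> \<in> configs N \<Longrightarrow> i \<in> {1..N} \<Longrightarrow> v \<in> {0, 1} \<Longrightarrow> \<eta>(i := v) \<in> configs N"
  by (auto simp: configs_def PiE_iff extensional_def)

lemma configs_nonempty: "restrict (\<lambda>_. 0) {1..N} \<in> configs N"
  by (auto simp: configs_def)

definition pois :: "real \<Rightarrow> nat \<Rightarrow> real" where
  "pois r n = exp (- r) * r ^ n / fact n"

lemma pois_nonneg: "0 \<le> r \<Longrightarrow> 0 \<le> pois r n"
  by (simp add: pois_def)

text \<open>The Poisson generating function turns a ratio \<open>k\<close> per step into an
  exponential rate proportional to \<open>1 - k\<close> in time.\<close>

lemma pois_sums: "(\<lambda>n. pois r n * k ^ n) sums exp (- (r * (1 - k)))"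
proof -
  have "(\<lambda>n. (r * k) ^ n /\<^sub>R fact n) sums exp (r * k)" by (rule exp_converges)
  then have "(\<lambda>n. exp (- r) * ((r * k) ^ n /\<^sub>R fact n)) sums (exp (- r) * exp (r * k))"
    by (rule sums_mult)
  moreover have "exp (- r) * ((r * k) ^ n /\<^sub>R fact n) = pois r n * k ^ n" for n
    by (simp add: pois_def power_mult_distrib field_simps)
  moreover have "exp (- r) * exp (r * k) = exp (- (r * (1 - k)))"
    by (simp add: exp_add[symmetric] algebra_simps)
  ultimately show ?thesis by simp
qed

lemma pois_sums_1: "pois r sums 1"
  using pois_sums[of r 1] by simp

lemma exponential_tendsto_0:
  fixes c k :: real
  assumes "1 \<le> N" "k < 1"
  shows "((\<lambda>t. c * exp (- (2 * real N ^ 3 * t * (1 - k)))) \<longlongrightarrow> 0) at_top"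
proof -
  have "0 < 2 * real N ^ 3 * (1 - k)" using assms by simp
  then have "filterlim (\<lambda>t. - (2 * real N ^ 3 * (1 - k)) * t) at_bot at_top"
    by (intro filterlim_tendsto_neg_mult_at_bot[OF tendsto_const _ filterlim_ident]) simp
  then have "((\<lambda>t. exp (- (2 * real N ^ 3 * (1 - k)) * t)) \<longlongrightarrow> 0) at_top"
    by (rule filterlim_compose[OF exp_at_bot])
  then have "((\<lambda>t. c * exp (- (2 * real N ^ 3 * (1 - k)) * t)) \<longlongrightarrow> c * 0) at_top"
    by (rule tendsto_mult_left)
  then show ?thesis by (simp add: mult_ac)
qed

lemma skel_lin: "skel N p q (\<lambda>\<eta>. a * f \<eta> + b * g \<eta>) \<eta> = a * skel N p q f \<eta> + b * skel N p q g \<eta>"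
proof -
  have "(\<Sum>e\<in>{1..<N}. bond e (\<lambda>\<eta>. a * f \<eta> + b * g \<eta>) \<eta>) = a * (\<Sum>e\<in>{1..<N}. bond e f \<eta>) + b * (\<Sum>e\<in>{1..<N}. bond e g \<eta>)"
    unfolding sum_distrib_left sum.distrib[symmetric]
    by (intro sum.cong) (auto simp: bond_def add_divide_distrib algebra_simps)
  moreover have "resv i r (\<lambda>\<eta>. a * f \<eta> + b * g \<eta>) \<eta> = a * resv i r f \<eta> + b * resv i r g \<eta>" for i r
    by (simp add: resv_def algebra_simps)
  ultimately show ?thesis
    unfolding skel_def by (simp add: add_divide_distrib distrib_left)
qed

lemma skel_sum: "skel N p q (\<lambda>\<eta>. \<Sum>x\<in>X. g x * f x \<eta>) \<eta> = (\<Sum>x\<in>X. g x * skel N p q (f x) \<eta>)"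
proof (induction X rule: infinite_finite_induct)
  case (insert x X)
  then show ?case using skel_lin[of N p q "g x" "f x" 1 "\<lambda>\<eta>. \<Sum>x\<in>X. g x * f x \<eta>"] by simp
qed (simp_all add: skel_def bond_def resv_def)

lemma skel_power_sum: "(skel N p q ^^ n) (\<lambda>\<eta>. \<Sum>x\<in>X. g x * f x \<eta>) \<eta> = (\<Sum>x\<in>X. g x * (skel N p q ^^ n) (f x) \<eta>)"
proof (induction n arbitrary: \<eta>)
  case (Suc n)
  then have "(skel N p q ^^ n) (\<lambda>\<eta>. \<Sum>x\<in>X. g x * f x \<eta>) = (\<lambda>\<eta>. \<Sum>x\<in>X. g x * (skel N p q ^^ n) (f x) \<eta>)"
    by (intro ext)
  then show ?case by (simp add: skel_sum)
qed simp

context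
  fixes N :: nat and p q :: real
  assumes N1: "1 \<le> N" and p01: "0 \<le> p" "p \<le> 1" and q01: "0 \<le> q" "q \<le> 1"
begin

lemma skel_const: "skel N p q (\<lambda>_. c) \<eta> = c"
  using N1 by (simp add: skel_def bond_def resv_def of_nat_diff field_simps)

lemma skel_mono:
  assumes "\<And>\<zeta>. \<zeta> \<in> configs N \<Longrightarrow> f \<zeta> \<le> g \<zeta>" "\<eta> \<in> configs N"
  shows "skel N p q f \<eta> \<le> skel N p q g \<eta>"
proof -
  have "bond e f \<eta> \<le> bond e g \<eta>" if "e \<in> {1..<N}" for e
    unfolding bond_def using assms configs_nswap[OF assms(2) that] by (intro divide_right_mono add_mono) auto
  moreover have "resv i r f \<eta> \<le> resv i r g \<eta>" if "i \<in> {1..N}" "0 \<le> r" "r \<le> 1" for i r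
    unfolding resv_def using that assms configs_upd[OF assms(2) that(1)]
    by (intro add_mono mult_left_mono) auto
  ultimately show ?thesis
    unfolding skel_def using N1 p01 q01 by (intro divide_right_mono add_mono sum_mono) auto
qed

lemma skel_power_const: "(skel N p q ^^ n) (\<lambda>_. c) \<eta> = c"
proof (induction n arbitrary: \<eta>)
  case (Suc n)
  then have "(skel N p q ^^ n) (\<lambda>_. c) = (\<lambda>_. c)" by (intro ext)
  then show ?case by (simp add: skel_const)
qed simp

lemma skel_power_mono:
  assumes "\<And>\<zeta>. \<zeta> \<in> configs N \<Longrightarrow> f \<zeta> \<le> g \<zeta>" "\<eta> \<in> configs N"
  shows "(skel N p q ^^ n) f \<eta> \<le> (skel N p q ^^ n) g \<eta>"
  using assms(2)
proof (induction n arbitrary: \<eta>)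
  case 0
  then show ?case using assms(1) by simp
next
  case (Suc n)
  then show ?case using skel_mono[of "(skel N p q ^^ n) f" "(skel N p q ^^ n) g"] by simp
qed

lemma skel_power_cong:
  assumes "\<And>\<zeta>. \<zeta> \<in> configs N \<Longrightarrow> f \<zeta> = g \<zeta>" "\<eta> \<in> configs N"
  shows "(skel N p q ^^ n) f \<eta> = (skel N p q ^^ n) g \<eta>"
  using assms by (intro antisym skel_power_mono) auto

lemma skel_power_abs_le:
  assumes "\<And>\<zeta>. \<zeta> \<in> configs N \<Longrightarrow> \<bar>f \<zeta>\<bar> \<le> M" "\<eta> \<in> configs N"
  shows "\<bar>(skel N p q ^^ n) f \<eta>\<bar> \<le> M"
proof -
  have b: "- M \<le> f \<zeta>" "f \<zeta> \<le> M" if "\<zeta> \<in> configs N" for \<zeta>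
    using assms(1)[OF that] by linarith+
  have "(skel N p q ^^ n) f \<eta> \<le> (skel N p q ^^ n) (\<lambda>_. M) \<eta>"
    by (intro skel_power_mono b assms(2))
  moreover have "(skel N p q ^^ n) (\<lambda>_. - M) \<eta> \<le> (skel N p q ^^ n) f \<eta>"
    by (intro skel_power_mono b assms(2))
  ultimately show ?thesis by (simp add: skel_power_const)
qed

text \<open>The binomial formula for the generator \<open>R * (Q - 1)\<close> with
  \<open>R = 2 * N^3\<close>, arranged as a coefficient of a Cauchy product of two exponential
  series.\<close>

lemma generator_power_skel:
  "(ssep_generator N p q ^^ n) f \<eta> =
     fact n * (\<Sum>k\<le>n. (2 * real N ^ 3) ^ k / fact k * (skel N p q ^^ k) f \<eta> * ((- (2 * real N ^ 3)) ^ (n - k) / fact (n - k)))"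
proof (induction n arbitrary: \<eta>)
  case (Suc n)
  define R where "R = 2 * real N ^ 3"
  let ?Q = "skel N p q"
  define T where "T n \<eta> = (\<Sum>k\<le>n. R ^ k / fact k * ((- R) ^ (n - k) / fact (n - k)) * (?Q ^^ k) f \<eta>)" for n \<eta>
  have "(ssep_generator N p q ^^ n) f = (\<lambda>\<eta>. fact n * T n \<eta>)"
    using Suc.IH by (intro ext) (simp add: T_def R_def mult_ac)
  \<comment> \<open>The summand \<open>0 * 0\<close> only gives the function the shape required by
    \<open>skel_lin\<close>.\<close>
  then have "(ssep_generator N p q ^^ Suc n) f \<eta> = R * (?Q (\<lambda>\<eta>. fact n * T n \<eta> + 0 * 0) \<eta> - fact n * T n \<eta>)"
    by (simp add: ssep_generator_skel[OF N1] R_def)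
  also have "?Q (\<lambda>\<eta>. fact n * T n \<eta> + 0 * 0) \<eta> = fact n * ?Q (T n) \<eta>"
    using skel_lin[of N p q "fact n" "T n" 0 "\<lambda>_. 0" \<eta>] by simp
  also have "?Q (T n) \<eta> = (\<Sum>k\<le>n. R ^ k / fact k * ((- R) ^ (n - k) / fact (n - k)) * (?Q ^^ Suc k) f \<eta>)"
    unfolding T_def by (subst skel_sum) simp
  finally have 1: "(ssep_generator N p q ^^ Suc n) f \<eta> =
     fact n * (R * (\<Sum>k\<le>n. R ^ k / fact k * ((- R) ^ (n - k) / fact (n - k)) * (?Q ^^ Suc k) f \<eta>) + (- R) * T n \<eta>)"
    by (simp add: algebra_simps)
  let ?a = "\<lambda>k. R ^ k / fact k * ((- R) ^ (Suc n - k) / fact (Suc n - k)) * (?Q ^^ k) f \<eta>"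
  \<comment> \<open>Writing \<open>Suc n\<close> as \<open>k + (Suc n - k)\<close> splits the
    coefficient into the part where one more \<open>R * Q\<close> acts and the part where one more
    \<open>- R\<close> acts.\<close>
  have "real (Suc n) * T (Suc n) \<eta> = (\<Sum>k\<le>Suc n. real k * ?a k + real (Suc n - k) * ?a k)"
  proof -
    have "real (Suc n) * ?a k = real k * ?a k + real (Suc n - k) * ?a k" if "k \<le> Suc n" for k
      unfolding distrib_right[symmetric] of_nat_add[symmetric] using that by simp
    then show ?thesis unfolding T_def sum_distrib_left by (intro sum.cong) auto
  qed
  also have "\<dots> = (\<Sum>k\<le>Suc n. real k * ?a k) + (\<Sum>k\<le>Suc n. real (Suc n - k) * ?a k)"
    by (rule sum.distrib)
  also have "(\<Sum>k\<le>Suc n. real k * ?a k) = (\<Sum>k\<le>n. real (Suc k) * ?a (Suc k))"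
    by (subst sum.atMost_Suc_shift) simp
  also have "\<dots> = R * (\<Sum>k\<le>n. R ^ k / fact k * ((- R) ^ (n - k) / fact (n - k)) * (?Q ^^ Suc k) f \<eta>)"
    unfolding sum_distrib_left by (intro sum.cong refl) (simp add: field_simps del: of_nat_Suc funpow.simps)
  also have "(\<Sum>k\<le>Suc n. real (Suc n - k) * ?a k) = (\<Sum>k\<le>n. real (Suc n - k) * ?a k)"
    by simp
  also have "\<dots> = (- R) * T n \<eta>"
    unfolding T_def sum_distrib_left
    by (intro sum.cong refl) (simp add: Suc_diff_le field_simps del: of_nat_Suc)
  finally have 2: "R * (\<Sum>k\<le>n. R ^ k / fact k * ((- R) ^ (n - k) / fact (n - k)) * (?Q ^^ Suc k) f \<eta>) + (- R) * T n \<eta>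
      = real (Suc n) * T (Suc n) \<eta>" by simp
  have "(ssep_generator N p q ^^ Suc n) f \<eta> = fact (Suc n) * T (Suc n) \<eta>"
    unfolding 1 2 by (simp add: mult_ac)
  then show ?case by (simp add: T_def R_def mult_ac)
qed simp

text \<open>The identity commutes with \<open>skel\<close>, so the exponential factorizes as
  \<open>exp (- R * t)\<close> times the exponential of \<open>R * t * Q\<close>: the number of
  steps is Poisson.\<close>

lemma semigroup_skel:
  assumes \<eta>: "\<eta> \<in> configs N"
  shows "(\<lambda>n. pois (2 * real N ^ 3 * t) n * (skel N p q ^^ n) f \<eta>) sums
    markov_semigroup (ssep_generator N p q) t f \<eta>"
proof -
  define r where "r = 2 * real N ^ 3 * t"
  define M where "M = (\<Sum>\<zeta>\<in>configs N. \<bar>f \<zeta>\<bar>)"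
  have M: "\<bar>(skel N p q ^^ n) f \<eta>\<bar> \<le> M" for n
    unfolding M_def using finite_configs by (intro skel_power_abs_le \<eta> member_le_sum) auto
  let ?a = "\<lambda>k. r ^ k / fact k * (skel N p q ^^ k) f \<eta>"
  let ?b = "\<lambda>k. (- r) ^ k / fact k :: real"
  have suma: "summable (\<lambda>k. norm (?a k))"
  proof (rule summable_comparison_test'[where N = 0])
    have "summable (\<lambda>k. \<bar>r\<bar> ^ k /\<^sub>R fact k)" by (rule sums_summable[OF exp_converges])
    then show "summable (\<lambda>k. \<bar>r\<bar> ^ k /\<^sub>R fact k * M)" by (rule summable_mult2)
    fix n
    have "norm (norm (?a n)) = \<bar>r\<bar> ^ n / fact n * \<bar>(skel N p q ^^ n) f \<eta>\<bar>"
      by (simp add: abs_mult power_abs)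
    also have "\<dots> \<le> \<bar>r\<bar> ^ n / fact n * M" by (intro mult_left_mono M) auto
    finally show "norm (norm (?a n)) \<le> \<bar>r\<bar> ^ n /\<^sub>R fact n * M" by (simp add: field_simps)
  qed
  have sumb: "summable (\<lambda>k. norm (?b k))"
  proof -
    have "summable (\<lambda>k. \<bar>r\<bar> ^ k /\<^sub>R fact k)" by (rule sums_summable[OF exp_converges])
    then show ?thesis by (simp add: power_abs field_simps)
  qed
  have eb: "(\<Sum>k. ?b k) = exp (- r)"
    using sums_unique[OF exp_converges[of "- r"]] by (simp add: field_simps)
  have term_eq: "t ^ n / fact n * (ssep_generator N p q ^^ n) f \<eta> = (\<Sum>i\<le>n. ?a i * ?b (n - i))" for n
    unfolding generator_power_skel sum_distrib_left
  proof (intro sum.cong refl)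
    fix k assume "k \<in> {..n}"
    then have "t ^ n = t ^ k * t ^ (n - k)" by (simp add: power_add[symmetric])
    moreover have "(- r) ^ j = (- (2 * real N ^ 3)) ^ j * t ^ j" for j
      unfolding r_def power_mult_distrib[symmetric] by simp
    ultimately show "t ^ n / fact n * (fact n * ((2 * real N ^ 3) ^ k / fact k * (skel N p q ^^ k) f \<eta> * ((- (2 * real N ^ 3)) ^ (n - k) / fact (n - k))))
       = ?a k * ?b (n - k)"
      by (simp add: r_def power_mult_distrib)
  qed
  have "markov_semigroup (ssep_generator N p q) t f \<eta> = (\<Sum>k. ?a k) * exp (- r)"
    unfolding markov_semigroup_def term_eq eb[symmetric] by (rule Cauchy_product[OF suma sumb, symmetric])
  moreover have "(\<lambda>k. exp (- r) * ?a k) sums (exp (- r) * (\<Sum>k. ?a k))"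
    by (intro sums_mult summable_sums summable_norm_cancel[OF suma])
  moreover have "exp (- r) * ?a n = pois r n * (skel N p q ^^ n) f \<eta>" for n
    by (simp add: pois_def)
  ultimately show ?thesis by (simp add: r_def mult.commute)
qed

lemma semigroup_le_geometric:
  assumes "\<eta> \<in> configs N" "0 \<le> t" "\<And>n. (skel N p q ^^ n) f \<eta> \<le> a * k ^ n + b"
  shows "markov_semigroup (ssep_generator N p q) t f \<eta> \<le> a * exp (- (2 * real N ^ 3 * t * (1 - k))) + b"
proof (rule sums_le)
  let ?r = "2 * real N ^ 3 * t"
  show "(\<lambda>n. pois ?r n * (skel N p q ^^ n) f \<eta>) sums markov_semigroup (ssep_generator N p q) t f \<eta>"
    by (rule semigroup_skel[OF assms(1)])
  show "(\<lambda>n. a * (pois ?r n * k ^ n) + b * pois ?r n) sums (a * exp (- (?r * (1 - k))) + b)"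
    using sums_add[OF sums_mult[OF pois_sums[of ?r k], of a] sums_mult[OF pois_sums_1[of ?r], of b]] by simp
  have "0 \<le> ?r" using assms(2) by simp
  show "pois ?r n * (skel N p q ^^ n) f \<eta> \<le> a * (pois ?r n * k ^ n) + b * pois ?r n" for n
    using mult_left_mono[OF assms(3) pois_nonneg[OF \<open>0 \<le> ?r\<close>], of n n] by (simp add: algebra_simps)
qed

lemma semigroup_diff_geometric:
  assumes "\<eta> \<in> configs N" "\<zeta> \<in> configs N" "0 \<le> t"
    "\<And>n. \<bar>(skel N p q ^^ n) f \<eta> - (skel N p q ^^ n) f \<zeta>\<bar> \<le> a * k ^ n"
  shows "\<bar>markov_semigroup (ssep_generator N p q) t f \<eta> - markov_semigroup (ssep_generator N p q) t f \<zeta>\<bar>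
    \<le> a * exp (- (2 * real N ^ 3 * t * (1 - k)))"
proof -
  let ?r = "2 * real N ^ 3 * t" and ?P = "markov_semigroup (ssep_generator N p q) t f"
  have r: "0 \<le> ?r" using assms(3) by simp
  have A: "(\<lambda>n. a * (pois ?r n * k ^ n)) sums (a * exp (- (?r * (1 - k))))"
    by (intro sums_mult pois_sums)
  have *: "?P \<xi> - ?P \<omega> \<le> a * exp (- (?r * (1 - k)))"
    if "\<xi> \<in> configs N" "\<omega> \<in> configs N" "\<And>n. (skel N p q ^^ n) f \<xi> - (skel N p q ^^ n) f \<omega> \<le> a * k ^ n" for \<xi> \<omega>
  proof (rule sums_le[OF _ sums_diff[OF semigroup_skel[OF that(1)] semigroup_skel[OF that(2)]] A])
    show "pois ?r n * (skel N p q ^^ n) f \<xi> - pois ?r n * (skel N p q ^^ n) f \<omega> \<le> a * (pois ?r n * k ^ n)" for n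
      using mult_left_mono[OF that(3)[of n] pois_nonneg[OF r]] by (simp add: algebra_simps)
  qed
  have "?P \<eta> - ?P \<zeta> \<le> a * exp (- (?r * (1 - k)))"
    using assms(4) by (intro * assms(1,2)) (auto simp: abs_le_iff)
  moreover have "?P \<zeta> - ?P \<eta> \<le> a * exp (- (?r * (1 - k)))"
    using assms(4) by (intro * assms(1,2)) (auto simp: abs_le_iff)
  ultimately show ?thesis by (simp add: abs_le_iff)
qed

subsection \<open>The invariant distribution\<close>

context
  fixes c k :: real
  assumes k: "0 \<le> k" "k < 1" and contr: "\<And>A \<eta> \<zeta> n. \<eta> \<in> configs N \<Longrightarrow> \<zeta> \<in> configs N \<Longrightarrow>
    \<bar>(skel N p q ^^ n) (indicator A) \<eta> - (skel N p q ^^ n) (indicator A) \<zeta>\<bar> \<le> c * k ^ n"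
begin

text \<open>After \<open>M\<close> steps the function is within \<open>c * k^M\<close> of a constant
  on all configurations, and further averaging cannot leave this range.\<close>

lemma skel_indicator_convergent:
  assumes \<eta>: "\<eta> \<in> configs N"
  shows "convergent (\<lambda>n. (skel N p q ^^ n) (indicator A) \<eta>)"
proof -
  let ?Q = "skel N p q" and ?f = "indicator A :: config \<Rightarrow> real"
  have lim0: "(\<lambda>n. c * k ^ n) \<longlonglongrightarrow> 0"
    using tendsto_mult_right_zero[OF LIMSEQ_power_zero, of k c] k by simp
  have "Cauchy (\<lambda>n. (?Q ^^ n) ?f \<eta>)"
  proof (rule metric_CauchyI)
    fix e :: real assume "0 < e"
    then obtain M where M: "\<And>n. n \<ge> M \<Longrightarrow> norm (c * k ^ n - 0) < e / 2"
      using LIMSEQ_D[OF lim0, of "e / 2"] by auto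
    have near: "\<bar>(?Q ^^ (j + M)) ?f \<eta> - (?Q ^^ M) ?f \<eta>\<bar> < e / 2" for j
    proof -
      let ?g = "(?Q ^^ M) ?f" and ?a = "(?Q ^^ M) ?f \<eta>"
      have "?g \<zeta> \<le> ?a + c * k ^ M \<and> ?a - c * k ^ M \<le> ?g \<zeta>" if "\<zeta> \<in> configs N" for \<zeta>
        using contr[OF \<eta> that, of M A] by (simp add: abs_le_iff)
      then have "(?Q ^^ j) ?g \<eta> \<le> (?Q ^^ j) (\<lambda>_. ?a + c * k ^ M) \<eta>" "(?Q ^^ j) (\<lambda>_. ?a - c * k ^ M) \<eta> \<le> (?Q ^^ j) ?g \<eta>"
        by (intro skel_power_mono \<eta>; simp)+
      then have "\<bar>(?Q ^^ (j + M)) ?f \<eta> - ?a\<bar> \<le> c * k ^ M"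
        by (simp add: skel_power_const funpow_add abs_le_iff)
      also have "\<dots> < e / 2" using M[of M] by simp
      finally show ?thesis .
    qed
    show "\<exists>M. \<forall>m\<ge>M. \<forall>n\<ge>M. dist ((?Q ^^ m) ?f \<eta>) ((?Q ^^ n) ?f \<eta>) < e"
    proof (intro exI allI impI)
      fix m n assume "M \<le> m" "M \<le> n"
      then have "\<bar>(?Q ^^ m) ?f \<eta> - (?Q ^^ M) ?f \<eta>\<bar> < e / 2" "\<bar>(?Q ^^ n) ?f \<eta> - (?Q ^^ M) ?f \<eta>\<bar> < e / 2"
        using near[of "m - M"] near[of "n - M"] by auto
      then show "dist ((?Q ^^ m) ?f \<eta>) ((?Q ^^ n) ?f \<eta>) < e" unfolding dist_real_def by linarith
    qed
  qed
  then show ?thesis by (rule Cauchy_convergent)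
qed

lemma law_difference:
  assumes "\<eta> \<in> configs N" "\<zeta> \<in> configs N" "0 \<le> t"
  shows "\<bar>law (ssep_generator N p q) t \<eta> A - law (ssep_generator N p q) t \<zeta> A\<bar>
    \<le> c * exp (- (2 * real N ^ 3 * t * (1 - k)))"
  unfolding law_def by (intro semigroup_diff_geometric assms contr)

lemma law_invariant_difference:
  assumes inv: "invariant_distribution (configs N) (ssep_generator N p q) \<mu>"
    and "\<eta> \<in> configs N" "0 \<le> t" "A \<subseteq> configs N"
  shows "\<bar>law (ssep_generator N p q) t \<eta> A - measure_pmf.prob \<mu> A\<bar> \<le> c * exp (- (2 * real N ^ 3 * t * (1 - k)))"
proof -
  let ?l = "\<lambda>\<eta>. law (ssep_generator N p q) t \<eta> A" and ?B = "c * exp (- (2 * real N ^ 3 * t * (1 - k)))"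
  have one: "(\<Sum>x\<in>configs N. pmf \<mu> x) = 1"
    using inv finite_configs by (intro sum_pmf_eq_1) (auto simp: invariant_distribution_def)
  have "measure_pmf.prob \<mu> A = (\<Sum>x\<in>configs N. pmf \<mu> x * ?l x)"
    using inv assms by (simp add: invariant_distribution_def)
  then have "?l \<eta> - measure_pmf.prob \<mu> A = (\<Sum>x\<in>configs N. pmf \<mu> x * (?l \<eta> - ?l x))"
    using one by (simp add: right_diff_distrib sum_subtractf sum_distrib_right[symmetric])
  also have "\<bar>\<dots>\<bar> \<le> (\<Sum>x\<in>configs N. pmf \<mu> x * ?B)"
    using assms
    by (intro order_trans[OF sum_abs] sum_mono) (auto simp: abs_mult intro!: mult_left_mono law_difference)
  also have "\<dots> = ?B" unfolding sum_distrib_right[symmetric] one by simp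
  finally show ?thesis .
qed

lemma law_tendsto_invariant:
  assumes "invariant_distribution (configs N) (ssep_generator N p q) \<mu>" "\<eta> \<in> configs N" "A \<subseteq> configs N"
  shows "((\<lambda>t. law (ssep_generator N p q) t \<eta> A) \<longlongrightarrow> measure_pmf.prob \<mu> A) at_top"
proof (rule Lim_transform[OF tendsto_const], rule Lim_null_comparison[OF _ exponential_tendsto_0[OF N1 k(2)]])
  show "\<forall>\<^sub>F t in at_top. norm (law (ssep_generator N p q) t \<eta> A - measure_pmf.prob \<mu> A)
      \<le> c * exp (- (2 * real N ^ 3 * t * (1 - k)))"
    using law_invariant_difference[OF assms(1,2) _ assms(3)]
    by (intro eventually_mono[OF eventually_ge_at_top[of 0]]) simp
qed

text \<open>The definite description is meaningful only with existence and uniqueness. Existence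
  comes from the limit of the powers of \<open>skel\<close> at the empty configuration, uniqueness
  from the convergence of the laws to every invariant distribution.\<close>

lemma ssep_stationary_invariant:
  "invariant_distribution (configs N) (ssep_generator N p q) (ssep_stationary N p q)"
proof -
  let ?S = "configs N" and ?Q = "skel N p q" and ?L = "ssep_generator N p q"
  define \<eta>0 where "\<eta>0 = (restrict (\<lambda>_. 0) {1..N} :: config)"
  have \<eta>0: "\<eta>0 \<in> ?S" unfolding \<eta>0_def by (rule configs_nonempty)
  define m where "m A = lim (\<lambda>n. (?Q ^^ n) (indicator A) \<eta>0)" for A
  have m_lim: "(\<lambda>n. (?Q ^^ n) (indicator A) \<eta>0) \<longlonglongrightarrow> m A" for A
    unfolding m_def using skel_indicator_convergent[OF \<eta>0] by (simp add: convergent_LIMSEQ_iff)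
  have m_fun: "(\<lambda>n. (?Q ^^ n) g \<eta>0) \<longlonglongrightarrow> (\<Sum>x\<in>?S. g x * m {x})" for g
  proof -
    have "g \<zeta> = (\<Sum>x\<in>?S. g x * indicator {x} \<zeta>)" if "\<zeta> \<in> ?S" for \<zeta>
    proof -
      have "(\<Sum>x\<in>?S. g x * indicator {x} \<zeta>) = (\<Sum>x\<in>?S. if \<zeta> = x then g x else 0)"
        by (intro sum.cong) (auto simp: indicator_def)
      then show ?thesis using that finite_configs by (simp add: sum.delta)
    qed
    then have "(?Q ^^ n) g \<eta>0 = (?Q ^^ n) (\<lambda>\<zeta>. \<Sum>x\<in>?S. g x * indicator {x} \<zeta>) \<eta>0" for n
      by (intro skel_power_cong \<eta>0)
    then have "(\<lambda>n. (?Q ^^ n) g \<eta>0) = (\<lambda>n. \<Sum>x\<in>?S. g x * (?Q ^^ n) (indicator {x}) \<eta>0)"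
      by (simp add: skel_power_sum)
    then show ?thesis by (simp only:) (intro tendsto_sum tendsto_mult_left m_lim)
  qed
  have m_nonneg: "0 \<le> m A" for A
  proof (rule LIMSEQ_le_const[OF m_lim], intro exI allI impI)
    fix n
    have "(?Q ^^ n) (\<lambda>_. 0) \<eta>0 \<le> (?Q ^^ n) (indicator A) \<eta>0" by (intro skel_power_mono \<eta>0) auto
    then show "0 \<le> (?Q ^^ n) (indicator A) \<eta>0" by (simp add: skel_power_const)
  qed
  have m_one: "(\<Sum>x\<in>?S. m {x}) = 1"
    using LIMSEQ_unique[OF m_fun[of "\<lambda>_. 1"]] skel_power_const by simp
  define f where "f x = (if x \<in> ?S then m {x} else 0)" for x
  have f0: "0 \<le> f x" for x by (simp add: f_def m_nonneg)
  have "(\<integral>\<^sup>+x. ennreal (f x) \<partial>count_space UNIV) = (\<integral>\<^sup>+x. ennreal (f x) \<partial>count_space ?S)"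
    by (rule nn_integral_count_space_eq) (auto simp: f_def)
  also have "\<dots> = ennreal (\<Sum>x\<in>?S. f x)"
    by (simp add: nn_integral_count_space_finite finite_configs sum_ennreal f0)
  also have "\<dots> = 1" using m_one by (simp add: f_def)
  finally have f1: "(\<integral>\<^sup>+x. ennreal (f x) \<partial>count_space UNIV) = 1" .
  define \<mu> where "\<mu> = embed_pmf f"
  have pmf: "pmf \<mu> x = f x" for x unfolding \<mu>_def by (rule pmf_embed_pmf[OF f0 f1])
  have prob: "measure_pmf.prob \<mu> A = m A" if "A \<subseteq> ?S" for A
  proof -
    have "measure_pmf.prob \<mu> A = (\<Sum>x\<in>A. m {x})"
      using finite_subset[OF that finite_configs] that
      by (subst measure_measure_pmf_finite) (auto simp: pmf f_def intro!: sum.cong)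
    also have "\<dots> = (\<Sum>x\<in>?S. indicator A x * m {x})"
      using that finite_configs by (intro sum.mono_neutral_cong_left) auto
    also have "\<dots> = m A" using LIMSEQ_unique[OF m_fun m_lim] .
    finally show ?thesis .
  qed
  have inv: "invariant_distribution ?S ?L \<mu>"
    unfolding invariant_distribution_def
  proof (intro conjI allI impI)
    show "set_pmf \<mu> \<subseteq> ?S" by (auto simp: set_pmf_iff pmf f_def split: if_splits)
    fix t :: real and A assume t: "0 \<le> t" and A: "A \<subseteq> ?S"
    let ?r = "2 * real N ^ 3 * t"
    have "(\<lambda>n. \<Sum>x\<in>?S. pmf \<mu> x * (pois ?r n * (?Q ^^ n) (indicator A) x)) sums (\<Sum>x\<in>?S. pmf \<mu> x * law ?L t x A)"
      unfolding law_def by (intro sums_sum sums_mult semigroup_skel)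
    moreover have "(\<Sum>x\<in>?S. pmf \<mu> x * (pois ?r n * (?Q ^^ n) (indicator A) x)) = m A * pois ?r n" for n
    proof -
      \<comment> \<open>Dropping the first \<open>n\<close> terms does not change the limit, so the
        limit is invariant under every power of \<open>skel\<close>, hence under their Poisson
        mixture.\<close>
      have "(\<lambda>j. (?Q ^^ (j + n)) (indicator A) \<eta>0) \<longlonglongrightarrow> m A"
        by (rule LIMSEQ_ignore_initial_segment[OF m_lim])
      moreover have "(\<lambda>j. (?Q ^^ j) ((?Q ^^ n) (indicator A)) \<eta>0) \<longlonglongrightarrow> (\<Sum>x\<in>?S. (?Q ^^ n) (indicator A) x * m {x})"
        by (rule m_fun)
      ultimately have e: "(\<Sum>x\<in>?S. (?Q ^^ n) (indicator A) x * m {x}) = m A"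
        by (simp add: funpow_add LIMSEQ_unique)
      have "(\<Sum>x\<in>?S. pmf \<mu> x * (pois ?r n * (?Q ^^ n) (indicator A) x))
          = pois ?r n * (\<Sum>x\<in>?S. (?Q ^^ n) (indicator A) x * m {x})"
        unfolding sum_distrib_left by (intro sum.cong) (auto simp: pmf f_def)
      then show ?thesis using e by simp
    qed
    ultimately have "(\<lambda>n. m A * pois ?r n) sums (\<Sum>x\<in>?S. pmf \<mu> x * law ?L t x A)" by simp
    moreover have "(\<lambda>n. m A * pois ?r n) sums (m A * 1)" by (intro sums_mult pois_sums_1)
    ultimately show "(\<Sum>x\<in>?S. pmf \<mu> x * law ?L t x A) = measure_pmf.prob \<mu> A"
      using sums_unique2 prob[OF A] by fastforce
  qed
  have "\<nu> = \<mu>" if "invariant_distribution ?S ?L \<nu>" for \<nu>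
  proof (rule pmf_eqI)
    fix x
    show "pmf \<nu> x = pmf \<mu> x"
    proof (cases "x \<in> ?S")
      case True
      then have "measure_pmf.prob \<nu> {x} = measure_pmf.prob \<mu> {x}"
        using tendsto_unique[OF _ law_tendsto_invariant[OF that \<eta>0] law_tendsto_invariant[OF inv \<eta>0], of "{x}"] by simp
      then show ?thesis by (simp add: measure_pmf_single)
    next
      case False
      then have "x \<notin> set_pmf \<nu>" "x \<notin> set_pmf \<mu>"
        using that inv by (auto simp: invariant_distribution_def)
      then show ?thesis by (simp add: set_pmf_iff)
    qed
  qed
  then show ?thesis
    unfolding ssep_stationary_def by (rule theI[where P = "invariant_distribution ?S ?L", OF inv])
qed

end

end

subsection \<open>The spectral gap\<close>

lemma sin_ge_cubic:
  fixes x :: real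
  assumes "0 \<le> x"
  shows "x - x ^ 3 / 6 \<le> sin x"
proof -
  have "\<bar>sin x - x\<bar> * 6 \<le> x * (x * x)"
    using Maclaurin_sin_bound[of x 3] assms
    by (simp add: sin_coeff_def numeral_3_eq_3 power_abs)
  moreover have "x - sin x \<le> \<bar>sin x - x\<bar>" using abs_ge_minus_self[of "sin x - x"] by simp
  then have "(x - sin x) * 6 \<le> \<bar>sin x - x\<bar> * 6" by (rule mult_right_mono) simp
  ultimately have "(x - sin x) * 6 \<le> x * (x * x)" by (rule order_trans[rotated])
  then show ?thesis by (simp add: power3_eq_cube field_simps)
qed

text \<open>The half-angle formula \<open>1 - cos y = 2 * (sin (y / 2))^2\<close> reduces both
  bounds to bounds on the sine.\<close>

lemma one_minus_cos_bounds:
  fixes y :: real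
  assumes "0 \<le> y" "y \<le> 1"
  shows "1 - cos y \<le> y\<^sup>2 / 2" "y\<^sup>2 / 2 * (1 - y\<^sup>2 / 12) \<le> 1 - cos y"
proof -
  have eq: "1 - cos y = 2 * (sin (y / 2))\<^sup>2" using cos_double_sin[of "y / 2"] by simp
  have s0: "0 \<le> sin (y / 2)" using assms pi_gt3 by (intro sin_ge_zero) auto
  have "(sin (y / 2))\<^sup>2 \<le> (y / 2)\<^sup>2" using assms s0 by (intro power_mono sin_x_le_x) auto
  then show "1 - cos y \<le> y\<^sup>2 / 2" unfolding eq by (simp add: power2_eq_square)
  have y2: "y\<^sup>2 \<le> 1" using assms by (simp add: power_le_one)
  have "y / 2 * (1 - y\<^sup>2 / 24) \<le> sin (y / 2)"
    using sin_ge_cubic[of "y / 2"] assms by (simp add: power2_eq_square power3_eq_cube algebra_simps)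
  then have "(y / 2 * (1 - y\<^sup>2 / 24))\<^sup>2 \<le> (sin (y / 2))\<^sup>2"
    using assms y2 by (intro power_mono) auto
  moreover have "y\<^sup>2 / 4 * (1 - y\<^sup>2 / 12) \<le> (y / 2 * (1 - y\<^sup>2 / 24))\<^sup>2"
  proof -
    have "1 - y\<^sup>2 / 12 \<le> (1 - y\<^sup>2 / 24)\<^sup>2"
      using zero_le_power2[of "y\<^sup>2 / 24"] by (simp add: power2_eq_square field_simps)
    then have "y\<^sup>2 / 4 * (1 - y\<^sup>2 / 12) \<le> y\<^sup>2 / 4 * (1 - y\<^sup>2 / 24)\<^sup>2" by (intro mult_left_mono) auto
    then show ?thesis by (simp add: power_mult_distrib power_divide)
  qed
  ultimately show "y\<^sup>2 / 2 * (1 - y\<^sup>2 / 12) \<le> 1 - cos y" unfolding eq by linarith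
qed

lemma pi_square_bounds: "9 \<le> pi\<^sup>2" "pi\<^sup>2 \<le> 10"
proof -
  show "9 \<le> pi\<^sup>2" using power_mono[of 3 pi 2] pi_gt3 by simp
  have "pi\<^sup>2 \<le> (3.15)\<^sup>2" using pi_approx by (intro power_mono) auto
  then show "pi\<^sup>2 \<le> 10" by (simp add: power2_eq_square)
qed

context
  fixes N :: nat
  assumes N: "6 \<le> N"
begin

text \<open>The threshold 6 makes this angle at most 1/2; it also makes \<open>3 / N\<close> at most
  1/2, which is used in the choice of the time for the upper bound.\<close>

lemma gap_angle: "0 < pi / (real N + 1)" "pi / (real N + 1) \<le> 1 / 2"
  using N pi_approx by (simp_all add: field_simps)

text \<open>The gap enters multiplied by a time of order \<open>log N\<close>, so a relative error
  \<open>3 / N\<close> costs only a bounded amount. The bound from above by the exact value of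
  \<open>pi^2\<close> serves the lower bound on the mixing time.\<close>

lemma gap_bounds:
  defines "y \<equiv> pi / (real N + 1)"
  shows "1 - skappa N \<le> 5 / real N ^ 3" "skappa N < 1" "1 / 2 \<le> skappa N"
    "2 * real N ^ 3 * (1 - skappa N) \<le> pi\<^sup>2" "pi\<^sup>2 * (1 - 3 / real N) \<le> 2 * real N ^ 3 * (1 - skappa N)"
    "y\<^sup>2 \<le> 8 * (1 - cos y)"
proof -
  have Np: "0 < real N" and N6: "6 \<le> real N" using N by auto
  have y: "0 < y" "y \<le> 1 / 2" unfolding y_def by (rule gap_angle)+
  have up: "1 - cos y \<le> y\<^sup>2 / 2" and lo: "y\<^sup>2 / 2 * (1 - y\<^sup>2 / 12) \<le> 1 - cos y"
    using one_minus_cos_bounds[of y] y by auto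
  have y2: "y\<^sup>2 = pi\<^sup>2 / (real N + 1)\<^sup>2" by (simp add: y_def power_divide)
  have kap: "1 - skappa N = (1 - cos y) / real N" by (simp add: skappa_def y_def)
  have y2N: "y\<^sup>2 \<le> pi\<^sup>2 / (real N)\<^sup>2"
    unfolding y2 using Np by (intro divide_left_mono power_mono mult_pos_pos) auto
  have "1 - skappa N \<le> (y\<^sup>2 / 2) / real N" unfolding kap using up Np by (intro divide_right_mono) auto
  also have "\<dots> \<le> (10 / (real N)\<^sup>2 / 2) / real N"
    using y2N pi_square_bounds Np
    by (intro divide_right_mono order_trans[OF y2N] divide_right_mono) auto
  also have "\<dots> = 5 / real N ^ 3" by (simp add: power2_eq_square power3_eq_cube)
  finally show u: "1 - skappa N \<le> 5 / real N ^ 3" .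
  have "6 ^ 3 \<le> real N ^ 3" using N6 by (intro power_mono) auto
  then have "5 / real N ^ 3 \<le> 1 / 2" using Np by (simp add: field_simps)
  then show "1 / 2 \<le> skappa N" using u by linarith
  have ysq: "y\<^sup>2 \<le> 1" using y by (intro power_le_one) auto
  have "y\<^sup>2 / 2 * (1 / 4) \<le> y\<^sup>2 / 2 * (1 - y\<^sup>2 / 12)" using ysq by (intro mult_left_mono) auto
  then have "y\<^sup>2 / 2 * (1 / 4) \<le> 1 - cos y" using lo by (rule order_trans)
  then show e: "y\<^sup>2 \<le> 8 * (1 - cos y)" by simp
  have "0 < y\<^sup>2" using y by simp
  also note e
  finally have "0 < 1 - cos y" by simp
  then have "0 < 1 - skappa N" unfolding kap using Np by simp
  then show "skappa N < 1" by simp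
  have lam: "2 * real N ^ 3 * (1 - skappa N) = 2 * (real N)\<^sup>2 * (1 - cos y)"
    unfolding kap using Np by (simp add: power2_eq_square power3_eq_cube)
  have "2 * (real N)\<^sup>2 * (1 - cos y) \<le> 2 * (real N)\<^sup>2 * (pi\<^sup>2 / (real N)\<^sup>2 / 2)"
    using up y2N by (intro mult_left_mono) auto
  then show "2 * real N ^ 3 * (1 - skappa N) \<le> pi\<^sup>2" unfolding lam using Np by simp
  have a: "1 - 2 / real N \<le> (real N)\<^sup>2 / (real N + 1)\<^sup>2"
  proof -
    have "(1 - 2 / real N) * (real N + 1)\<^sup>2 = (real N)\<^sup>2 - 3 - 2 / real N"
      using Np by (simp add: power2_eq_square field_simps)
    also have "\<dots> \<le> (real N)\<^sup>2"
    proof -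
      have "0 \<le> 2 / real N" by simp
      then show ?thesis by linarith
    qed
    finally show ?thesis using Np by (simp add: pos_le_divide_eq)
  qed
  have b: "1 - 1 / real N \<le> 1 - y\<^sup>2 / 12"
  proof -
    have "y\<^sup>2 / 12 \<le> (10 / (real N)\<^sup>2) / 12"
      using pi_square_bounds by (intro divide_right_mono order_trans[OF y2N]) (auto intro: divide_right_mono)
    also have "\<dots> \<le> 1 / real N" using N6 Np by (simp add: power2_eq_square field_simps)
    finally show ?thesis by simp
  qed
  \<comment> \<open>Of the relative error \<open>3 / N\<close>, two parts come from replacing
    \<open>N + 1\<close> by \<open>N\<close> and one from the fourth order term of the
    cosine.\<close>
  have "pi\<^sup>2 * (1 - 3 / real N) \<le> pi\<^sup>2 * ((1 - 2 / real N) * (1 - 1 / real N))"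
  proof (intro mult_left_mono)
    have "(1 - 2 / real N) * (1 - 1 / real N) = 1 - 3 / real N + 2 / (real N)\<^sup>2"
      using Np by (simp add: power2_eq_square field_simps)
    then show "1 - 3 / real N \<le> (1 - 2 / real N) * (1 - 1 / real N)" by simp
  qed simp
  also have "\<dots> \<le> pi\<^sup>2 * ((real N)\<^sup>2 / (real N + 1)\<^sup>2 * (1 - y\<^sup>2 / 12))"
    using a b N6 Np by (intro mult_left_mono mult_mono) (auto simp: field_simps)
  also have "\<dots> = 2 * (real N)\<^sup>2 * (y\<^sup>2 / 2 * (1 - y\<^sup>2 / 12))" by (simp add: y2)
  also have "\<dots> \<le> 2 * real N ^ 3 * (1 - skappa N)"
    unfolding lam using lo by (intro mult_left_mono) auto
  finally show "pi\<^sup>2 * (1 - 3 / real N) \<le> 2 * real N ^ 3 * (1 - skappa N)" .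
qed

text \<open>The steps spent on the collision estimate take time 8, so undoing their decay costs only
  a constant. Here 160 is 16 times 2, from \<open>ln (1 - x) \<ge> - 2 * x\<close>, times 5, from
  \<open>gap_bounds\<close>.\<close>

lemma skappa_power_lower: "exp (- 160) \<le> skappa N ^ (16 * N ^ 3)"
proof -
  define x where "x = 1 - skappa N"
  have x: "0 \<le> x" "x \<le> 1 / 2" "x \<le> 5 / real N ^ 3" using gap_bounds by (auto simp: x_def)
  have "- x - 2 * x\<^sup>2 \<le> ln (1 - x)" using x by (intro ln_one_minus_pos_lower_bound)
  moreover have "2 * x\<^sup>2 \<le> x" using mult_left_mono[OF x(2,1)] by (simp add: power2_eq_square)
  ultimately have l: "- (2 * x) \<le> ln (skappa N)" by (simp add: x_def)
  have "real N ^ 3 * x \<le> real N ^ 3 * (5 / real N ^ 3)" using x(3) by (intro mult_left_mono) auto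
  then have "real N ^ 3 * x \<le> 5" using N by simp
  moreover have "real (16 * N ^ 3) * - (2 * x) = - 32 * (real N ^ 3 * x)" by simp
  ultimately have "- 160 \<le> real (16 * N ^ 3) * - (2 * x)" by linarith
  also have "\<dots> \<le> real (16 * N ^ 3) * ln (skappa N)" using l by (intro mult_left_mono) auto
  finally have "exp (- 160) \<le> exp (real (16 * N ^ 3) * ln (skappa N))" by simp
  also have "\<dots> = skappa N ^ (16 * N ^ 3)"
    using gap_bounds(3) by (simp add: exp_of_nat_mult del: of_nat_mult of_nat_power)
  finally show ?thesis .
qed

text \<open>A bound for every \<open>n\<close> is needed because the Poisson number of steps may be
  small. Below \<open>16 * N^3\<close> steps the trivial bound 2 suffices, since
  \<open>exp 160\<close> outweighs the decay so far.\<close>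

lemma skel_contraction:
  assumes f: "\<And>\<zeta>. \<bar>f \<zeta>\<bar> \<le> 1"
    and \<alpha>: "0 < \<alpha>" "\<alpha> / 2 \<le> p" "\<alpha> / 2 \<le> 1 - p" "\<alpha> / 2 \<le> q" "\<alpha> / 2 \<le> 1 - q"
    and \<eta>: "\<eta> \<in> configs N" "\<zeta> \<in> configs N"
  shows "\<bar>(skel N p q ^^ n) f \<eta> - (skel N p q ^^ n) f \<zeta>\<bar> \<le> 48 / sqrt \<alpha> * exp 160 * sqrt (real N) * skappa N ^ n"
proof -
  let ?n0 = "16 * N ^ 3" and ?c = "48 / sqrt \<alpha> * sqrt (real N)"
  have k: "0 \<le> skappa N" "skappa N \<le> 1" using gap_bounds by auto
  have \<alpha>1: "\<alpha> \<le> 1" using \<alpha> by linarith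
  have c0: "0 \<le> ?c" using \<alpha> by simp
  have e: "1 \<le> exp 160 * skappa N ^ ?n0"
    using mult_left_mono[OF skappa_power_lower, of "exp 160"] by (simp add: exp_minus)
  show ?thesis
  proof (cases "?n0 \<le> n")
    case True
    then obtain m where m: "n = m + ?n0" using le_Suc_ex[OF True] by (metis add.commute)
    have "\<bar>(skel N p q ^^ n) f \<eta> - (skel N p q ^^ n) f \<zeta>\<bar> \<le> ?c * skappa N ^ m * 1"
      unfolding m mult_1_right using N by (intro skel_oscillation f \<alpha> \<eta>) auto
    also have "?c * skappa N ^ m * 1 \<le> ?c * skappa N ^ m * (exp 160 * skappa N ^ ?n0)"
      using k by (intro mult_left_mono e mult_nonneg_nonneg c0) auto
    also have "\<dots> = 48 / sqrt \<alpha> * exp 160 * sqrt (real N) * skappa N ^ n"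
      unfolding m power_add by (simp add: mult_ac)
    finally show ?thesis .
  next
    case False
    have b: "\<bar>(skel N p q ^^ n) f \<xi>\<bar> \<le> 1" if "\<xi> \<in> configs N" for \<xi>
      using N \<alpha> f that by (intro skel_power_abs_le) auto
    have "\<bar>(skel N p q ^^ n) f \<eta> - (skel N p q ^^ n) f \<zeta>\<bar> \<le> 2"
      using b[OF \<eta>(1)] b[OF \<eta>(2)] by linarith
    also have "2 \<le> ?c"
    proof -
      have "1 * 1 \<le> 1 / sqrt \<alpha> * sqrt (real N)" using \<alpha> \<alpha>1 N by (intro mult_mono) auto
      then show ?thesis by simp
    qed
    also have "?c * 1 \<le> ?c * (exp 160 * skappa N ^ n)"
    proof (intro mult_left_mono c0)
      have "exp 160 * skappa N ^ ?n0 \<le> exp 160 * skappa N ^ n"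
        using False k by (intro mult_left_mono power_decreasing) auto
      then show "1 \<le> exp 160 * skappa N ^ n" using e by linarith
    qed
    finally show ?thesis by (simp add: mult_ac)
  qed
qed

subsection \<open>The slowest mode\<close>

context
  fixes p q :: real
  assumes p: "0 < p" "p < 1" and q: "0 < q" "q < 1"
begin

text \<open>The constant balances the inflow from the reservoirs, which makes this an exact
  eigenfunction. The minus sign makes it large and positive on the empty configuration.\<close>

definition slow_mode :: "config \<Rightarrow> real" where
  "slow_mode \<eta> = sin (pi / (real N + 1)) * (p + q) / (2 * (1 - cos (pi / (real N + 1))))
     - (\<Sum>x\<in>{1..N}. smode N x * real (\<eta> x))"

lemma slow_mode_nswap:
  assumes e: "e \<in> {1..<N}"
  shows "slow_mode (\<eta> \<circ> nswap e) = slow_mode \<eta> + (smode N (Suc e) - smode N e) * (real (\<eta> (Suc e)) - real (\<eta> e))"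
proof -
  have "(\<Sum>x\<in>{1..N}. smode N x * real ((\<eta> \<circ> nswap e) x)) - (\<Sum>x\<in>{1..N}. smode N x * real (\<eta> x))
      = (\<Sum>x\<in>{1..N}. smode N x * (real (\<eta> (nswap e x)) - real (\<eta> x)))"
    by (simp add: sum_subtractf right_diff_distrib)
  also have "\<dots> = (\<Sum>x\<in>{e, Suc e}. smode N x * (real (\<eta> (nswap e x)) - real (\<eta> x)))"
    using e by (intro sum.mono_neutral_right) (auto simp: nswap_def)
  also have "\<dots> = - (smode N (Suc e) - smode N e) * (real (\<eta> (Suc e)) - real (\<eta> e))"
    by (simp add: nswap_def algebra_simps)
  finally show ?thesis unfolding slow_mode_def by linarith
qed

lemma slow_mode_upd:
  assumes i: "i \<in> {1..N}"
  shows "slow_mode (\<eta>(i := v)) = slow_mode \<eta> + smode N i * (real (\<eta> i) - real v)"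
proof -
  have "(\<Sum>x\<in>{1..N}. smode N x * real ((\<eta>(i := v)) x)) = smode N i * real v + (\<Sum>x\<in>{1..N} - {i}. smode N x * real (\<eta> x))"
    using i by (simp add: sum.remove)
  moreover have "(\<Sum>x\<in>{1..N}. smode N x * real (\<eta> x)) = smode N i * real (\<eta> i) + (\<Sum>x\<in>{1..N} - {i}. smode N x * real (\<eta> x))"
    using i by (simp add: sum.remove)
  ultimately show ?thesis unfolding slow_mode_def by (simp add: algebra_simps)
qed

lemma smode_ends: "smode N 1 = sin (pi / (real N + 1))" "smode N N = sin (pi / (real N + 1))"
proof -
  show "smode N 1 = sin (pi / (real N + 1))" by (simp add: smode_def)
  have "pi * real N / (real N + 1) = pi - pi / (real N + 1)" by (simp add: field_simps)
  then show "smode N N = sin (pi / (real N + 1))" by (simp add: smode_def sin_diff)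
qed

lemma kwalk_smode:
  assumes "x \<in> {1..N}"
  shows "kwalk N (smode N) x = skappa N * smode N x"
proof -
  obtain z where z: "x = Suc z" using assms by (cases x) auto
  have "kwalk N (smode N) x = smode N (Suc z) + (smode N (Suc (Suc z)) + smode N z - 2 * smode N (Suc z)) / (2 * real N)"
    unfolding z using N assms z by (intro kwalk_eq) auto
  also have "\<dots> = skappa N * smode N (Suc z)"
    unfolding smode_laplacian skappa_def using N by (simp add: field_simps)
  finally show ?thesis using z by simp
qed

text \<open>On a linear statistic the step acts on the coefficients as \<open>kwalk\<close>, and the
  reservoirs add a constant inflow through the two end values of the mode; this inflow equals
  \<open>C * (1 - skappa N)\<close>.\<close>

lemma skel_slow_mode: "skel N p q slow_mode \<eta> = skappa N * slow_mode \<eta>"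
proof -
  define C where "C = sin (pi / (real N + 1)) * (p + q) / (2 * (1 - cos (pi / (real N + 1))))"
  have N1: "1 \<le> N" using N by simp
  define lin where "lin c \<eta> = (\<Sum>x\<in>{1..N}. c x * real (\<eta> x))" for c and \<eta> :: config
  have sm: "slow_mode = (\<lambda>\<eta>. 1 * C + (- 1) * lin (smode N) \<eta>)"
    by (intro ext) (simp add: slow_mode_def C_def lin_def)
  have b: "bond e (lin c) \<eta> = lin (\<lambda>x. (c x + c (nswap e x)) / 2) \<eta>" if "e \<in> {1..<N}" for e c
  proof -
    have img: "nswap e ` {1..N} = {1..N}" using that by (auto intro!: nswap_image_both)
    have "lin c (\<eta> \<circ> nswap e) = (\<Sum>x\<in>nswap e ` {1..N}. c x * real (\<eta> (nswap e x)))"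
      unfolding img lin_def by simp
    also have "\<dots> = lin (c \<circ> nswap e) \<eta>" unfolding sum_nswap lin_def by simp
    finally show ?thesis
      by (simp add: bond_def lin_def sum.distrib[symmetric] sum_divide_distrib algebra_simps add_divide_distrib)
  qed
  have r: "resv i r (lin c) \<eta> = lin (\<lambda>x. if x = i then 0 else c x) \<eta> + c i * r" if "i \<in> {1..N}" for i r c
  proof -
    have "lin c (\<eta>(i := v)) = c i * real v + (\<Sum>x\<in>{1..N} - {i}. c x * real (\<eta> x))" for v
      using that by (simp add: lin_def sum.remove)
    moreover have "lin (\<lambda>x. if x = i then 0 else c x) \<eta> = (\<Sum>x\<in>{1..N} - {i}. c x * real (\<eta> x))"
      unfolding lin_def using that by (subst sum.remove[of _ i]) (auto intro!: sum.cong)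
    ultimately show ?thesis by (simp add: resv_def algebra_simps)
  qed
  have "skel N p q (lin (smode N)) \<eta> = ((\<Sum>e\<in>{1..<N}. lin (\<lambda>x. (smode N x + smode N (nswap e x)) / 2) \<eta>)
      + (lin (\<lambda>x. if x = 1 then 0 else smode N x) \<eta> + smode N 1 * p) / 2
      + (lin (\<lambda>x. if x = N then 0 else smode N x) \<eta> + smode N N * q) / 2) / real N"
    unfolding skel_def using N1 by (simp add: b r)
  also have "\<dots> = lin (kwalk N (smode N)) \<eta> + (smode N 1 * p + smode N N * q) / (2 * real N)"
  proof -
    have "lin (kwalk N (smode N)) \<eta> = (\<Sum>x\<in>{1..N}. ((\<Sum>e\<in>{1..<N}. (smode N x + smode N (nswap e x)) / 2 * real (\<eta> x))
        + (if x = 1 then 0 else smode N x) * real (\<eta> x) / 2 + (if x = N then 0 else smode N x) * real (\<eta> x) / 2) / real N)"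
      unfolding lin_def kwalk_def sum_distrib_right[symmetric] by (intro sum.cong refl) (simp add: distrib_right)
    also have "\<dots> = ((\<Sum>x\<in>{1..N}. \<Sum>e\<in>{1..<N}. (smode N x + smode N (nswap e x)) / 2 * real (\<eta> x))
        + lin (\<lambda>x. if x = 1 then 0 else smode N x) \<eta> / 2 + lin (\<lambda>x. if x = N then 0 else smode N x) \<eta> / 2) / real N"
      unfolding lin_def by (simp only: sum_divide_distrib[symmetric] sum.distrib)
    also have "(\<Sum>x\<in>{1..N}. \<Sum>e\<in>{1..<N}. (smode N x + smode N (nswap e x)) / 2 * real (\<eta> x))
        = (\<Sum>e\<in>{1..<N}. lin (\<lambda>x. (smode N x + smode N (nswap e x)) / 2) \<eta>)"
      unfolding lin_def by (rule sum.swap)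
    finally show ?thesis using N1 by (simp add: field_simps)
  qed
  also have "lin (kwalk N (smode N)) \<eta> = skappa N * lin (smode N) \<eta>"
    unfolding lin_def sum_distrib_left by (intro sum.cong) (auto simp: kwalk_smode)
  also have "(smode N 1 * p + smode N N * q) / (2 * real N) = C * (1 - skappa N)"
  proof -
    have "1 - cos (pi / (real N + 1)) \<noteq> 0" using gap_bounds(2) unfolding skappa_def by auto
    then show ?thesis
      unfolding smode_ends C_def skappa_def using N1 by (simp add: field_simps)
  qed
  finally have l: "skel N p q (lin (smode N)) \<eta> = skappa N * lin (smode N) \<eta> + C * (1 - skappa N)" .
  have "skel N p q slow_mode \<eta> = 1 * skel N p q (\<lambda>_. C) \<eta> + (- 1) * skel N p q (lin (smode N)) \<eta>"
    unfolding sm by (rule skel_lin)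
  also have "skel N p q (\<lambda>_. C) \<eta> = C" using N1 p q by (intro skel_const) auto
  finally show ?thesis unfolding l sm by (simp add: algebra_simps)
qed

lemma skel_power_slow_mode: "(skel N p q ^^ n) slow_mode \<eta> = skappa N ^ n * slow_mode \<eta>"
proof (induction n arbitrary: \<eta>)
  case (Suc n)
  then have "(skel N p q ^^ n) slow_mode = (\<lambda>\<eta>. skappa N ^ n * slow_mode \<eta> + 0 * 0)" by (intro ext) simp
  then have "(skel N p q ^^ Suc n) slow_mode \<eta> = skel N p q (\<lambda>\<eta>. skappa N ^ n * slow_mode \<eta> + 0 * 0) \<eta>"
    by simp
  also have "\<dots> = skappa N ^ n * skel N p q slow_mode \<eta>"
    using skel_lin[of N p q "skappa N ^ n" slow_mode 0 "\<lambda>_. 0" \<eta>] by simp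
  finally show ?case by (simp add: skel_slow_mode)
qed simp

text \<open>The step of a square is the square, plus twice the function times its drift, plus the
  mean square jump. Jumps are at most \<open>pi / (N + 1)\<close>: across a bond by the gradient of
  the mode, at a reservoir by its end value.\<close>

lemma skel_slow_mode_square:
  assumes \<eta>: "\<eta> \<in> configs N"
  shows "skel N p q (\<lambda>\<eta>. (slow_mode \<eta>)\<^sup>2) \<eta> \<le> (2 * skappa N - 1) * (slow_mode \<eta>)\<^sup>2 + (pi / (real N + 1))\<^sup>2"
proof -
  let ?G = slow_mode and ?y = "pi / (real N + 1)"
  have N1: "1 \<le> N" using N by simp
  have bin: "\<eta> i = 0 \<or> \<eta> i = 1" if "i \<in> {1..N}" for i
    using \<eta> that by (auto simp: configs_def PiE_iff)
  have b: "bond e (\<lambda>\<eta>. (?G \<eta>)\<^sup>2) \<eta> \<le> (?G \<eta>)\<^sup>2 + 2 * ?G \<eta> * (bond e ?G \<eta> - ?G \<eta>) + ?y\<^sup>2 / 2"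
    if e: "e \<in> {1..<N}" for e
  proof -
    let ?D = "?G (\<eta> \<circ> nswap e) - ?G \<eta>"
    have s: "\<bar>smode N (Suc e) - smode N e\<bar> \<le> ?y"
    proof -
      have "pi * real (Suc e) / (real N + 1) - pi * real e / (real N + 1) = ?y"
        by (simp add: diff_divide_distrib[symmetric] algebra_simps)
      then have "smode N (Suc e) - smode N e = 2 * sin (?y / 2) * cos ((pi * real (Suc e) / (real N + 1) + pi * real e / (real N + 1)) / 2)"
        unfolding smode_def sin_diff_sin by simp
      then have "\<bar>smode N (Suc e) - smode N e\<bar> = 2 * \<bar>sin (?y / 2)\<bar> * \<bar>cos ((pi * real (Suc e) / (real N + 1) + pi * real e / (real N + 1)) / 2)\<bar>"
        by (simp only: abs_mult abs_numeral)
      also have "\<dots> \<le> 2 * \<bar>sin (?y / 2)\<bar> * 1" by (intro mult_left_mono abs_cos_le_one) auto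
      also have "\<dots> \<le> 2 * \<bar>?y / 2\<bar> * 1" by (intro mult_right_mono mult_left_mono abs_sin_x_le_abs_x) auto
      also have "2 * \<bar>?y / 2\<bar> * 1 = ?y" using gap_angle(1) by (simp only: abs_of_pos half_gt_zero) (simp add: field_simps)
      finally show ?thesis .
    qed
    have "\<bar>real (\<eta> (Suc e)) - real (\<eta> e)\<bar> \<le> 1"
      using bin[of e] bin[of "Suc e"] e by auto
    then have "\<bar>?D\<bar> \<le> ?y * 1"
      unfolding slow_mode_nswap[OF e] using s by (simp add: abs_mult) (intro mult_mono[of _ ?y _ 1, simplified], auto)
    then have "\<bar>?D\<bar>\<^sup>2 \<le> (?y * 1)\<^sup>2" by (intro power_mono) auto
    then have "?D\<^sup>2 \<le> ?y\<^sup>2" by simp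
    moreover have "bond e (\<lambda>\<eta>. (?G \<eta>)\<^sup>2) \<eta> = (?G \<eta>)\<^sup>2 + 2 * ?G \<eta> * (bond e ?G \<eta> - ?G \<eta>) + ?D\<^sup>2 / 2"
      unfolding bond_def by (simp add: power2_eq_square field_simps)
    ultimately show ?thesis by simp
  qed
  have r: "resv i r (\<lambda>\<eta>. (?G \<eta>)\<^sup>2) \<eta> \<le> (?G \<eta>)\<^sup>2 + 2 * ?G \<eta> * (resv i r ?G \<eta> - ?G \<eta>) + ?y\<^sup>2"
    if i: "i = 1 \<or> i = N" and r01: "0 \<le> r" "r \<le> 1" for i r
  proof -
    have i': "i \<in> {1..N}" using i N1 by auto
    have D: "(?G (\<eta>(i := v)) - ?G \<eta>)\<^sup>2 \<le> ?y\<^sup>2" if "v = 0 \<or> v = 1" for v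
    proof -
      have "\<bar>real (\<eta> i) - real v\<bar> \<le> 1" using bin[OF i'] that by auto
      moreover have "\<bar>smode N i\<bar> \<le> ?y"
        using i abs_sin_x_le_abs_x[of ?y] gap_angle(1) by (auto simp: smode_ends smode_ends(1)[unfolded One_nat_def])
      ultimately have "\<bar>smode N i * (real (\<eta> i) - real v)\<bar> \<le> ?y * 1"
        unfolding abs_mult using gap_angle(1) by (intro mult_mono) auto
      then show ?thesis unfolding slow_mode_upd[OF i'] using gap_angle(1) by (simp add: abs_le_square_iff[symmetric])
    qed
    have "resv i r (\<lambda>\<eta>. (?G \<eta>)\<^sup>2) \<eta> = (?G \<eta>)\<^sup>2 + 2 * ?G \<eta> * (resv i r ?G \<eta> - ?G \<eta>)
       + (r * (?G (\<eta>(i := 1)) - ?G \<eta>)\<^sup>2 + (1 - r) * (?G (\<eta>(i := 0)) - ?G \<eta>)\<^sup>2)"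
      unfolding resv_def by (simp add: power2_eq_square algebra_simps)
    also have "r * (?G (\<eta>(i := 1)) - ?G \<eta>)\<^sup>2 + (1 - r) * (?G (\<eta>(i := 0)) - ?G \<eta>)\<^sup>2 \<le> r * ?y\<^sup>2 + (1 - r) * ?y\<^sup>2"
      using r01 D by (intro add_mono mult_left_mono) auto
    finally show ?thesis by (simp add: algebra_simps)
  qed
  let ?a = "(?G \<eta>)\<^sup>2" and ?g = "?G \<eta>"
  have "skel N p q (\<lambda>\<eta>. (?G \<eta>)\<^sup>2) \<eta> \<le> ((\<Sum>e\<in>{1..<N}. ?a + 2 * ?g * (bond e ?G \<eta> - ?g) + ?y\<^sup>2 / 2)
      + (?a + 2 * ?g * (resv 1 p ?G \<eta> - ?g) + ?y\<^sup>2) / 2 + (?a + 2 * ?g * (resv N q ?G \<eta> - ?g) + ?y\<^sup>2) / 2) / real N"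
    unfolding skel_def using p q by (intro divide_right_mono add_mono sum_mono b r) auto
  also have "(\<Sum>e\<in>{1..<N}. ?a + 2 * ?g * (bond e ?G \<eta> - ?g) + ?y\<^sup>2 / 2)
      = (real N - 1) * (?a - 2 * ?g * ?g + ?y\<^sup>2 / 2) + 2 * ?g * (\<Sum>e\<in>{1..<N}. bond e ?G \<eta>)"
    using N1 by (simp add: sum.distrib sum_distrib_left[symmetric] sum_subtractf of_nat_diff algebra_simps)
  also have "(\<dots> + (?a + 2 * ?g * (resv 1 p ?G \<eta> - ?g) + ?y\<^sup>2) / 2 + (?a + 2 * ?g * (resv N q ?G \<eta> - ?g) + ?y\<^sup>2) / 2) / real N
      = ?a - 2 * ?g * ?g + 2 * ?g * skel N p q ?G \<eta> + (real N + 1) / (2 * real N) * ?y\<^sup>2"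
    unfolding skel_def using N1 by (simp add: field_simps)
  \<comment> \<open>Bonds contribute half a squared jump and reservoirs a full one with weight 1/2,
    in total the factor \<open>(N + 1) / (2 * N) \<le> 1\<close>.\<close>
  also have "\<dots> \<le> ?a - 2 * ?g * ?g + 2 * ?g * skel N p q ?G \<eta> + 1 * ?y\<^sup>2"
    using N1 by (intro add_left_mono mult_right_mono) (auto simp: field_simps)
  finally show ?thesis by (simp add: skel_slow_mode power2_eq_square algebra_simps)
qed

text \<open>The level \<open>4 * N\<close> satisfies
  \<open>4 * N * (1 - k) = 8 * (1 - cos y)\<close>, which is at least the noise \<open>y^2\<close>
  of one step, so the recursion never accumulates more than \<open>4 * N\<close>.\<close>

lemma skel_power_slow_mode_square:
  assumes \<eta>: "\<eta> \<in> configs N"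
  shows "(skel N p q ^^ n) (\<lambda>\<eta>. (slow_mode \<eta>)\<^sup>2) \<eta> \<le> (slow_mode \<eta>)\<^sup>2 * (2 * skappa N - 1) ^ n + 4 * real N"
proof -
  let ?y = "pi / (real N + 1)" and ?k = "2 * skappa N - 1" and ?Q = "skel N p q"
  let ?b = "4 * real N"
  have N1: "1 \<le> N" using N by simp
  have k0: "0 \<le> ?k" using gap_bounds(3) by simp
  have yb: "?y\<^sup>2 \<le> ?b * (1 - ?k)"
  proof -
    have "?b * (1 - ?k) = 8 * (1 - cos ?y)" using N1 by (simp add: skappa_def)
    then show ?thesis using gap_bounds(6) by simp
  qed
  have "(?Q ^^ n) (\<lambda>\<eta>. (slow_mode \<eta>)\<^sup>2) \<eta> \<le> ?k ^ n * (slow_mode \<eta>)\<^sup>2 + ?b * (1 - ?k ^ n)"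
    using \<eta>
  proof (induction n arbitrary: \<eta>)
    case (Suc n)
    have "(?Q ^^ Suc n) (\<lambda>\<eta>. (slow_mode \<eta>)\<^sup>2) \<eta> \<le> ?Q (\<lambda>\<eta>. ?k ^ n * (slow_mode \<eta>)\<^sup>2 + ?b * (1 - ?k ^ n) * 1) \<eta>"
      unfolding funpow.simps o_apply
      using N1 p q Suc.prems by (intro skel_mono) (auto intro: Suc.IH[simplified])
    also have "\<dots> = ?k ^ n * ?Q (\<lambda>\<eta>. (slow_mode \<eta>)\<^sup>2) \<eta> + ?b * (1 - ?k ^ n) * ?Q (\<lambda>_. 1) \<eta>"
      by (rule skel_lin)
    also have "?Q (\<lambda>_. 1) \<eta> = 1" using N1 p q by (intro skel_const) auto
    also have "?k ^ n * ?Q (\<lambda>\<eta>. (slow_mode \<eta>)\<^sup>2) \<eta> + ?b * (1 - ?k ^ n) * 1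
        \<le> ?k ^ n * (?k * (slow_mode \<eta>)\<^sup>2 + ?b * (1 - ?k)) + ?b * (1 - ?k ^ n) * 1"
      using k0 skel_slow_mode_square[OF Suc.prems] yb by (intro add_right_mono mult_left_mono) auto
    also have "\<dots> = ?k ^ Suc n * (slow_mode \<eta>)\<^sup>2 + ?b * (1 - ?k ^ Suc n)"
      by (simp add: algebra_simps)
    finally show ?case .
  qed simp
  moreover have "?b * (1 - ?k ^ n) \<le> ?b * 1" using k0 by (intro mult_left_mono) auto
  ultimately show ?thesis by (simp add: mult.commute)
qed

end

end

lemma skel_power_lin:
  "(skel N p q ^^ n) (\<lambda>\<eta>. a * f \<eta> + b * g \<eta>) \<eta> = a * (skel N p q ^^ n) f \<eta> + b * (skel N p q ^^ n) g \<eta>"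
proof (induction n arbitrary: \<eta>)
  case (Suc n)
  then have "(skel N p q ^^ n) (\<lambda>\<eta>. a * f \<eta> + b * g \<eta>) = (\<lambda>\<eta>. a * (skel N p q ^^ n) f \<eta> + b * (skel N p q ^^ n) g \<eta>)"
    by (intro ext)
  then show ?case by (simp add: skel_lin)
qed simp

subsection \<open>Bounds on the distance to equilibrium\<close>

text \<open>Under the root stands the largest \<open>\<alpha>\<close> that both reservoirs allow;
  \<open>exp 160\<close> pays for the steps of the collision estimate.\<close>

definition osc_const :: "real \<Rightarrow> real \<Rightarrow> real" where
  "osc_const p q = 48 / sqrt (2 * min (min p (1 - p)) (min q (1 - q))) * exp 160"

lemma osc_const_ge_1:
  assumes "0 < p" "p < 1" "0 < q" "q < 1"
  shows "1 \<le> osc_const p q"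
proof -
  define a where "a = 2 * min (min p (1 - p)) (min q (1 - q))"
  have a: "0 < a" "a \<le> 1" using assms by (auto simp: a_def min_def)
  have "sqrt a \<le> 1" "0 < sqrt a" using a by simp_all
  then have "1 \<le> 48 / sqrt a" by (subst pos_le_divide_eq) linarith+
  then have "1 * 1 \<le> 48 / sqrt a * exp 160" using a by (intro mult_mono) auto
  then show ?thesis by (simp add: osc_const_def a_def)
qed

context
  fixes N :: nat and p q :: real
  assumes N: "6 \<le> N" and p: "0 < p" "p < 1" and q: "0 < q" "q < 1"
begin

abbreviation gap :: real where
  "gap \<equiv> 2 * real N ^ 3 * (1 - skappa N)"

lemma indicator_contraction:
  assumes "\<eta> \<in> configs N" "\<zeta> \<in> configs N"
  shows "\<bar>(skel N p q ^^ n) (indicator A) \<eta> - (skel N p q ^^ n) (indicator A) \<zeta>\<bar>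
    \<le> osc_const p q * sqrt (real N) * skappa N ^ n"
  unfolding osc_const_def
  by (rule skel_contraction[OF N _ _ _ _ _ _ assms]) (use p q in \<open>auto simp: min_def indicator_def\<close>)

lemma stationary_invariant:
  "invariant_distribution (configs N) (ssep_generator N p q) (ssep_stationary N p q)"
  by (rule ssep_stationary_invariant[OF _ _ _ _ _ _ _ indicator_contraction])
     (use N p q gap_bounds[OF N] in auto)

lemma ssep_distance_ge:
  assumes "\<eta> \<in> configs N" "A \<subseteq> configs N"
  shows "\<bar>law (ssep_generator N p q) t \<eta> A - measure_pmf.prob (ssep_stationary N p q) A\<bar> \<le> ssep_distance N p q t"
proof -
  have "\<bar>law (ssep_generator N p q) t \<eta> A - measure_pmf.prob (ssep_stationary N p q) A\<bar>
      \<le> tv_dist (configs N) (law (ssep_generator N p q) t \<eta>) (measure_pmf.prob (ssep_stationary N p q))"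
    unfolding tv_dist_def using assms finite_configs[of N] by (intro Max_ge) auto
  also have "\<dots> \<le> ssep_distance N p q t"
    unfolding ssep_distance_def using assms finite_configs[of N] by (intro Max_ge) auto
  finally show ?thesis .
qed

lemma ssep_distance_le:
  assumes "0 \<le> t"
  shows "ssep_distance N p q t \<le> osc_const p q * sqrt (real N) * exp (- gap * t)"
proof -
  have "\<bar>law (ssep_generator N p q) t \<eta> A - measure_pmf.prob (ssep_stationary N p q) A\<bar>
      \<le> osc_const p q * sqrt (real N) * exp (- gap * t)" if "\<eta> \<in> configs N" "A \<subseteq> configs N" for \<eta> A
  proof -
    have "\<bar>law (ssep_generator N p q) t \<eta> A - measure_pmf.prob (ssep_stationary N p q) A\<bar>
      \<le> osc_const p q * sqrt (real N) * exp (- (2 * real N ^ 3 * t * (1 - skappa N)))"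
      by (rule law_invariant_difference[OF _ _ _ _ _ _ _ indicator_contraction stationary_invariant])
         (use N p q gap_bounds[OF N] assms that in auto)
    then show ?thesis by (simp add: mult_ac)
  qed
  then have "tv_dist (configs N) (law (ssep_generator N p q) t \<eta>) (measure_pmf.prob (ssep_stationary N p q))
      \<le> osc_const p q * sqrt (real N) * exp (- gap * t)" if "\<eta> \<in> configs N" for \<eta>
    unfolding tv_dist_def using finite_configs[of N] that
    by (subst Max_le_iff) auto
  moreover have "configs N \<noteq> {}" using configs_nonempty by blast
  ultimately show ?thesis
    unfolding ssep_distance_def using finite_configs[of N]
    by (subst Max_le_iff) auto
qed

text \<open>\<open>sin y / (1 - cos y)\<close> is at least \<open>1 / y = (N + 1) / pi\<close>, and
  \<open>pi < 4\<close> leaves \<open>N / 4\<close>; the factor \<open>(p + q) / 2\<close> makes it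
  an eighth.\<close>

lemma slow_mode_initial:
  "(p + q) * real N / 8 \<le> slow_mode N p q (restrict (\<lambda>_. 0) {1..N})"
proof -
  define y where "y = pi / (real N + 1)"
  have y: "0 < y" "y \<le> 1 / 2" unfolding y_def by (rule gap_angle[OF N])+
  have up: "1 - cos y \<le> y\<^sup>2 / 2" using one_minus_cos_bounds(1)[of y] y by simp
  have pos: "0 < 1 - cos y"
  proof -
    have "0 < y\<^sup>2" using y by simp
    also have "y\<^sup>2 \<le> 8 * (1 - cos y)" unfolding y_def by (rule gap_bounds(6)[OF N])
    finally show ?thesis by simp
  qed
  have "y ^ 3 / 6 \<le> y / 2"
  proof -
    have "y ^ 3 = y * y\<^sup>2" by (simp add: power3_eq_cube power2_eq_square)
    also have "\<dots> \<le> y * 1" using y by (intro mult_left_mono) (auto simp: power_le_one)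
    finally show ?thesis using y by simp
  qed
  then have s: "y / 2 \<le> sin y" using sin_ge_cubic[of y] y by simp
  have "real N / 4 \<le> (real N + 1) / 4" by simp
  also have "\<dots> \<le> (real N + 1) / pi" using pi_less_4 by (intro divide_left_mono) auto
  also have "\<dots> = 1 / y" by (simp add: y_def)
  also have "\<dots> = (y / 2) / (y\<^sup>2 / 2)" using y by (simp add: power2_eq_square)
  also have "\<dots> \<le> sin y / (1 - cos y)"
    using s up pos y by (intro frac_le) auto
  finally have r: "real N / 4 \<le> sin y / (1 - cos y)" .
  have "slow_mode N p q (restrict (\<lambda>_. 0) {1..N}) = (p + q) / 2 * (sin y / (1 - cos y))"
  proof -
    have "(\<Sum>x\<in>{1..N}. smode N x * real (restrict (\<lambda>_. 0) {1..N} x)) = 0"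
      by (intro sum.neutral) auto
    then show ?thesis unfolding slow_mode_def[OF N p q] y_def by simp
  qed
  moreover have "(p + q) / 2 * (real N / 4) \<le> (p + q) / 2 * (sin y / (1 - cos y))"
    using r p q by (intro mult_left_mono) auto
  ultimately show ?thesis by simp
qed

section \<open>Chebyshev bounds at time \<open>t\<close> and in equilibrium\<close>

lemma law_slow_mode_ge:
  \<comment> \<open>Chebyshev's inequality in pointwise form: the indicator dominates a parabola in
    the mode, so only the first two moments are needed, and these are known at every step of the
    skeleton.\<close>
  assumes \<eta>: "\<eta> \<in> configs N" and t: "0 \<le> t" and m: "m = exp (- gap * t) * slow_mode N p q \<eta>" "0 < m"
  shows "1 - 16 * real N / m\<^sup>2 \<le> law (ssep_generator N p q) t \<eta> {\<zeta> \<in> configs N. m / 2 \<le> slow_mode N p q \<zeta>}"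
proof -
  let ?G = "slow_mode N p q" and ?A = "{\<zeta> \<in> configs N. m / 2 \<le> slow_mode N p q \<zeta>}"
    and ?Q = "skel N p q" and ?r = "2 * real N ^ 3 * t" and ?k = "2 * skappa N - 1"
  have N1: "1 \<le> N" and p': "0 \<le> p" "p \<le> 1" and q': "0 \<le> q" "q \<le> 1" using N p q by auto
  have r0: "0 \<le> ?r" using t by simp
  \<comment> \<open>The coefficients of \<open>1 - ((G - m) / (m / 2))^2\<close>, which is 1 at
    \<open>m\<close> and vanishes at \<open>m / 2\<close>.\<close>
  define a where "a = - (4 / m\<^sup>2)"
  define b where "b = 8 / m"
  define h where "h \<zeta> = a * (?G \<zeta>)\<^sup>2 + 1 * (b * ?G \<zeta> + (- 3) * 1)" for \<zeta>
  have h: "h \<zeta> \<le> indicator ?A \<zeta>" if "\<zeta> \<in> configs N" for \<zeta>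
  proof -
    have heq: "h \<zeta> = 1 - ((?G \<zeta> - m) / (m / 2))\<^sup>2"
      using m(2) by (simp add: h_def a_def b_def power2_eq_square field_simps)
    show ?thesis
    proof (cases "m / 2 \<le> ?G \<zeta>")
      case True
      then show ?thesis using that heq by simp
    next
      case False
      then have "1 \<le> (m - ?G \<zeta>) / (m / 2)" using m(2) by (simp add: field_simps)
      then have "1 \<le> ((m - ?G \<zeta>) / (m / 2))\<^sup>2" by simp
      also have "\<dots> = ((?G \<zeta> - m) / (m / 2))\<^sup>2" by (simp add: power_divide power2_commute)
      finally show ?thesis unfolding heq by (simp add: indicator_def)
    qed
  qed
  have low: "a * ((?G \<eta>)\<^sup>2 * ?k ^ n + 4 * real N) + (b * (skappa N ^ n * ?G \<eta>) - 3) \<le> (?Q ^^ n) (indicator ?A) \<eta>" for n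
  proof -
    have "a \<le> 0" by (simp add: a_def)
    then have "a * ((?G \<eta>)\<^sup>2 * ?k ^ n + 4 * real N) \<le> a * (?Q ^^ n) (\<lambda>\<eta>. (?G \<eta>)\<^sup>2) \<eta>"
      by (intro mult_left_mono_neg skel_power_slow_mode_square N p q \<eta>)
    moreover have "(?Q ^^ n) h \<eta> = a * (?Q ^^ n) (\<lambda>\<eta>. (?G \<eta>)\<^sup>2) \<eta> + (b * (skappa N ^ n * ?G \<eta>) - 3)"
      unfolding h_def[abs_def] skel_power_lin skel_power_slow_mode[OF N p q] skel_power_const[OF N1 p' q'] by simp
    moreover have "(?Q ^^ n) h \<eta> \<le> (?Q ^^ n) (indicator ?A) \<eta>"
      by (intro skel_power_mono N1 p' q' h \<eta>)
    ultimately show ?thesis by linarith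
  qed
  \<comment> \<open>Since \<open>1 - (2 * skappa N - 1)\<close> is twice
    \<open>1 - skappa N\<close>, the second moment decays in continuous time exactly like the square
    of the mean, and the variance is left with \<open>4 * N\<close>.\<close>
  have e1: "(\<lambda>n. pois ?r n * ?k ^ n) sums (exp (- gap * t))\<^sup>2"
  proof -
    have "exp (- (?r * (1 - ?k))) = exp (- gap * t + - gap * t)" by (simp add: algebra_simps)
    also have "\<dots> = (exp (- gap * t))\<^sup>2" unfolding exp_add by (simp add: power2_eq_square)
    finally show ?thesis using pois_sums[of ?r ?k] by simp
  qed
  have e2: "(\<lambda>n. pois ?r n * skappa N ^ n) sums exp (- gap * t)"
    using pois_sums[of ?r "skappa N"] by (simp add: mult_ac)
  have S0: "(\<lambda>n. a * ((?G \<eta>)\<^sup>2 * (pois ?r n * ?k ^ n) + 4 * real N * pois ?r n) + (b * (?G \<eta> * (pois ?r n * skappa N ^ n)) - 3 * pois ?r n))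
     sums (a * ((?G \<eta>)\<^sup>2 * (exp (- gap * t))\<^sup>2 + 4 * real N * 1) + (b * (?G \<eta> * exp (- gap * t)) - 3 * 1))"
    by (intro sums_add sums_diff sums_mult e1 e2 pois_sums_1)
  have S1: "a * ((?G \<eta>)\<^sup>2 * (exp (- gap * t))\<^sup>2 + 4 * real N * 1) + (b * (?G \<eta> * exp (- gap * t)) - 3 * 1) = 1 - 16 * real N / m\<^sup>2"
  proof -
    have 1: "(?G \<eta>)\<^sup>2 * (exp (- gap * t))\<^sup>2 = m\<^sup>2" "?G \<eta> * exp (- gap * t) = m"
      unfolding m(1) power_mult_distrib by (simp_all only: mult.commute)
    show ?thesis unfolding 1 a_def b_def using m(2) by (simp add: field_simps)
  qed
  note S = S0[unfolded S1]
  show ?thesis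
    unfolding law_def
  proof (rule sums_le[OF _ S semigroup_skel[OF N1 p' q' \<eta>]])
    fix n
    show "a * ((?G \<eta>)\<^sup>2 * (pois ?r n * ?k ^ n) + 4 * real N * pois ?r n) + (b * (?G \<eta> * (pois ?r n * skappa N ^ n)) - 3 * pois ?r n)
        \<le> pois ?r n * (?Q ^^ n) (indicator ?A) \<eta>"
      using mult_left_mono[OF low[of n] pois_nonneg[OF r0, of n]] by (simp add: algebra_simps)
  qed
qed

text \<open>Markov's inequality for the square is applied along the process and passes to the limit
  of large times, where the initial term disappears.\<close>

lemma stationary_slow_mode_le:
  assumes \<theta>: "0 < \<theta>"
  shows "measure_pmf.prob (ssep_stationary N p q) {\<zeta> \<in> configs N. \<theta> \<le> slow_mode N p q \<zeta>} \<le> 4 * real N / \<theta>\<^sup>2"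
proof -
  let ?G = "slow_mode N p q" and ?A = "{\<zeta> \<in> configs N. \<theta> \<le> slow_mode N p q \<zeta>}"
    and ?Q = "skel N p q" and ?k = "2 * skappa N - 1"
  have N1: "1 \<le> N" and p': "0 \<le> p" "p \<le> 1" and q': "0 \<le> q" "q \<le> 1" using N p q by auto
  define \<eta> where "\<eta> = (restrict (\<lambda>_. 0) {1..N} :: config)"
  have \<eta>: "\<eta> \<in> configs N" unfolding \<eta>_def by (rule configs_nonempty)
  have k1: "?k < 1" "0 \<le> ?k" using gap_bounds[OF N] by auto
  have ind: "indicator ?A \<zeta> \<le> 1 / \<theta>\<^sup>2 * (?G \<zeta>)\<^sup>2 + 0 * 0" for \<zeta>
  proof (cases "\<zeta> \<in> ?A")
    case True
    then have "\<theta>\<^sup>2 \<le> (?G \<zeta>)\<^sup>2" using \<theta> by (intro power_mono) auto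
    then show ?thesis using True \<theta> by (simp add: field_simps)
  qed (use \<theta> in auto)
  have step: "(?Q ^^ n) (indicator ?A) \<eta> \<le> (?G \<eta>)\<^sup>2 / \<theta>\<^sup>2 * ?k ^ n + 4 * real N / \<theta>\<^sup>2" for n
  proof -
    have "(?Q ^^ n) (indicator ?A) \<eta> \<le> (?Q ^^ n) (\<lambda>\<zeta>. 1 / \<theta>\<^sup>2 * (?G \<zeta>)\<^sup>2 + 0 * 0) \<eta>"
      by (intro skel_power_mono N1 p' q' ind \<eta>)
    also have "\<dots> = 1 / \<theta>\<^sup>2 * (?Q ^^ n) (\<lambda>\<zeta>. (?G \<zeta>)\<^sup>2) \<eta>"
      using skel_power_lin[of n N p q "1 / \<theta>\<^sup>2" "\<lambda>\<zeta>. (?G \<zeta>)\<^sup>2" 0 "\<lambda>_. 0" \<eta>] by simp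
    also have "\<dots> \<le> 1 / \<theta>\<^sup>2 * ((?G \<eta>)\<^sup>2 * ?k ^ n + 4 * real N)"
      by (intro mult_left_mono skel_power_slow_mode_square N p q \<eta>) simp
    finally show ?thesis by (simp add: add_divide_distrib distrib_left)
  qed
  have "((\<lambda>t. (?G \<eta>)\<^sup>2 / \<theta>\<^sup>2 * exp (- (2 * real N ^ 3 * t * (1 - ?k))) + 4 * real N / \<theta>\<^sup>2) \<longlongrightarrow> 0 + 4 * real N / \<theta>\<^sup>2) at_top"
    by (intro tendsto_add tendsto_const exponential_tendsto_0[OF N1 k1(1)])
  moreover have "((\<lambda>t. law (ssep_generator N p q) t \<eta> ?A) \<longlongrightarrow> measure_pmf.prob (ssep_stationary N p q) ?A) at_top"
    by (rule law_tendsto_invariant[OF N1 p' q' _ _ indicator_contraction stationary_invariant \<eta>])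
       (use gap_bounds[OF N] in auto)
  moreover have "\<forall>\<^sub>F t in at_top. law (ssep_generator N p q) t \<eta> ?A
      \<le> (?G \<eta>)\<^sup>2 / \<theta>\<^sup>2 * exp (- (2 * real N ^ 3 * t * (1 - ?k))) + 4 * real N / \<theta>\<^sup>2"
    unfolding law_def
    by (intro eventually_mono[OF eventually_ge_at_top[of 0]] semigroup_le_geometric N1 p' q' \<eta> step)
  ultimately show ?thesis
    using tendsto_le[OF trivial_limit_at_top_linorder] by fastforce
qed

text \<open>Both tails cost \<open>16 * N / m^2\<close>, and the square of the initial value brings
  \<open>64 / ((p + q)^2 * N^2)\<close>; this is \<open>2048 = 2 * 16 * 64\<close>.\<close>

lemma ssep_distance_ge_slow_mode:
  assumes "0 \<le> t"
  shows "1 - 2048 / ((p + q)\<^sup>2 * real N) * exp (2 * pi\<^sup>2 * t) \<le> ssep_distance N p q t"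
proof -
  define \<eta> where "\<eta> = (restrict (\<lambda>_. 0) {1..N} :: config)"
  have \<eta>: "\<eta> \<in> configs N" unfolding \<eta>_def by (rule configs_nonempty)
  define m where "m = exp (- gap * t) * slow_mode N p q \<eta>"
  define m0 where "m0 = exp (- pi\<^sup>2 * t) * ((p + q) * real N / 8)"
  have m0: "0 < m0" using N p q by (simp add: m0_def)
  have "m0 \<le> m"
    unfolding m0_def m_def
  proof (intro mult_mono)
    show "(p + q) * real N / 8 \<le> slow_mode N p q \<eta>" unfolding \<eta>_def by (rule slow_mode_initial)
    have "gap * t \<le> pi\<^sup>2 * t" using gap_bounds(4)[OF N] assms by (rule mult_right_mono)
    then show "exp (- pi\<^sup>2 * t) \<le> exp (- gap * t)" by simp
  qed (use p q in auto)
  then have m: "0 < m" "m0\<^sup>2 \<le> m\<^sup>2" using m0 by (auto intro: power_mono)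
  let ?A = "{\<zeta> \<in> configs N. m / 2 \<le> slow_mode N p q \<zeta>}"
  have "1 - 16 * real N / m\<^sup>2 \<le> law (ssep_generator N p q) t \<eta> ?A"
    by (rule law_slow_mode_ge[OF \<eta> assms m_def m(1)])
  moreover have "measure_pmf.prob (ssep_stationary N p q) ?A \<le> 4 * real N / (m / 2)\<^sup>2"
    using m(1) by (intro stationary_slow_mode_le) simp
  moreover have "4 * real N / (m / 2)\<^sup>2 = 16 * real N / m\<^sup>2" by (simp add: power_divide)
  moreover have "\<bar>law (ssep_generator N p q) t \<eta> ?A - measure_pmf.prob (ssep_stationary N p q) ?A\<bar> \<le> ssep_distance N p q t"
    by (rule ssep_distance_ge[OF \<eta>]) auto
  moreover have "16 * real N / m\<^sup>2 \<le> 16 * real N / m0\<^sup>2"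
    using m m0 by (intro divide_left_mono) auto
  moreover have "2 * (16 * real N / m0\<^sup>2) = 2048 / ((p + q)\<^sup>2 * real N) * exp (2 * pi\<^sup>2 * t)"
  proof -
    have "m0\<^sup>2 = exp (- pi\<^sup>2 * t + - pi\<^sup>2 * t) * ((p + q) * real N / 8)\<^sup>2"
      unfolding m0_def power_mult_distrib exp_add by (simp add: power2_eq_square)
    also have "- pi\<^sup>2 * t + - pi\<^sup>2 * t = - (2 * pi\<^sup>2 * t)" by simp
    also have "exp (- (2 * pi\<^sup>2 * t)) = 1 / exp (2 * pi\<^sup>2 * t)" by (simp only: exp_minus inverse_eq_divide)
    finally have "m0\<^sup>2 = 1 / exp (2 * pi\<^sup>2 * t) * ((p + q)\<^sup>2 * (real N)\<^sup>2 / 64)"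
      by (simp add: power_mult_distrib power_divide)
    then show ?thesis using N by (simp add: power2_eq_square[of "real N"])
  qed
  ultimately show ?thesis by linarith
qed

text \<open>The gap may fall short of \<open>pi^2\<close> by the factor \<open>1 - 3 / N\<close>. On
  the main term this loses at most 3/2, which the summand 3/2 restores; on the constant it loses at
  most one half, which the factor 2 restores.\<close>

lemma ssep_distance_le_eps:
  assumes \<epsilon>: "0 < \<epsilon>" "\<epsilon> < 1"
  defines "t0 \<equiv> ln (real N) / (2 * pi\<^sup>2) + 2 * (ln (osc_const p q / \<epsilon>) + 3 / 2) / pi\<^sup>2"
  shows "0 \<le> t0" and "ssep_distance N p q t0 \<le> \<epsilon>"
proof -
  define C where "C = osc_const p q"
  have C: "1 \<le> C" unfolding C_def by (rule osc_const_ge_1[OF p q])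
  define l where "l = ln (C / \<epsilon>)"
  have l: "0 \<le> l" unfolding l_def using C \<epsilon> by (intro ln_ge_zero) (simp add: field_simps)
  have Np: "0 < real N" "6 \<le> real N" using N by auto
  have lnN: "0 \<le> ln (real N)" "ln (real N) \<le> real N" using Np ln_le_minus_one[of "real N"] by auto
  show t0: "0 \<le> t0" unfolding t0_def C_def[symmetric] l_def[symmetric] using lnN l by (intro add_nonneg_nonneg divide_nonneg_nonneg) auto
  have pt0: "pi\<^sup>2 * t0 = ln (real N) / 2 + 2 * (l + 3 / 2)"
    unfolding t0_def C_def[symmetric] l_def[symmetric] by (simp add: distrib_left add_divide_distrib)
  have "ln (real N) / 2 + l \<le> (1 - 3 / real N) * (ln (real N) / 2 + 2 * (l + 3 / 2))"
  proof -
    have "3 / real N * ln (real N) \<le> 3 / real N * real N" using lnN Np by (intro mult_left_mono) auto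
    then have 1: "3 / real N * ln (real N) \<le> 3" using Np by simp
    define w where "w = 3 / real N"
    define A where "A = w * ln (real N)"
    define B where "B = (1 - w) * (2 * (l + 3 / 2))"
    have "w \<le> 1 / 2" using Np by (simp add: w_def field_simps)
    then have "1 / 2 * (2 * (l + 3 / 2)) \<le> B"
      unfolding B_def using l by (intro mult_right_mono) auto
    then have "l + 3 / 2 \<le> B" by simp
    moreover have "A \<le> 3" unfolding A_def w_def by (rule 1)
    ultimately have "ln (real N) / 2 + l \<le> ln (real N) / 2 - A / 2 + B" by linarith
    also have "ln (real N) / 2 - A / 2 + B = (1 - w) * (ln (real N) / 2 + 2 * (l + 3 / 2))"
      unfolding A_def B_def by (simp add: left_diff_distrib distrib_left)
    finally show ?thesis by (simp only: w_def)
  qed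
  also have "\<dots> = pi\<^sup>2 * (1 - 3 / real N) * t0" unfolding pt0[symmetric] by simp
  also have "\<dots> \<le> gap * t0" using gap_bounds(5)[OF N] t0 by (rule mult_right_mono)
  finally have g: "ln (real N) / 2 + l \<le> gap * t0" .
  have "ssep_distance N p q t0 \<le> C * sqrt (real N) * exp (- gap * t0)"
    unfolding C_def by (rule ssep_distance_le[OF t0])
  also have "\<dots> \<le> C * sqrt (real N) * exp (- (ln (real N) / 2) + - l)"
    using g C by (intro mult_left_mono) auto
  also have "exp (- (ln (real N) / 2) + - l) = (1 / sqrt (real N)) * (\<epsilon> / C)"
  proof -
    have "exp (ln (real N) / 2) = sqrt (real N)"
      using Np by (simp add: ln_sqrt[symmetric])
    moreover have "exp l = C / \<epsilon>" unfolding l_def using C \<epsilon> by (intro exp_ln) auto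
    ultimately show ?thesis unfolding exp_add exp_minus by (simp add: inverse_eq_divide)
  qed
  also have "C * sqrt (real N) * ((1 / sqrt (real N)) * (\<epsilon> / C)) = \<epsilon>" using C Np by simp
  finally show "ssep_distance N p q t0 \<le> \<epsilon>" .
qed

lemma ssep_mixing_time_le:
  assumes "0 < \<epsilon>" "\<epsilon> < 1"
  shows "ssep_mixing_time N p q \<epsilon> \<le> ln (real N) / (2 * pi\<^sup>2) + 2 * (ln (osc_const p q / \<epsilon>) + 3 / 2) / pi\<^sup>2"
  unfolding ssep_mixing_time_def using ssep_distance_le_eps[OF assms]
  by (intro cInf_lower) (auto intro: bdd_belowI[of _ 0])

text \<open>4096 is twice 2048: before the claimed time the loss in the lower bound is at most half
  of \<open>1 - \<epsilon>\<close>, so the distance still exceeds \<open>\<epsilon>\<close>.\<close>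

lemma ssep_mixing_time_ge:
  assumes \<epsilon>: "0 < \<epsilon>" "\<epsilon> < 1"
  shows "ln (real N) / (2 * pi\<^sup>2) - ln (4096 / ((p + q)\<^sup>2 * (1 - \<epsilon>))) / (2 * pi\<^sup>2) \<le> ssep_mixing_time N p q \<epsilon>"
proof -
  have Np: "0 < real N" using N by simp
  define D where "D = 4096 / ((p + q)\<^sup>2 * (1 - \<epsilon>))"
  have pq: "0 < (p + q)\<^sup>2" using p q by simp
  have D: "0 < D" unfolding D_def using pq \<epsilon> by simp
  show ?thesis
    unfolding ssep_mixing_time_def D_def[symmetric]
  proof (rule cInf_greatest)
    \<comment> \<open>The infimum of an empty set would carry no information, so the lower bound
      also relies on the time found for the upper bound.\<close>
    show "{t. 0 \<le> t \<and> ssep_distance N p q t \<le> \<epsilon>} \<noteq> {}" using ssep_distance_le_eps[OF \<epsilon>] by blast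
    fix t assume "t \<in> {t. 0 \<le> t \<and> ssep_distance N p q t \<le> \<epsilon>}"
    then have t: "0 \<le> t" "ssep_distance N p q t \<le> \<epsilon>" by auto
    show "ln (real N) / (2 * pi\<^sup>2) - ln D / (2 * pi\<^sup>2) \<le> t"
    proof (rule ccontr)
      assume "\<not> ?thesis"
      then have "t < (ln (real N) - ln D) / (2 * pi\<^sup>2)" by (simp add: diff_divide_distrib)
      then have "2 * pi\<^sup>2 * t < ln (real N) - ln D" by (simp add: pos_less_divide_eq mult.commute)
      also have "\<dots> = ln (real N / D)" using Np D by (simp add: ln_div)
      finally have "exp (2 * pi\<^sup>2 * t) < exp (ln (real N / D))" by simp
      also have "\<dots> = real N / D" using Np D by (intro exp_ln) simp
      finally have "2048 / ((p + q)\<^sup>2 * real N) * exp (2 * pi\<^sup>2 * t) \<le> 2048 / ((p + q)\<^sup>2 * real N) * (real N / D)"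
        by (intro mult_left_mono) auto
      also have "\<dots> = (1 - \<epsilon>) / 2"
      proof -
        have "2048 / (P * n) * (n / (4096 / (P * e))) = e / 2" if "0 < P" "0 < n" "0 < e" for P n e :: real
          using that by simp
        then show ?thesis unfolding D_def using pq Np \<epsilon> by simp
      qed
      finally have "1 - (1 - \<epsilon>) / 2 \<le> ssep_distance N p q t"
        using ssep_distance_ge_slow_mode[OF t(1)] by linarith
      then have "(1 + \<epsilon>) / 2 \<le> \<epsilon>" using t(2) by (simp add: diff_divide_distrib add_divide_distrib)
      then show False using \<epsilon> by simp
    qed
  qed
qed

end

theorem theorem1:
  fixes p q \<epsilon> :: real
  assumes "p \<in> {0<..<1}" and "q \<in> {0<..<1}" and "\<epsilon> \<in> {0<..<1}"
  shows "\<exists>K::real. \<forall>N::nat\<ge>1. \<bar>ssep_mixing_time N p q \<epsilon> - ln (real N) / (2 * pi\<^sup>2)\<bar> \<le> K"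
proof -
  define err where "err N = \<bar>ssep_mixing_time N p q \<epsilon> - ln (real N) / (2 * pi\<^sup>2)\<bar>" for N
  define K1 where "K1 = 2 * (ln (osc_const p q / \<epsilon>) + 3 / 2) / pi\<^sup>2"
  define K2 where "K2 = ln (4096 / ((p + q)\<^sup>2 * (1 - \<epsilon>))) / (2 * pi\<^sup>2)"
  \<comment> \<open>The finitely many \<open>N\<close> below 6 need no estimate: each error is one
    real number, and their sum dominates every one of them.\<close>
  have "err N \<le> \<bar>K1\<bar> + \<bar>K2\<bar> + (\<Sum>n<6. err n)" for N
  proof (cases "N < 6")
    case True
    then have "err N \<le> (\<Sum>n<6. err n)" by (intro member_le_sum) (auto simp: err_def)
    then show ?thesis by linarith
  next
    case False
    have "0 \<le> (\<Sum>n<6. err n)" by (intro sum_nonneg) (simp add: err_def)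
    moreover have "err N \<le> \<bar>K1\<bar> + \<bar>K2\<bar>"
      using ssep_mixing_time_le[of N p q \<epsilon>, folded K1_def] ssep_mixing_time_ge[of N p q \<epsilon>, folded K2_def] False assms
      unfolding err_def by auto
    ultimately show ?thesis by linarith
  qed
  then show ?thesis unfolding err_def by blast
qed

end
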